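(* For any integers $g\ge1$, $n\ge1$, we have $$\sum_{j=0}^{g}(-1)^j\binom{g}{j}S_{g,n+g-j}=\frac{(2^{2g-1}-1)\,g!}{2^{2g-1}\,(2g)!}\,|B_{2g}|,$$ where $B_{2g}$ is the $2g$-th Bernoulli number.
   Context: Bernoulli numbers are normalized in the standard way, $\frac{t}{e^t-1}=\sum_{m\ge0}B_m\frac{t^m}{m!}$ (e.g. $B_2=1/6$, $B_4=-1/30$). For integers $n\ge1$, $g\ge0$, an $(n,g)$-decorated tree is a rooted tree (sons of a vertex are not ordered) with two maps $\mathrm{nm}$, $\mathrm{cp}$ as follows. Every vertex has at most $2$ sons (of two adjacent vertices, the son is the one farther from the root). Let $V_0,V_1,V_2$ be the sets of vertices with $0,1,2$ sons respectively; elements of $V_0$ are called leaves. One requires $|V_0|=n$ and $|V_1|=g$ (hence $|V_2|=n-1$), and that the father of each leaf (if the leaf is not the root) has two sons. The map $\mathrm{nm}:V_0\to\{1,\dots,n\}$ is a bijection. The map $\mathrm{cp}:V_1\cup V_2\to\{1,\dots,2g+n-1\}$ satisfies: (1) $\mathrm{cp}$ is injective; (2) if $a\in\mathrm{cp}(V_1)$, then $a>1$ and $a-1\notin\mathrm{cp}(V_1\cup V_2)$; (3) if $v$ is a descendant of $v'$, then $\mathrm{cp}(v)>\mathrm{cp}(v')$. Decorated trees are considered up to isomorphism of rooted trees preserving $\mathrm{nm}$ and $\mathrm{cp}$. For $v\in V_1\cup V_2$ let $\mathrm{ml}(v)$ be the number of descendants of $v$ in $V_0$. For an $(n,g)$-decorated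 tree $\Gamma$ put $$N(\Gamma)=\frac{1}{n^{\,n+g-1}}\prod_{v\in V_2}\frac{\mathrm{ml}(v)}{\mathrm{cp}(v)}\prod_{v\in V_1}\frac{\mathrm{ml}(v)^3-\mathrm{ml}(v)}{12\,\mathrm{cp}(v)},$$ and $S_{g,n}=\sum_\Gamma N(\Gamma)$, the sum being over all (isomorphism classes of) $(n,g)$-decorated trees. Empty products equal $1$ and empty sums equal $0$ (for instance $S_{g,1}=0$ for $g\ge1$). *)

theory Defs
  imports
    Complex_Main
    "HOL-Library.Multiset"
    "HOL-Computational_Algebra.Formal_Power_Series"
begin

text \<open>
  Finite rooted trees with unordered sons and a natural number attached to every vertex, up to
  label-preserving isomorphism of rooted trees: such an isomorphism class is determined by the
  label of the root and the multiset of the classes of the subtrees rooted at its sons.  The label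
  of a leaf stands for its value under nm, the label of any other vertex for its value under cp.
\<close>

datatype ltree = Vertex (label: nat) (sons: "ltree multiset")

text \<open>
  A vertex is represented by the subtree rooted at it.  Distinct vertices may carry equal
  subtrees, so the vertices form a multiset with one occurrence for each vertex.
\<close>

primrec vertices :: "ltree \<Rightarrow> ltree multiset" where
  "vertices (Vertex a M) = {#Vertex a M#} + \<Sum>\<^sub># (image_mset vertices M)"

definition vertices_with_sons :: "nat \<Rightarrow> ltree \<Rightarrow> ltree multiset" where
  "vertices_with_sons k t = {#v \<in># vertices t. size (sons v) = k#}"

definition inner_vertices :: "ltree \<Rightarrow> ltree multiset" where
  "inner_vertices t = vertices_with_sons 1 t + vertices_with_sons 2 t"

text \<open>The proper descendants of the root of a tree.\<close>

definition descendants :: "ltree \<Rightarrow> ltree multiset" where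
  "descendants v = \<Sum>\<^sub># (image_mset vertices (sons v))"

definition ml :: "ltree \<Rightarrow> nat" where
  "ml v = size {#w \<in># descendants v. sons w = {#}#}"

text \<open>
  Since multisets of labels record repetitions, the fifth condition says that nm is a bijection
  from the leaves onto \<open>{1..n}\<close>, and the seventh that cp is injective.
\<close>

definition decorated_tree :: "nat \<Rightarrow> nat \<Rightarrow> ltree \<Rightarrow> bool" where
  "decorated_tree n g t \<longleftrightarrow>
     (\<forall>v \<in># vertices t. size (sons v) \<le> 2) \<and>
     size (vertices_with_sons 0 t) = n \<and>
     size (vertices_with_sons 1 t) = g \<and>
     (\<forall>v \<in># vertices t. \<forall>w \<in># sons v. sons w = {#} \<longrightarrow> size (sons v) = 2) \<and>
     image_mset label (vertices_with_sons 0 t) = mset_set {1..n} \<and>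
     (\<forall>v \<in># inner_vertices t. label v \<in> {1..2 * g + n - 1}) \<and>
     (\<forall>a. count (image_mset label (inner_vertices t)) a \<le> 1) \<and>
     (\<forall>a \<in># image_mset label (vertices_with_sons 1 t).
        a > 1 \<and> a - 1 \<notin># image_mset label (inner_vertices t)) \<and>
     (\<forall>v' \<in># inner_vertices t. \<forall>v \<in># descendants v'. sons v \<noteq> {#} \<longrightarrow> label v > label v')"

definition tree_weight :: "nat \<Rightarrow> nat \<Rightarrow> ltree \<Rightarrow> real" where
  "tree_weight n g t = 1 / real n ^ (n + g - 1)
     * (\<Prod>v \<in># vertices_with_sons 2 t. real (ml v) / real (label v))
     * (\<Prod>v \<in># vertices_with_sons 1 t. (real (ml v) ^ 3 - real (ml v)) / (12 * real (label v)))"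

definition tree_sum :: "nat \<Rightarrow> nat \<Rightarrow> real" where
  "tree_sum g n = (\<Sum>t | decorated_tree n g t. tree_weight n g t)"

text \<open>
  The series in the denominator has zero constant term, but so has \<open>fps_X\<close>, and division of formal
  power series over a field then cancels the common factor \<open>fps_X\<close>.
\<close>

definition bernoulli :: "nat \<Rightarrow> real" where
  "bernoulli m = fact m * fps_nth (fps_X / (fps_exp 1 - 1)) m"

end

theory Submission
  imports Defs "HOL-Probability.Infinite_Product_Measure"
begin

text \<open>
  The proof identifies the sums over trees with moments of a classical statistic of random points
  on a circle, for which both the polynomial dependence on the number of points and the leading
  coefficient are visible.

  Let \<open>\<kappa>\<close> be the Green function of \<open>-d\<^sup>2/dx\<^sup>2\<close> on the functions of mean zero on the circle of
  length \<open>1\<close>, that is \<open>\<kappa>(d) = (d\<^sup>2 - \<bar>d\<bar> + 1/6) / 2\<close> for \<open>\<bar>d\<bar> \<le> 1\<close> (below: \<open>kernel\<close>).  Masses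
  \<open>\<mu>\<^sub>i\<close> at the points \<open>x\<^sub>i\<close> have the energy \<open>\<Sum>i j. \<mu>\<^sub>i \<mu>\<^sub>j \<kappa>(x\<^sub>i - x\<^sub>j)\<close>; for unit masses this is, up to
  normalization, Watson's statistic \<open>U\<^sup>2\<close> of the sample \<open>x\<close>.  If the points are independent and
  uniform, then \<open>tree_sum_eq_moment\<close> says that
  \<open>tree_sum g n = E[(energy of n unit masses - 1/12)\<^sup>g] / (2\<^sup>g g!)\<close>.

  The reason is a coalescence.  Read from the leaves towards the root, a decorated tree is a history
  of clusters: a vertex with two sons merges two clusters, a vertex with one son marks a cluster, and
  \<open>ml\<close> is the mass of the cluster concerned.  Every number in \<open>{1..2 * g + n - 1}\<close> is the label of an
  inner vertex or the predecessor of the label of a marking, so that the largest label is determined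
  by the numbers of markings and mergers.  Splitting off the event with the largest label gives the
  recursion \<open>merge_sum_rec\<close> for the sum over all histories that start from clusters of given
  masses: two clusters of masses \<open>x\<close> and \<open>y\<close> merge with weight \<open>x + y\<close>, and a cluster of mass \<open>x\<close>
  is marked with weight \<open>(x\<^sup>3 - x) / 12\<close>.  The moments of the energy obey the same recursion
  (\<open>moment_merge\<close>).  Indeed, integrate by parts in the position of each mass against the force that
  the other masses exert on it; the force jumps where two masses meet, and so the boundary terms are
  configurations in which these two masses are merged.  The remaining term contains the squared
  forces, and \<open>energy_dissipation\<close> expresses them by the energy and the sum of the cubes of the
  masses.  (This is the balance of energy in Burgers' equation: a shock of height \<open>m\<close> dissipates
  energy at the rate \<open>m\<^sup>3 / 12\<close>.)

  The \<open>g\<close>-th difference in \<open>n\<close> becomes an alternating sum over the subsets of \<open>g\<close> chosen points,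
  which keeps from the expansion of the \<open>g\<close>-th power of the energy only the products in which all the
  chosen points occur.  As \<open>\<kappa>\<close> has mean zero, a product has expectation zero if some point occurs in
  it once only.  Since there are \<open>2 * g\<close> places, what is left is the coefficient in which each of the
  chosen points occurs exactly twice; there the factors form cycles, and a cycle through \<open>l\<close> points
  contributes the \<open>l\<close>-fold convolution power of \<open>\<kappa>\<close> at \<open>0\<close>, which is \<open>\<bar>B\<^bsub>2l\<^esub>\<bar> / (2l)!\<close>.  Opening a
  cycle turns this into the recursion for the coefficients of \<open>(t/2) / sin (t/2)\<close>, which are the
  numbers \<open>(2\<^bsup>2g-1\<^esup> - 1) \<bar>B\<^bsub>2g\<^esub>\<bar> / (2\<^bsup>2g-1\<^esup> (2g)!)\<close> of the statement.
\<close>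

section \<open>The power series of the Bernoulli numbers\<close>

definition bernoulli_fps :: "real fps" where
  "bernoulli_fps = fps_X / (fps_exp 1 - 1)"

definition bern :: "nat \<Rightarrow> real" where
  "bern m = fps_nth bernoulli_fps m"

lemma bernoulli_eq_bern: "bernoulli m = fact m * bern m"
  by (simp add: bernoulli_def bern_def bernoulli_fps_def)

lemma fps_exp_minus_1_nonzero: "fps_exp 1 - 1 \<noteq> (0 :: real fps)"
proof
  assume "fps_exp 1 - 1 = (0 :: real fps)"
  then have "fps_nth (fps_exp 1 - 1 :: real fps) 1 = 0" by (metis fps_zero_nth)
  then show False by simp
qed

lemma bernoulli_fps_times: "bernoulli_fps * (fps_exp 1 - 1) = fps_X"
proof -
  have "subdegree (fps_exp 1 - 1 :: real fps) \<le> 1"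
    by (rule subdegree_leI) simp
  then have "(fps_exp 1 - 1 :: real fps) dvd fps_X"
    by (subst fps_dvd_iff) (auto simp: fps_exp_minus_1_nonzero)
  then show ?thesis
    unfolding bernoulli_fps_def by simp
qed

lemma bern_rec: "(\<Sum>j<m. bern j / fact (m - j)) = (if m = 1 then 1 else 0)"
proof -
  have "fps_nth (bernoulli_fps * (fps_exp 1 - 1)) m = (if m = 1 then 1 else 0)"
    by (subst bernoulli_fps_times) (simp add: fps_X_def)
  also have "fps_nth (bernoulli_fps * (fps_exp 1 - 1)) m
      = (\<Sum>j=0..m. bern j * (1 / fact (m - j) - (if m - j = 0 then 1 else 0)))"
    unfolding fps_mult_nth bern_def by simp
  also have "\<dots> = (\<Sum>j<m. bern j * (1 / fact (m - j) - (if m - j = 0 then 1 else 0)))"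
    by (simp add: atLeast0AtMost flip: lessThan_Suc_atMost)
  also have "\<dots> = (\<Sum>j<m. bern j / fact (m - j))"
    by (rule sum.cong) auto
  finally show ?thesis .
qed

lemma bern_0: "bern 0 = 1"
  using bern_rec[of 1] by simp

lemma bern_1: "bern (Suc 0) = - 1 / 2"
  using bern_rec[of 2] by (simp add: lessThan_Suc numeral_2_eq_2 bern_0)

text \<open>
  Differentiate \<open>B(t) (e\<^sup>t - 1) = t\<close> and multiply by \<open>B\<close>.  The resulting quadratic recursion yields at
  once that the odd coefficients vanish from the third one on and that the even ones alternate in sign.
\<close>

lemma bernoulli_fps_riccati:
  "fps_X * fps_deriv bernoulli_fps = bernoulli_fps - bernoulli_fps\<^sup>2 - fps_X * bernoulli_fps"
proof -
  let ?B = bernoulli_fps and ?E = "fps_exp 1 :: real fps"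
  have BE: "?B * ?E = ?B + fps_X"
    using bernoulli_fps_times by (simp add: algebra_simps)
  have "fps_deriv (?B * ?E) = fps_deriv (?B + fps_X)" by (simp add: BE)
  then have D: "fps_deriv ?B * (?E - 1) = 1 - ?B * ?E" by (simp add: algebra_simps)
  have "fps_X * fps_deriv ?B = ?B * (fps_deriv ?B * (?E - 1))"
    by (metis bernoulli_fps_times mult.assoc mult.commute)
  also have "\<dots> = ?B - ?B * (?B + fps_X)"
    unfolding D BE by (simp add: algebra_simps)
  finally show ?thesis by (simp add: algebra_simps power2_eq_square)
qed

lemma bern_convolution:
  assumes "m \<ge> 3"
  shows "real (m + 1) * bern m = - (\<Sum>i=2..m-2. bern i * bern (m - i))"
proof -
  have *: "fps_nth (fps_X * fps_deriv bernoulli_fps) m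
      = fps_nth (bernoulli_fps - bernoulli_fps\<^sup>2 - fps_X * bernoulli_fps) m"
    by (simp only: bernoulli_fps_riccati)
  have "real m * bern m = bern m - (\<Sum>i=0..m. bern i * bern (m - i)) - bern (m - 1)"
  proof -
    have "fps_nth (bernoulli_fps\<^sup>2) m = (\<Sum>i=0..m. bern i * bern (m - i))"
      by (simp add: fps_mult_nth power2_eq_square bern_def)
    moreover have "fps_nth (fps_X * fps_deriv bernoulli_fps) m = real m * bern m"
      using assms by (cases m) (simp_all add: bern_def)
    moreover have "fps_nth (fps_X * bernoulli_fps) m = bern (m - 1)"
      using assms by (simp add: bern_def)
    ultimately show ?thesis
      using * by (simp add: bern_def)
  qed
  moreover have "(\<Sum>i=0..m. bern i * bern (m - i))
      = 2 * bern m - bern (m - 1) + (\<Sum>i=2..m-2. bern i * bern (m - i))"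
  proof -
    have "{0..m} = {0, 1, m - 1, m} \<union> {2..m-2}" using assms by auto
    moreover have "(\<Sum>i\<in>{0, 1, m - 1, m}. bern i * bern (m - i)) = 2 * bern m - bern (m - 1)"
      using assms by (simp add: bern_0 bern_1)
    ultimately show ?thesis
      using assms by (simp only:) (subst sum.union_disjoint, auto)
  qed
  ultimately show ?thesis by (simp add: algebra_simps)
qed

lemma bern_odd: "odd m \<Longrightarrow> m \<ge> 3 \<Longrightarrow> bern m = 0"
proof (induction m rule: less_induct)
  case (less m)
  have "(\<Sum>i=2..m-2. bern i * bern (m - i)) = 0"
  proof (rule sum.neutral, rule ballI)
    fix i assume i: "i \<in> {2..m-2}"
    show "bern i * bern (m - i) = 0"
    proof (cases "odd i")
      case True
      then have "i \<ge> 3" using i by (cases "i = 2") auto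
      then show ?thesis using less.IH[of i] True i by auto
    next
      case False
      then have "odd (m - i)" using less.prems i by auto
      moreover from this have "m - i \<ge> 3" using i by (cases "m - i = 2") auto
      ultimately show ?thesis using less.IH[of "m - i"] i by auto
    qed
  qed
  then show ?case using bern_convolution[OF less.prems(2)] by auto
qed

lemma bern_even_sign:
  assumes "g \<ge> 1"
  shows "(-1) ^ (g + 1) * bern (2 * g) > 0"
  using assms
proof (induction g rule: less_induct)
  case (less g)
  show ?case
  proof (cases "g = 1")
    case True
    have "bern 2 = 1 / 12"
      using bern_rec[of 3] by (simp add: lessThan_Suc numeral_3_eq_3 numeral_2_eq_2 bern_0 bern_1)
    then show ?thesis using True by simp
  next
    case False
    with less.prems have g: "g \<ge> 2" by simp
    have "real (2 * g + 1) * ((-1) ^ (g + 1) * bern (2 * g))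
        = (-1) ^ g * (\<Sum>i=2..2*g-2. bern i * bern (2 * g - i))"
    proof -
      have "real (2 * g + 1) * bern (2 * g) = - (\<Sum>i=2..2*g-2. bern i * bern (2 * g - i))"
        using bern_convolution[of "2 * g"] g by simp
      then have "(-1) ^ (g + 1) * (real (2 * g + 1) * bern (2 * g))
          = (-1) ^ (g + 1) * - (\<Sum>i=2..2*g-2. bern i * bern (2 * g - i))" by (simp only:)
      then show ?thesis by (simp only: mult.left_commute) simp
    qed
    also have "(\<Sum>i=2..2*g-2. bern i * bern (2 * g - i))
        = (\<Sum>i\<in>(*) 2 ` {1..g-1}. bern i * bern (2 * g - i))"
    proof (rule sum.mono_neutral_right)
      show "(*) 2 ` {1..g-1} \<subseteq> {2..2*g-2}" by auto
      show "\<forall>i\<in>{2..2*g-2} - (*) 2 ` {1..g-1}. bern i * bern (2 * g - i) = 0"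
      proof
        fix i assume i: "i \<in> {2..2*g-2} - (*) 2 ` {1..g-1}"
        have "odd i"
        proof
          assume "even i"
          then obtain k where "i = 2 * k" by (auto elim: evenE)
          moreover from this have "k \<in> {1..g-1}" using i by auto
          ultimately show False using i by auto
        qed
        moreover from this have "i \<ge> 3" using i by (cases "i = 2") auto
        ultimately show "bern i * bern (2 * g - i) = 0" by (simp add: bern_odd)
      qed
    qed auto
    also have "\<dots> = (\<Sum>k=1..g-1. bern (2 * k) * bern (2 * (g - k)))"
      by (subst sum.reindex) (auto simp: inj_on_def diff_mult_distrib2)
    also have "(-1) ^ g * \<dots>
        = (\<Sum>k=1..g-1. ((-1) ^ (k + 1) * bern (2 * k)) * ((-1) ^ (g - k + 1) * bern (2 * (g - k))))"
      unfolding sum_distrib_left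
    proof (rule sum.cong)
      fix k assume k: "k \<in> {1..g-1}"
      then have "k + 1 + (g - k + 1) = g + 2" by auto
      then have "(-1 :: real) ^ g = (-1) ^ (k + 1) * (-1) ^ (g - k + 1)"
        by (simp only: flip: power_add) simp
      then show "(-1) ^ g * (bern (2 * k) * bern (2 * (g - k)))
          = ((-1) ^ (k + 1) * bern (2 * k)) * ((-1) ^ (g - k + 1) * bern (2 * (g - k)))"
        by simp
    qed simp
    also have "\<dots> > 0"
    proof (rule sum_pos)
      fix k assume k: "k \<in> {1..g-1}"
      then have "(-1) ^ (k + 1) * bern (2 * k) > 0" "(-1) ^ (g - k + 1) * bern (2 * (g - k)) > 0"
        using less.IH[of k] less.IH[of "g - k"] g by auto
      then show "((-1) ^ (k + 1) * bern (2 * k)) * ((-1) ^ (g - k + 1) * bern (2 * (g - k))) > 0"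
        by (rule mult_pos_pos)
    qed (use g in auto)
    finally have "real (2 * g + 1) * ((-1) ^ (g + 1) * bern (2 * g)) > 0" .
    then show ?thesis by (rule zero_less_mult_pos) simp
  qed
qed

corollary abs_bernoulli_even:
  assumes "g \<ge> 1"
  shows "\<bar>bernoulli (2 * g)\<bar> = (-1) ^ (g + 1) * fact (2 * g) * bern (2 * g)"
proof -
  have "\<bar>bern (2 * g)\<bar> = \<bar>(-1) ^ (g + 1) * bern (2 * g)\<bar>"
    by (simp add: abs_mult power_abs)
  also have "\<dots> = (-1) ^ (g + 1) * bern (2 * g)"
    using bern_even_sign[OF assms] by simp
  finally show ?thesis by (simp add: bernoulli_eq_bern abs_mult)
qed

text \<open>
  The coefficients of \<open>(t/2) / sinh (t/2) = e\<^bsup>t/2\<^esup> B(t)\<close>, as \<open>csch_fps\<close> shows.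
\<close>

definition csch_coeff :: "nat \<Rightarrow> real" where
  "csch_coeff m = (2 * (1 / 2) ^ m - 1) * bern m"

text \<open>
  With \<open>u = e\<^bsup>t/2\<^esup>\<close> the identity is \<open>u / (u\<^sup>2 - 1) = 1 / (u - 1) - 1 / (u\<^sup>2 - 1)\<close> multiplied by \<open>t\<close>, where
  \<open>t / (u - 1) = 2 B(t/2)\<close>.
\<close>

lemma csch_fps:
  "Abs_fps csch_coeff = fps_exp (1/2) * bernoulli_fps"
proof -
  let ?B = bernoulli_fps and ?E = "fps_exp 1 :: real fps" and ?R = "fps_exp (1/2) :: real fps"
  define H where "H = Abs_fps (\<lambda>m. (1/2) ^ m * bern m)"
  have RR: "?R * ?R = ?E" by (simp flip: fps_exp_add_mult)
  have "H * (?R - 1) = fps_const (1/2) * fps_X"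
  proof (rule fps_ext)
    fix m
    have "fps_nth (H * (?R - 1)) m
        = (1/2) ^ m * (\<Sum>j=0..m. bern j * fps_nth (?E - 1) (m - j))"
      unfolding fps_mult_nth sum_distrib_left
    proof (rule sum.cong)
      fix j assume "j \<in> {0..m}"
      then have p: "(1/2) ^ m = (1/2 :: real) ^ j * (1/2) ^ (m - j)" by (simp flip: power_add)
      show "fps_nth H j * fps_nth (?R - 1) (m - j)
          = (1/2) ^ m * (bern j * fps_nth (?E - 1) (m - j))"
        unfolding p by (simp add: H_def)
    qed simp
    also have "(\<Sum>j=0..m. bern j * fps_nth (?E - 1) (m - j)) = fps_nth (?B * (?E - 1)) m"
      by (simp add: fps_mult_nth bern_def)
    also have "(1/2) ^ m * \<dots> = fps_nth (fps_const (1/2) * fps_X) m"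
      unfolding bernoulli_fps_times by (simp add: fps_X_def)
    finally show "fps_nth (H * (?R - 1)) m = fps_nth (fps_const (1/2) * fps_X) m" .
  qed
  then have "2 * (H * (?R - 1)) = 2 * (fps_const (1/2) * fps_X)" by simp
  also have "\<dots> = fps_X" by (rule fps_ext) (simp add: fps_numeral_fps_const)
  finally have H: "2 * H * (?R - 1) = fps_X" by (simp add: mult.assoc)
  have "(2 * H - ?B) * (?E - 1) = 2 * H * (?R - 1) * (?R + 1) - ?B * (?E - 1)"
    unfolding RR[symmetric] by (simp add: algebra_simps)
  also have "\<dots> = ?R * fps_X" unfolding H bernoulli_fps_times by (simp add: algebra_simps)
  also have "\<dots> = ?R * ?B * (?E - 1)" by (simp add: mult.assoc bernoulli_fps_times)
  finally have "2 * H - ?B = ?R * ?B" using fps_exp_minus_1_nonzero by simp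
  moreover have "Abs_fps csch_coeff = 2 * H - ?B"
    by (rule fps_ext) (simp add: csch_coeff_def H_def bern_def algebra_simps fps_numeral_fps_const)
  ultimately show ?thesis by simp
qed

lemma csch_coeff_0: "csch_coeff 0 = 1"
  by (simp add: csch_coeff_def bern_0)

text \<open>
  For \<open>S = e\<^bsup>t/2\<^esup> B\<close> the Riccati equation gives \<open>t S' = S (1 - B - t/2)\<close>, the logarithmic derivative of
  \<open>(t/2) / sinh (t/2)\<close>.
\<close>

lemma csch_coeff_rec:
  assumes "g \<ge> 1"
  shows "real (2 * g) * csch_coeff (2 * g)
    = - (\<Sum>l=1..g. bern (2 * l) * csch_coeff (2 * (g - l)))"
proof -
  let ?B = bernoulli_fps and ?R = "fps_exp (1/2) :: real fps" and ?S = "Abs_fps csch_coeff"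
  have "fps_X * fps_deriv ?S = fps_const (1/2) * fps_X * ?S + ?R * (fps_X * fps_deriv ?B)"
    unfolding csch_fps by (simp add: algebra_simps)
  also have "\<dots> = ?S - fps_const (1/2) * fps_X * ?S - ?B * ?S"
  proof -
    have h: "fps_const (1/2) + fps_const (1/2) = (1 :: real fps)" by simp
    have "fps_const (1/2) * (fps_X * ?S) + fps_const (1/2) * (fps_X * ?S) = fps_X * ?S"
      by (metis distrib_right h mult_1)
    then show ?thesis
      unfolding bernoulli_fps_riccati csch_fps by (simp add: algebra_simps power2_eq_square)
  qed
  finally have *: "fps_nth (fps_X * fps_deriv ?S) (2 * g)
      = fps_nth (?S - fps_const (1/2) * fps_X * ?S - ?B * ?S) (2 * g)" by simp
  have "real (2 * g) * csch_coeff (2 * g) = csch_coeff (2 * g) - csch_coeff (2 * g - 1) / 2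
      - (\<Sum>i=0..2*g. bern i * csch_coeff (2 * g - i))"
  proof -
    have "fps_nth (?B * ?S) (2 * g) = (\<Sum>i=0..2*g. bern i * csch_coeff (2 * g - i))"
      by (simp add: fps_mult_nth bern_def)
    moreover have "fps_nth (fps_X * fps_deriv ?S) (2 * g) = real (2 * g) * csch_coeff (2 * g)"
      using assms by (cases "2 * g") auto
    moreover have "fps_nth (fps_const (1/2) * fps_X * ?S) (2 * g) = csch_coeff (2 * g - 1) / 2"
      using assms by (simp add: mult.assoc)
    ultimately show ?thesis
      using * by simp
  qed
  also have "(\<Sum>i=0..2*g. bern i * csch_coeff (2 * g - i))
      = (\<Sum>i\<in>{0,1} \<union> (*) 2 ` {1..g}. bern i * csch_coeff (2 * g - i))"
  proof (rule sum.mono_neutral_right)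
    show "\<forall>i\<in>{0..2*g} - ({0, 1} \<union> (*) 2 ` {1..g}). bern i * csch_coeff (2 * g - i) = 0"
    proof
      fix i assume i: "i \<in> {0..2*g} - ({0, 1} \<union> (*) 2 ` {1..g})"
      have "odd i"
      proof
        assume "even i"
        then obtain k where "i = 2 * k" by (auto elim: evenE)
        moreover from this have "k \<in> {1..g}" using i by auto
        ultimately show False using i by auto
      qed
      moreover from this have "i \<ge> 3" using i by (cases "i = 2") auto
      ultimately show "bern i * csch_coeff (2 * g - i) = 0" by (simp add: bern_odd)
    qed
  qed (use assms in auto)
  also have "\<dots> = csch_coeff (2 * g) - csch_coeff (2 * g - 1) / 2
      + (\<Sum>i\<in>(*) 2 ` {1..g}. bern i * csch_coeff (2 * g - i))"
    by (subst sum.union_disjoint) (auto simp: bern_0 bern_1)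
  also have "(\<Sum>i\<in>(*) 2 ` {1..g}. bern i * csch_coeff (2 * g - i))
      = (\<Sum>l=1..g. bern (2 * l) * csch_coeff (2 * (g - l)))"
    by (subst sum.reindex) (auto simp: inj_on_def diff_mult_distrib2)
  finally show ?thesis by simp
qed

section \<open>Periodic Bernoulli functions\<close>

text \<open>
  The \<open>m\<close>-th Bernoulli polynomial divided by \<open>m!\<close>; in this normalization the derivative of each one is
  the previous one.
\<close>

definition bernpoly :: "nat \<Rightarrow> real \<Rightarrow> real" where
  "bernpoly m x = (\<Sum>j\<le>m. bern j * x ^ (m - j) / fact (m - j))"

text \<open>
  The extension of \<open>bernpoly m\<close> with period \<open>1\<close>, on the interval from \<open>-1\<close> to \<open>1\<close> that contains the
  differences of two points of the unit interval.
\<close>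

definition perbern :: "nat \<Rightarrow> real \<Rightarrow> real" where
  "perbern m d = bernpoly m (if d < 0 then d + 1 else d)"

lemma bernpoly_at_0: "bernpoly m 0 = bern m"
proof -
  have "bernpoly m 0 = (\<Sum>j\<le>m. if j = m then bern m else 0)"
    unfolding bernpoly_def by (rule sum.cong) (auto simp: power_0_left)
  then show ?thesis by simp
qed

lemma bernpoly_at_1: "m \<noteq> 1 \<Longrightarrow> bernpoly m 1 = bern m"
  using bern_rec[of m] by (simp add: bernpoly_def flip: lessThan_Suc_atMost)

lemma has_derivative_bernpoly:
  "(bernpoly (Suc m) has_real_derivative bernpoly m x) (at x)"
proof -
  have *: "bernpoly (Suc m) = (\<lambda>x. (\<Sum>j\<le>m. bern j * x ^ (Suc (m - j)) / fact (Suc (m - j))) + bern (Suc m))"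
    by (rule ext) (auto simp: bernpoly_def Suc_diff_le intro!: sum.cong simp del: power_Suc fact_Suc)
  have D: "((\<lambda>x. bern j * x ^ Suc (m - j) / fact (Suc (m - j))) has_real_derivative
      bern j * x ^ (m - j) / fact (m - j)) (at x)" for j
    by (rule derivative_eq_intros refl | simp del: power_Suc)+
  have "((\<lambda>x. \<Sum>j\<le>m. bern j * x ^ Suc (m - j) / fact (Suc (m - j))) has_real_derivative
      (\<Sum>j\<le>m. bern j * x ^ (m - j) / fact (m - j))) (at x)"
    by (rule DERIV_sum[OF D])
  from DERIV_add[OF this DERIV_const[of "bern (Suc m)"]] show ?thesis
    unfolding * bernpoly_def by (simp only: add_0_right)
qed

lemma continuous_on_bernpoly: "continuous_on S (bernpoly m)"
  unfolding bernpoly_def by (intro continuous_intros) auto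

lemma perbern_of_nonneg: "d \<ge> 0 \<Longrightarrow> perbern m d = bernpoly m d"
  by (simp add: perbern_def)

lemma perbern_of_nonpos: "m \<noteq> 1 \<Longrightarrow> d \<le> 0 \<Longrightarrow> perbern m d = bernpoly m (d + 1)"
  by (cases "d = 0") (auto simp: perbern_def bernpoly_at_0 bernpoly_at_1)

lemma continuous_on_perbern:
  assumes "m \<noteq> 1"
  shows "continuous_on UNIV (perbern m)"
proof -
  have "continuous_on ({..0} \<union> {0..}) (perbern m)"
  proof (rule continuous_on_closed_Un)
    have "continuous_on {..0} (\<lambda>d. bernpoly m (d + 1))"
      by (intro continuous_on_compose2[OF continuous_on_bernpoly[of UNIV]] continuous_intros) auto
    then show "continuous_on {..0} (perbern m)"
      by (rule continuous_on_eq) (use assms in \<open>auto simp: perbern_of_nonpos\<close>)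
    show "continuous_on {0..} (perbern m)"
      by (rule continuous_on_eq[OF continuous_on_bernpoly[of _ m]]) (auto simp: perbern_of_nonneg)
  qed auto
  moreover have "{..0} \<union> {0..} = (UNIV :: real set)" by auto
  ultimately show ?thesis by simp
qed

lemma perbern_period: "0 \<le> y \<Longrightarrow> y \<le> 1 \<Longrightarrow> m \<noteq> 1 \<Longrightarrow> perbern m (1 - y) = perbern m (- y)"
  by (simp add: perbern_of_nonpos perbern_of_nonneg)

lemma has_derivative_perbern:
  assumes "d \<noteq> 0"
  shows "(perbern (Suc m) has_real_derivative perbern m d) (at d)"
proof (cases "d < 0")
  case True
  have D: "((\<lambda>x. bernpoly (Suc m) (x + 1)) has_real_derivative bernpoly m (d + 1)) (at d)"
    using has_derivative_bernpoly[of m "d + 1"] by (simp add: DERIV_shift)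
  have "((\<lambda>x. bernpoly (Suc m) (x + 1)) has_real_derivative perbern m d) (at d)"
    using D True by (simp add: perbern_def)
  then show ?thesis
    by (rule has_field_derivative_transform_within_open[of _ _ _ "{..<0}"])
       (use True in \<open>auto simp: perbern_def\<close>)
next
  case False
  have "(bernpoly (Suc m) has_real_derivative perbern m d) (at d)"
    using has_derivative_bernpoly[of m d] False by (simp add: perbern_def)
  then show ?thesis
    by (rule has_field_derivative_transform_within_open[of _ _ _ "{0<..}"])
       (use False assms in \<open>auto simp: perbern_def\<close>)
qed

text \<open>
  The first of the periodic functions, but with the value \<open>0\<close> instead of \<open>- 1 / 2\<close> at the jump, so that
  no mass exerts a force on itself.
\<close>

definition sawtooth :: "real \<Rightarrow> real" where
  "sawtooth d = d - sgn d / 2"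

lemma perbern_1: "d \<noteq> 0 \<Longrightarrow> perbern (Suc 0) d = sawtooth d"
  by (auto simp: perbern_def bernpoly_def bern_0 bern_1 sawtooth_def)

definition kernel :: "real \<Rightarrow> real" where "kernel = perbern 2"

lemma kernel_eq:
  assumes "\<bar>d\<bar> \<le> 1"
  shows "kernel d = (d\<^sup>2 - \<bar>d\<bar> + 1 / 6) / 2"
proof -
  have "bern 2 = 1 / 12"
    using bern_rec[of 3] by (simp add: lessThan_Suc numeral_3_eq_3 numeral_2_eq_2 bern_0 bern_1)
  then have bernpoly_2: "bernpoly 2 d = (d\<^sup>2 - d + 1 / 6) / 2" for d
    by (simp add: bernpoly_def atMost_Suc numeral_2_eq_2 bern_0 bern_1 field_simps)
  then show ?thesis
    by (simp add: kernel_def perbern_def bernpoly_2 power2_eq_square field_simps)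
qed

lemma kernel_minus: "\<bar>d\<bar> \<le> 1 \<Longrightarrow> kernel (- d) = kernel d"
  by (simp add: kernel_eq)

lemma kernel_commute: "\<bar>x - y\<bar> \<le> 1 \<Longrightarrow> kernel (x - y) = kernel (y - x)"
  using kernel_minus[of "x - y"] by simp

lemma kernel_0: "kernel 0 = 1 / 12"
  by (simp add: kernel_eq)

lemma continuous_on_kernel: "continuous_on UNIV kernel"
  unfolding kernel_def by (rule continuous_on_perbern) simp

text \<open>
  For distinct points this is the addition law of the periodic Bernoulli functions: if \<open>P, Q, R\<close> are
  the three arcs between the points, each diminished by \<open>1 / 2\<close>, then \<open>P + Q + R = - 1 / 2\<close>, and
  squaring this relation gives the claim.  It survives the meeting of two points, whereas at a triple
  point all products of sawtooth functions vanish and the defect is \<open>3 * kernel 0\<close>.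
\<close>

lemma kernel_three_points:
  fixes x y z :: real
  assumes "x \<in> {0..1}" "y \<in> {0..1}" "z \<in> {0..1}" 
  shows "sawtooth (x - y) * sawtooth (x - z) + sawtooth (y - x) * sawtooth (y - z)
      + sawtooth (z - x) * sawtooth (z - y)
      = kernel (x - y) + kernel (y - z) + kernel (x - z) - (if x = y \<and> y = z then 1 / 4 else 0)"
proof -
  have k: "kernel (x - y) = ((x - y)\<^sup>2 - \<bar>x - y\<bar> + 1 / 6) / 2"
    "kernel (y - z) = ((y - z)\<^sup>2 - \<bar>y - z\<bar> + 1 / 6) / 2"
    "kernel (x - z) = ((x - z)\<^sup>2 - \<bar>x - z\<bar> + 1 / 6) / 2"
    using assms kernel_eq[of "x - y"] kernel_eq[of "y - z"] kernel_eq[of "x - z"]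
    by (auto simp: abs_le_iff)
  show ?thesis
    unfolding k sawtooth_def
    by (cases x y rule: linorder_cases; cases y z rule: linorder_cases; cases x z rule: linorder_cases)
       (auto simp: field_simps power2_eq_square)
qed

section \<open>Integration by parts on the circle\<close>

lemma fundamental_theorem_circle:
  fixes G G' :: "real \<Rightarrow> real"
  assumes fin: "finite S" and cont: "continuous_on {0..1} G" and per: "G 0 = G 1"
    and der: "\<And>t. t \<in> {0<..<1} - S \<Longrightarrow> (G has_real_derivative G' t) (at t)"
  shows "(G' has_integral 0) {0..1}"
  using fundamental_theorem_of_calculus_interior_strong[OF fin, of 0 1 G G'] der cont per
  by (simp add: has_real_derivative_iff_has_vector_derivative)

text \<open>
  The sawtooth function has slope \<open>1\<close> and jumps down by \<open>1\<close> at \<open>y\<close>, so that the jump contributes the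
  value at \<open>y\<close>.
\<close>

lemma integration_by_parts_circle:
  fixes G G' :: "real \<Rightarrow> real"
  assumes fin: "finite S" and cont: "continuous_on {0..1} G" and per: "G 0 = G 1"
    and der: "\<And>t. t \<in> {0<..<1} - S \<Longrightarrow> (G has_real_derivative G' t) (at t)"
    and y: "y \<in> {0..1}"
  shows "((\<lambda>t. G t + sawtooth (t - y) * G' t) has_integral G y) {0..1}"
proof -
  let ?f = "\<lambda>t. G t + sawtooth (t - y) * G' t"
  \<comment> \<open>On either side of \<open>y\<close> the sawtooth function agrees with a line off the point \<open>y\<close>.\<close>
  have "(?f has_integral (y - y + 1/2) * G y - (0 - y + 1/2) * G 0) {0..y}"
  proof (rule fundamental_theorem_of_calculus_interior_strong[of S])
    fix t assume t: "t \<in> {0<..<y} - S"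
    have "((\<lambda>t. (t - y + 1/2) * G t) has_real_derivative 1 * G t + G' t * (t - y + 1/2)) (at t)"
      using t y by (auto intro!: derivative_eq_intros der)
    then show "((\<lambda>t. (t - y + 1/2) * G t) has_vector_derivative ?f t) (at t)"
      using t by (simp add: has_real_derivative_iff_has_vector_derivative sawtooth_def mult.commute)
  qed (use y fin in \<open>auto intro!: continuous_intros continuous_on_subset[OF cont]\<close>)
  moreover have "(?f has_integral (1 - y - 1/2) * G 1 - (y - y - 1/2) * G y) {y..1}"
  proof (rule fundamental_theorem_of_calculus_interior_strong[of S])
    fix t assume t: "t \<in> {y<..<1} - S"
    have "((\<lambda>t. (t - y - 1/2) * G t) has_real_derivative 1 * G t + G' t * (t - y - 1/2)) (at t)"
      using t y by (auto intro!: derivative_eq_intros der)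
    then show "((\<lambda>t. (t - y - 1/2) * G t) has_vector_derivative ?f t) (at t)"
      using t by (simp add: has_real_derivative_iff_has_vector_derivative sawtooth_def mult.commute)
  qed (use y fin in \<open>auto intro!: continuous_intros continuous_on_subset[OF cont]\<close>)
  ultimately have "(?f has_integral ((y - y + 1/2) * G y - (0 - y + 1/2) * G 0)
      + ((1 - y - 1/2) * G 1 - (y - y - 1/2) * G y)) {0..1}"
    using y by (intro has_integral_combine[of 0 y 1]) auto
  then show ?thesis unfolding per by (simp add: algebra_simps)
qed

lemma continuous_on_perbern_diff: "m \<noteq> 1 \<Longrightarrow> continuous_on S (\<lambda>t. perbern m (t - y))"
  by (rule continuous_on_compose2[OF continuous_on_perbern]) (auto intro!: continuous_intros)

lemma perbern_diff_periodic:
  assumes "m \<noteq> 1" "y \<in> {0..1}"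
  shows "perbern m (0 - y) = perbern m (1 - y)" "perbern m (- y) = perbern m (1 - y)"
  using perbern_period[of y m] assms by simp_all

lemma has_derivative_perbern_diff:
  "t \<noteq> y \<Longrightarrow> ((\<lambda>t. perbern (Suc m) (t - y)) has_real_derivative perbern m (t - y)) (at t)"
  using has_derivative_perbern[of "t - y" m] DERIV_shift[of "perbern (Suc m)" _ t "- y"] by simp

lemma has_integral_perbern:
  assumes "m \<ge> 1" "y \<in> {0..1}"
  shows "((\<lambda>t. perbern m (t - y)) has_integral 0) {0..1}"
  by (rule fundamental_theorem_circle[of "{y}" "\<lambda>t. perbern (Suc m) (t - y)"])
     (use assms in \<open>auto simp: perbern_diff_periodic intro!: continuous_on_perbern_diff has_derivative_perbern_diff\<close>)

text \<open>
  Convolution with the Green function integrates a function of mean zero twice and changes the sign.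
\<close>

lemma has_integral_kernel_perbern:
  assumes m: "m \<ge> 2" and x: "x \<in> {0..1}" and y: "y \<in> {0..1}"
  shows "((\<lambda>t. kernel (x - t) * perbern m (t - y)) has_integral - perbern (m + 2) (x - y)) {0..1}"
proof -
  let ?P = "\<lambda>m t. perbern m (t - y)"
  \<comment> \<open>The integrals of \<open>?P (m + 2) + sawtooth * ?P (m + 1)\<close>, of \<open>?P (m + 2)\<close> and of
    \<open>sawtooth * ?P (m + 1) + kernel * ?P m\<close> are known, and the claim is a combination of them.\<close>
  have 1: "((\<lambda>t. ?P (m + 2) t + sawtooth (t - x) * ?P (m + 1) t) has_integral ?P (m + 2) x) {0..1}"
    by (rule integration_by_parts_circle[of "{y}"])
       (use m x y has_derivative_perbern_diff[of _ y "Suc m"] in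
        \<open>auto simp: perbern_diff_periodic intro!: continuous_on_perbern_diff\<close>)
  have 2: "((\<lambda>t. ?P (m + 2) t) has_integral 0) {0..1}"
    by (rule has_integral_perbern) (use y in auto)
  have 3: "((\<lambda>t. sawtooth (t - x) * ?P (m + 1) t + kernel (t - x) * ?P m t) has_integral 0) {0..1}"
  proof (rule fundamental_theorem_circle[of "{x, y}" "\<lambda>t. kernel (t - x) * ?P (m + 1) t"])
    fix t assume t: "t \<in> {0<..<1} - {x, y}"
    have "((\<lambda>t. kernel (t - x)) has_real_derivative sawtooth (t - x)) (at t)"
      using t has_derivative_perbern_diff[of t x "Suc 0"]
      by (auto simp: kernel_def numeral_2_eq_2 perbern_1)
    then show "((\<lambda>t. kernel (t - x) * ?P (m + 1) t) has_real_derivative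
        sawtooth (t - x) * ?P (m + 1) t + kernel (t - x) * ?P m t) (at t)"
      using t has_derivative_perbern_diff[of t y m]
      by (auto intro!: derivative_eq_intros)
  next
    show "continuous_on {0..1} (\<lambda>t. kernel (t - x) * ?P (m + 1) t)"
      unfolding kernel_def by (intro continuous_intros continuous_on_perbern_diff) (use m in auto)
    show "kernel (0 - x) * ?P (m + 1) 0 = kernel (1 - x) * ?P (m + 1) 1"
      unfolding kernel_def using m x y by (simp add: perbern_diff_periodic)
  qed simp
  have "((\<lambda>t. kernel (t - x) * ?P m t) has_integral - ?P (m + 2) x) {0..1}"
    using has_integral_add[OF has_integral_diff[OF 3 1] 2] by (simp add: algebra_simps)
  then show ?thesis
    by (rule has_integral_eq[rotated]) (use x kernel_commute in auto)
qed

text \<open>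
  The \<open>l\<close>-fold convolution power of \<open>kernel\<close> on the circle; see \<open>has_integral_kernel_convolution\<close>.
\<close>

definition kernel_power :: "nat \<Rightarrow> real \<Rightarrow> real" where
  "kernel_power l d = (-1) ^ (l + 1) * perbern (2 * l) d"

lemma kernel_power_1: "kernel_power (Suc 0) = kernel"
  by (rule ext) (simp add: kernel_power_def kernel_def numeral_2_eq_2)

lemma kernel_power_0: "kernel_power l 0 = (-1) ^ (l + 1) * bern (2 * l)"
  by (simp add: kernel_power_def perbern_of_nonneg bernpoly_at_0)

lemma has_integral_kernel_convolution:
  assumes "l \<ge> 1" "x \<in> {0..1}" "y \<in> {0..1}"
  shows "((\<lambda>t. kernel (x - t) * kernel_power l (t - y)) has_integral kernel_power (Suc l) (x - y)) {0..1}"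
proof -
  have "((\<lambda>t. (-1) ^ (l + 1) * (kernel (x - t) * perbern (2 * l) (t - y)))
      has_integral (-1) ^ (l + 1) * - perbern (2 * l + 2) (x - y)) {0..1}"
    by (intro has_integral_mult_right has_integral_kernel_perbern) (use assms in auto)
  then show ?thesis by (simp add: kernel_power_def mult_ac)
qed

section \<open>Independent uniform points\<close>

definition unit_uniform :: "real measure" where
  "unit_uniform = restrict_space lborel {0..1}"

text \<open>
  A sequence of points serves for all configurations at once: passing to fewer points only means that
  some coordinates are ignored.
\<close>

definition points :: "(nat \<Rightarrow> real) measure" where
  "points = PiM UNIV (\<lambda>_. unit_uniform)"

abbreviation expect :: "((nat \<Rightarrow> real) \<Rightarrow> real) \<Rightarrow> real" where
  "expect f \<equiv> integral\<^sup>L points f"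

lemma prob_space_unit_uniform: "prob_space unit_uniform"
proof
  show "emeasure unit_uniform (space unit_uniform) = 1"
    by (simp add: unit_uniform_def space_restrict_space emeasure_restrict_space)
qed

lemma prob_space_points: "prob_space points"
  unfolding points_def by (rule prob_space_PiM) (rule prob_space_unit_uniform)

lemma space_unit_uniform [simp]: "space unit_uniform = {0..1}"
  by (simp add: unit_uniform_def space_restrict_space)

lemma space_points: "x \<in> space points \<longleftrightarrow> (\<forall>i. x i \<in> {0..1})"
  by (auto simp: points_def space_PiM PiE_def Pi_def)

lemma measurable_coord [measurable]: "(\<lambda>x. x i) \<in> borel_measurable points"
proof -
  have "(\<lambda>x. x i) \<in> measurable points unit_uniform"
    unfolding points_def by (rule measurable_component_singleton) simp
  moreover have "(\<lambda>t. t) \<in> borel_measurable unit_uniform"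
    unfolding unit_uniform_def by (rule measurable_restrict_space1) simp
  ultimately show ?thesis using measurable_compose by fastforce
qed

text \<open>
  Drawing one coordinate anew does not change the distribution.  This is what allows to integrate over
  a single coordinate in \<open>expect_integrate\<close>.
\<close>

lemma points_resample:
  "distr (unit_uniform \<Otimes>\<^sub>M points) points (\<lambda>(t, x). x(i := t)) = points"
  using distr_pair_PiM_eq_PiM[of UNIV "\<lambda>_. unit_uniform" i] prob_space_unit_uniform
  by (simp add: points_def)

lemma measurable_resample:
  "(\<lambda>(t, x). x(i := t)) \<in> measurable (unit_uniform \<Otimes>\<^sub>M points) points"
proof -
  have "(\<lambda>(x, t). x(i := t)) \<in> measurable (points \<Otimes>\<^sub>M unit_uniform) points"
    using measurable_add_dim[of i UNIV "\<lambda>_. unit_uniform"] by (simp add: points_def)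
  then have "(\<lambda>p. (\<lambda>(x, t). x(i := t)) (snd p, fst p)) \<in> measurable (unit_uniform \<Otimes>\<^sub>M points) points"
    by (rule measurable_compose[rotated]) measurable
  then show ?thesis by (simp add: case_prod_beta)
qed

text \<open>
  A class of integrands that is closed under the algebraic operations, which makes all questions of
  integrability automatic.
\<close>

definition bounded_rv :: "((nat \<Rightarrow> real) \<Rightarrow> real) \<Rightarrow> bool" where
  "bounded_rv f \<longleftrightarrow> f \<in> borel_measurable points \<and> (\<exists>B. \<forall>x\<in>space points. \<bar>f x\<bar> \<le> B)"

lemma bounded_rv_integrable: "bounded_rv f \<Longrightarrow> integrable points f"
proof -
  assume f: "bounded_rv f"
  interpret prob_space points by (rule prob_space_points)
  obtain B where "\<And>x. x \<in> space points \<Longrightarrow> \<bar>f x\<bar> \<le> B" using f by (auto simp: bounded_rv_def)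
  then show ?thesis
    using f by (intro integrable_const_bound[of _ B]) (auto simp: bounded_rv_def)
qed

named_theorems bounded_rv_intros

lemma bounded_rv_const [bounded_rv_intros]: "bounded_rv (\<lambda>_. c)"
  by (auto simp: bounded_rv_def)

lemma bounded_rv_add [bounded_rv_intros]:
  assumes "bounded_rv f" "bounded_rv h"
  shows "bounded_rv (\<lambda>x. f x + h x)"
proof -
  obtain A B where "\<And>x. x \<in> space points \<Longrightarrow> \<bar>f x\<bar> \<le> A" "\<And>x. x \<in> space points \<Longrightarrow> \<bar>h x\<bar> \<le> B"
    using assms by (auto simp: bounded_rv_def)
  then have "\<bar>f x + h x\<bar> \<le> A + B" if "x \<in> space points" for x
    using that by (intro order.trans[OF abs_triangle_ineq add_mono]) auto
  then show ?thesis using assms by (auto simp: bounded_rv_def)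
qed

lemma bounded_rv_mult [bounded_rv_intros]:
  assumes "bounded_rv f" "bounded_rv h"
  shows "bounded_rv (\<lambda>x. f x * h x)"
proof -
  obtain A B where AB: "\<And>x. x \<in> space points \<Longrightarrow> \<bar>f x\<bar> \<le> A" "\<And>x. x \<in> space points \<Longrightarrow> \<bar>h x\<bar> \<le> B"
    using assms by (auto simp: bounded_rv_def)
  have "\<bar>f x * h x\<bar> \<le> A * B" if "x \<in> space points" for x
    unfolding abs_mult using AB[OF that] by (intro mult_mono) auto
  then show ?thesis using assms by (auto simp: bounded_rv_def)
qed

lemma bounded_rv_diff [bounded_rv_intros]:
  assumes "bounded_rv f" "bounded_rv h"
  shows "bounded_rv (\<lambda>x. f x - h x)"
  using bounded_rv_add[OF assms(1) bounded_rv_mult[OF bounded_rv_const[of "-1"] assms(2)]] by simp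

lemma bounded_rv_sum [bounded_rv_intros]:
  "(\<And>a. a \<in> A \<Longrightarrow> bounded_rv (f a)) \<Longrightarrow> bounded_rv (\<lambda>x. \<Sum>a\<in>A. f a x)"
  by (induction A rule: infinite_finite_induct) (auto intro: bounded_rv_intros)

lemma bounded_rv_power [bounded_rv_intros]: "bounded_rv f \<Longrightarrow> bounded_rv (\<lambda>x. f x ^ n)"
  by (induction n) (auto intro: bounded_rv_intros)

lemma bounded_rv_if [bounded_rv_intros]:
  "(P \<Longrightarrow> bounded_rv f) \<Longrightarrow> (\<not> P \<Longrightarrow> bounded_rv h) \<Longrightarrow> bounded_rv (\<lambda>x. if P then f x else h x)"
  by (cases P) auto

lemma bounded_rv_continuous:
  assumes "continuous_on UNIV \<phi>"
  shows "bounded_rv (\<lambda>x. \<phi> (x i - x j))"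
proof -
  have "compact (\<phi> ` {-1..1})"
    by (rule compact_continuous_image) (auto intro: continuous_on_subset[OF assms])
  then obtain B where B: "\<forall>y\<in>\<phi> ` {-1..1}. \<bar>y\<bar> \<le> B"
    using compact_imp_bounded bounded_real by blast
  have "\<bar>\<phi> (x i - x j)\<bar> \<le> B" if "x \<in> space points" for x
  proof -
    have "x i \<in> {0..1}" "x j \<in> {0..1}" using that by (auto simp: space_points)
    then have "x i - x j \<in> {-1..1}" by auto
    then show ?thesis using B by blast
  qed
  moreover have "(\<lambda>x. \<phi> (x i - x j)) \<in> borel_measurable points"
    using borel_measurable_continuous_onI[OF assms] by measurable
  ultimately show ?thesis by (auto simp: bounded_rv_def)
qed

lemma bounded_rv_kernel [bounded_rv_intros]: "bounded_rv (\<lambda>x. kernel (x i - x j))"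
  by (rule bounded_rv_continuous[OF continuous_on_kernel])

lemma bounded_rv_kernel_power [bounded_rv_intros]: "bounded_rv (\<lambda>x. kernel_power l (x i - x j))"
  unfolding kernel_power_def
  by (intro bounded_rv_intros bounded_rv_continuous[OF continuous_on_perbern]) auto

lemma bounded_rv_sawtooth [bounded_rv_intros]: "bounded_rv (\<lambda>x. sawtooth (x i - x j))"
proof -
  have "\<bar>sawtooth (x i - x j)\<bar> \<le> 2" if "x \<in> space points" for x
  proof -
    have "x i \<in> {0..1}" "x j \<in> {0..1}" using that by (auto simp: space_points)
    then show ?thesis by (auto simp: sawtooth_def sgn_if abs_le_iff)
  qed
  moreover have "(\<lambda>x. sawtooth (x i - x j)) \<in> borel_measurable points"
    unfolding sawtooth_def by measurable
  ultimately show ?thesis by (auto simp: bounded_rv_def)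
qed

lemma bounded_rv_fix:
  assumes f: "bounded_rv f" and x: "x \<in> space points"
  shows "(\<lambda>t. f (x(i := t))) \<in> borel_measurable unit_uniform"
    "\<exists>B. \<forall>t\<in>{0..1}. \<bar>f (x(i := t))\<bar> \<le> B"
proof -
  have "(\<lambda>t. (t, x)) \<in> measurable unit_uniform (unit_uniform \<Otimes>\<^sub>M points)"
    using x by simp
  from measurable_compose[OF this measurable_resample]
  have "(\<lambda>t. x(i := t)) \<in> measurable unit_uniform points" by simp
  then show "(\<lambda>t. f (x(i := t))) \<in> borel_measurable unit_uniform"
    using f measurable_compose unfolding bounded_rv_def by blast
  obtain B where "\<And>x. x \<in> space points \<Longrightarrow> \<bar>f x\<bar> \<le> B" using f by (auto simp: bounded_rv_def)
  moreover have "x(i := t) \<in> space points" if "t \<in> {0..1}" for t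
    using x that by (auto simp: space_points)
  ultimately show "\<exists>B. \<forall>t\<in>{0..1}. \<bar>f (x(i := t))\<bar> \<le> B" by blast
qed

lemma integral_unit_uniform:
  fixes h :: "real \<Rightarrow> real"
  assumes m: "h \<in> borel_measurable unit_uniform" and B: "\<exists>B. \<forall>t\<in>{0..1}. \<bar>h t\<bar> \<le> B"
    and i: "(h has_integral c) {0..1}"
  shows "integral\<^sup>L unit_uniform h = c"
proof -
  interpret prob_space unit_uniform by (rule prob_space_unit_uniform)
  obtain B where "\<And>t. t \<in> {0..1} \<Longrightarrow> \<bar>h t\<bar> \<le> B" using B by blast
  then have "integrable unit_uniform h"
    using m by (intro integrable_const_bound[of _ B]) auto
  then have "set_integrable lborel {0..1} h"
    by (simp add: unit_uniform_def integrable_restrict_space set_integrable_def)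
  then have "(LINT t:{0..1}|lborel. h t) = integral {0..1} h"
    by (rule set_borel_integral_eq_integral)
  also have "\<dots> = c" using i by (rule integral_unique)
  finally show ?thesis
    by (simp add: unit_uniform_def integral_restrict_space set_lebesgue_integral_def)
qed

lemma expect_integrate:
  assumes f: "bounded_rv f"
    and c: "\<And>x. x \<in> space points \<Longrightarrow> ((\<lambda>t. f (x(i := t))) has_integral c x) {0..1}"
  shows "expect f = expect c"
proof -
  interpret U: prob_space unit_uniform by (rule prob_space_unit_uniform)
  interpret Pt: prob_space points by (rule prob_space_points)
  interpret UP: pair_prob_space unit_uniform points ..
  have "expect f = integral\<^sup>L (distr (unit_uniform \<Otimes>\<^sub>M points) points (\<lambda>(t, x). x(i := t))) f"
    by (simp only: points_resample)
  also have "\<dots> = integral\<^sup>L (unit_uniform \<Otimes>\<^sub>M points) (\<lambda>p. f ((\<lambda>(t, x). x(i := t)) p))"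
    using f measurable_resample by (intro integral_distr) (auto simp: bounded_rv_def)
  also have "\<dots> = integral\<^sup>L (unit_uniform \<Otimes>\<^sub>M points) (\<lambda>(t, x). f (x(i := t)))"
    by (simp add: case_prod_unfold)
  also have "\<dots> = (\<integral>x. (\<integral>t. f (x(i := t)) \<partial>unit_uniform) \<partial>points)"
  proof (rule UP.integral_snd[symmetric])
    have "integrable (distr (unit_uniform \<Otimes>\<^sub>M points) points (\<lambda>(t, x). x(i := t))) f"
      using bounded_rv_integrable[OF f] by (simp only: points_resample)
    then have "integrable (unit_uniform \<Otimes>\<^sub>M points) (\<lambda>p. f ((\<lambda>(t, x). x(i := t)) p))"
      using f measurable_resample by (subst (asm) integrable_distr_eq) (auto simp: bounded_rv_def)
    then show "integrable (unit_uniform \<Otimes>\<^sub>M points) (\<lambda>(t, x). f (x(i := t)))"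
      by (simp add: case_prod_unfold)
  qed
  also have "\<dots> = expect c"
    by (intro Bochner_Integration.integral_cong refl integral_unit_uniform bounded_rv_fix f c)
  finally show ?thesis .
qed

lemma AE_points_distinct:
  assumes "i \<noteq> j"
  shows "AE x in points. x i \<noteq> x j"
proof -
  define f where "f x = (if x i = x j then 1 else 0 :: real)" for x :: "nat \<Rightarrow> real"
  have f: "bounded_rv f"
    unfolding bounded_rv_def f_def by (intro conjI exI[of _ 1]) auto
  have "expect f = expect (\<lambda>_. 0)"
  proof (rule expect_integrate[OF f, of i])
    fix x
    have "((\<lambda>_. 0 :: real) has_integral 0) {0..1}" by simp
    then show "((\<lambda>t. f (x(i := t))) has_integral 0) {0..1}"
      by (rule has_integral_spike_finite[of "{x j}", rotated 2]) (use assms in \<open>auto simp: f_def\<close>)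
  qed
  then have "expect f = 0" by simp
  then have "AE x in points. f x = 0"
    using integral_nonneg_eq_0_iff_AE[OF bounded_rv_integrable[OF f]] by (simp add: f_def)
  then show ?thesis by eventually_elim (auto simp: f_def split: if_splits)
qed

section \<open>The energy of a configuration of masses\<close>

definition energy :: "nat set \<Rightarrow> (nat \<Rightarrow> real) \<Rightarrow> (nat \<Rightarrow> real) \<Rightarrow> real" where
  "energy I \<mu> x = (\<Sum>i\<in>I. \<Sum>j\<in>I. \<mu> i * \<mu> j * kernel (x i - x j))"

definition force :: "nat set \<Rightarrow> (nat \<Rightarrow> real) \<Rightarrow> (nat \<Rightarrow> real) \<Rightarrow> nat \<Rightarrow> real" where
  "force I \<mu> x i = (\<Sum>j\<in>I. \<mu> j * sawtooth (x i - x j))"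

text \<open>
  The shift by \<open>1 / 12\<close>, the energy of a single unit mass, turns the dissipation \<open>m\<^sup>3 / 12\<close> into the weight
  \<open>(m\<^sup>3 - m) / 12\<close> of the trees, because the masses add up to the factor of the energy in
  \<open>energy_dissipation\<close>.
\<close>

definition moment :: "nat \<Rightarrow> nat set \<Rightarrow> (nat \<Rightarrow> real) \<Rightarrow> real" where
  "moment g I \<mu> = expect (\<lambda>x. (energy I \<mu> x - 1 / 12) ^ g)"

lemma bounded_rv_energy [bounded_rv_intros]: "bounded_rv (energy I \<mu>)"
proof -
  have "energy I \<mu> = (\<lambda>x. \<Sum>i\<in>I. \<Sum>j\<in>I. \<mu> i * \<mu> j * kernel (x i - x j))"
    by (rule ext) (simp add: energy_def)
  then show ?thesis by (simp only:) (intro bounded_rv_intros)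
qed

lemma bounded_rv_force [bounded_rv_intros]: "bounded_rv (\<lambda>x. force I \<mu> x i)"
  unfolding force_def by (intro bounded_rv_intros)

lemma space_points_kernel_commute: "x \<in> space points \<Longrightarrow> kernel (x i - x j) = kernel (x j - x i)"
proof -
  assume "x \<in> space points"
  then have "x i \<in> {0..1}" "x j \<in> {0..1}" by (auto simp: space_points)
  then show ?thesis by (intro kernel_commute) auto
qed

lemma energy_insert:
  assumes "finite K" "j \<notin> K" "x \<in> space points"
  shows "energy (insert j K) \<mu> x
    = energy K \<mu> x + 2 * \<mu> j * (\<Sum>l\<in>K. \<mu> l * kernel (x j - x l)) + (\<mu> j)\<^sup>2 / 12"
proof -
  have "energy (insert j K) \<mu> x = (\<mu> j)\<^sup>2 / 12 + (\<Sum>l\<in>K. \<mu> j * \<mu> l * kernel (x j - x l))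
      + (\<Sum>l\<in>K. \<mu> l * \<mu> j * kernel (x l - x j)) + energy K \<mu> x"
    using assms by (simp add: energy_def sum.distrib kernel_0 power2_eq_square)
  also have "(\<Sum>l\<in>K. \<mu> l * \<mu> j * kernel (x l - x j)) = (\<Sum>l\<in>K. \<mu> j * \<mu> l * kernel (x j - x l))"
    by (simp add: space_points_kernel_commute[OF assms(3)] mult.commute)
  finally show ?thesis by (simp add: sum_distrib_left mult.assoc)
qed

lemma energy_cong: "(\<And>i. i \<in> I \<Longrightarrow> \<mu> i = \<nu> i \<and> x i = y i) \<Longrightarrow> energy I \<mu> x = energy I \<nu> y"
  by (auto simp: energy_def intro!: sum.cong)

lemma energy_update:
  assumes "finite I" "i \<in> I" "x \<in> space points" "t \<in> {0..1}"
  shows "energy I \<mu> (x(i := t)) = energy (I - {i}) \<mu> x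
    + 2 * \<mu> i * (\<Sum>l\<in>I-{i}. \<mu> l * kernel (t - x l)) + (\<mu> i)\<^sup>2 / 12"
proof -
  have "x(i := t) \<in> space points" using assms by (auto simp: space_points)
  then have "energy (insert i (I - {i})) \<mu> (x(i := t)) = energy (I - {i}) \<mu> (x(i := t))
    + 2 * \<mu> i * (\<Sum>l\<in>I-{i}. \<mu> l * kernel ((x(i := t)) i - (x(i := t)) l)) + (\<mu> i)\<^sup>2 / 12"
    using assms by (intro energy_insert) auto
  moreover have "insert i (I - {i}) = I" using assms by auto
  moreover have "energy (I - {i}) \<mu> (x(i := t)) = energy (I - {i}) \<mu> x" by (rule energy_cong) auto
  moreover have "(\<Sum>l\<in>I-{i}. \<mu> l * kernel ((x(i := t)) i - (x(i := t)) l)) = (\<Sum>l\<in>I-{i}. \<mu> l * kernel (t - x l))"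
    by (rule sum.cong) auto
  ultimately show ?thesis by simp
qed

lemma energy_merge:
  assumes "finite I" "i \<in> I" "j \<in> I" "i \<noteq> j" and x: "x \<in> space points"
  shows "energy I \<mu> (x(i := x j)) = energy (I - {i}) (\<mu>(j := \<mu> i + \<mu> j)) x"
proof -
  define K where "K = I - {i, j}"
  define s where "s = (\<Sum>l\<in>K. \<mu> l * kernel (x j - x l))"
  have K: "finite K" "j \<notin> K" "I - {i} = insert j K" using assms by (auto simp: K_def)
  have "energy I \<mu> (x(i := x j)) = energy (insert j K) \<mu> x
      + 2 * \<mu> i * (\<Sum>l\<in>insert j K. \<mu> l * kernel (x j - x l)) + (\<mu> i)\<^sup>2 / 12"
    using energy_update[OF assms(1,2) x, of "x j"] x unfolding K(3) by (auto simp: space_points)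
  also have "energy (insert j K) \<mu> x = energy K \<mu> x + 2 * \<mu> j * s + (\<mu> j)\<^sup>2 / 12"
    unfolding s_def by (rule energy_insert[OF K(1,2) x])
  also have "(\<Sum>l\<in>insert j K. \<mu> l * kernel (x j - x l)) = \<mu> j / 12 + s"
    using K by (simp add: s_def kernel_0)
  also have "energy K \<mu> x + 2 * \<mu> j * s + (\<mu> j)\<^sup>2 / 12 + 2 * \<mu> i * (\<mu> j / 12 + s) + (\<mu> i)\<^sup>2 / 12
      = energy K \<mu> x + 2 * (\<mu> i + \<mu> j) * s + (\<mu> i + \<mu> j)\<^sup>2 / 12"
    by (simp add: power2_eq_square field_simps)
  also have "\<dots> = energy (insert j K) (\<mu>(j := \<mu> i + \<mu> j)) x"
  proof -
    have "energy K (\<mu>(j := \<mu> i + \<mu> j)) x = energy K \<mu> x"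
      by (rule energy_cong) (use K in auto)
    moreover have "(\<Sum>l\<in>K. (\<mu>(j := \<mu> i + \<mu> j)) l * kernel (x j - x l)) = s"
      unfolding s_def by (rule sum.cong) (use K in auto)
    ultimately show ?thesis
      by (subst energy_insert[OF K(1,2) x]) simp
  qed
  finally show ?thesis unfolding K(3) .
qed

text \<open>
  Write both sides as triple sums over the masses, make the summand on the side of the forces symmetric
  in the three indices and apply \<open>kernel_three_points\<close>.  Its defect is met exactly on the diagonal,
  where it produces the cubes.
\<close>

lemma energy_dissipation:
  assumes I: "finite I" and x: "x \<in> space points" and inj: "inj_on x I"
  shows "(\<Sum>i\<in>I. \<mu> i) * energy I \<mu> x
    = (\<Sum>i\<in>I. \<mu> i * (force I \<mu> x i)\<^sup>2) + (\<Sum>i\<in>I. \<mu> i ^ 3) / 12"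
proof -
  define T where "T F = (\<Sum>i\<in>I. \<Sum>j\<in>I. \<Sum>l\<in>I. \<mu> i * \<mu> j * \<mu> l * F i j l)" for F :: "nat \<Rightarrow> nat \<Rightarrow> nat \<Rightarrow> real"
  have T_12: "T (\<lambda>i j l. F j i l) = T F" for F
    unfolding T_def by (subst sum.swap) (simp add: mult_ac)
  have T_23: "T (\<lambda>i j l. F i l j) = T F" for F
    unfolding T_def by (rule sum.cong[OF refl], subst sum.swap) (simp add: mult_ac)
  have T_add: "T (\<lambda>i j l. F i j l + H i j l) = T F + T H" for F H
    by (simp add: T_def distrib_left sum.distrib)
  have T_diff: "T (\<lambda>i j l. F i j l - H i j l) = T F - T H" for F H
    by (simp add: T_def right_diff_distrib sum_subtractf)
  define a where "a i j l = sawtooth (x i - x j) * sawtooth (x i - x l)" for i j l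
  define k where "k i j l = kernel (x i - x j)" for i j l :: nat
  define e where "e i j l = (if i = j \<and> j = l then 1 / 4 else 0 :: real)" for i j l :: nat
  have Ta: "T a = (\<Sum>i\<in>I. \<mu> i * (force I \<mu> x i)\<^sup>2)"
    unfolding T_def force_def a_def power2_eq_square sum_product sum_distrib_left
    by (intro sum.cong refl) (simp add: mult_ac sum_distrib_left)
  have Tk: "T k = (\<Sum>i\<in>I. \<mu> i) * energy I \<mu> x"
    unfolding T_def energy_def k_def by (simp add: sum_distrib_left sum_distrib_right mult_ac)
  have Te: "T e = (\<Sum>i\<in>I. \<mu> i ^ 3) / 4"
  proof -
    have "(\<Sum>j\<in>I. \<Sum>l\<in>I. \<mu> i * \<mu> j * \<mu> l * e i j l) = \<mu> i ^ 3 / 4" if "i \<in> I" for i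
    proof -
      have "(\<Sum>j\<in>I. \<Sum>l\<in>I. \<mu> i * \<mu> j * \<mu> l * e i j l)
          = (\<Sum>j\<in>I. if j = i then (\<Sum>l\<in>I. if l = i then \<mu> i ^ 3 / 4 else 0) else 0)"
        by (intro sum.cong refl) (auto simp: e_def power3_eq_cube intro!: sum.cong sum.neutral)
      then show ?thesis using that I by simp
    qed
    then show ?thesis unfolding T_def sum_divide_distrib by (intro sum.cong refl)
  qed
  have "T (\<lambda>i j l. a i j l + a j i l + a l i j) = T (\<lambda>i j l. k i j l + k j l i + k i l j - e i j l)"
    unfolding T_def
  proof (intro sum.cong refl arg_cong2[where f = "(*)"])
    fix i j l assume "i \<in> I" "j \<in> I" "l \<in> I"
    then have "(x i = x j \<and> x j = x l) = (i = j \<and> j = l)" using inj by (auto dest: inj_onD)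
    then show "a i j l + a j i l + a l i j = k i j l + k j l i + k i l j - e i j l"
      using kernel_three_points[of "x i" "x j" "x l"] x
      by (simp add: a_def k_def e_def space_points)
  qed
  moreover have "T (\<lambda>i j l. a l i j) = T a"
    using T_12[of "\<lambda>i j l. a i l j"] T_23[of "\<lambda>i j l. a j i l"] T_12[of a] T_23[of a]
    by (metis T_12 T_23)
  moreover have "T (\<lambda>i j l. k j l i) = T k" by (metis T_12 T_23)
  moreover have "T (\<lambda>i j l. k i l j) = T k" by (rule T_23)
  moreover have "T (\<lambda>i j l. a j i l) = T a" by (rule T_12)
  ultimately have "3 * T a = 3 * T k - T e" by (simp add: T_add T_diff)
  then show ?thesis by (simp add: Ta Tk Te)
qed

text \<open>
  As a function of \<open>x i\<close>, the energy has the derivative \<open>2 * \<mu> i * force I \<mu> x i\<close>, and the force is a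
  combination of sawtooth functions with jumps at the other points; so \<open>integration_by_parts_circle\<close>
  evaluates the integral over \<open>x i\<close> by the configurations in which the mass \<open>i\<close> has moved to one of the
  other points \<open>j\<close>.
\<close>

lemma expect_integration_by_parts:
  assumes I: "finite I" and i: "i \<in> I"
  shows "(\<Sum>j\<in>I-{i}. \<mu> j * expect (\<lambda>x. (energy (I - {i}) (\<mu>(j := \<mu> i + \<mu> j)) x - c) ^ g))
    = expect (\<lambda>x. (sum \<mu> I - \<mu> i) * (energy I \<mu> x - c) ^ g
        + 2 * \<mu> i * (force I \<mu> x i)\<^sup>2 * (g * (energy I \<mu> x - c) ^ (g - 1)))"
    (is "_ = expect ?f")
proof -
  have "expect ?f = expect (\<lambda>x. \<Sum>j\<in>I-{i}. \<mu> j * (energy I \<mu> (x(i := x j)) - c) ^ g)"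
  proof (rule expect_integrate)
    show "bounded_rv ?f" by (intro bounded_rv_intros)
    fix x assume x: "x \<in> space points"
    then have x01: "x j \<in> {0..1}" for j by (auto simp: space_points)
    define e where "e t = energy (I - {i}) \<mu> x + 2 * \<mu> i * (\<Sum>l\<in>I-{i}. \<mu> l * kernel (t - x l)) + (\<mu> i)\<^sup>2 / 12" for t
    define s where "s t = (\<Sum>l\<in>I-{i}. \<mu> l * sawtooth (t - x l))" for t
    have e: "energy I \<mu> (x(i := t)) = e t" if "t \<in> {0..1}" for t
      unfolding e_def using that by (rule energy_update[OF I i x])
    have s: "force I \<mu> (x(i := t)) i = s t" for t
    proof -
      have "force I \<mu> (x(i := t)) i = (\<Sum>l\<in>I. if l = i then 0 else \<mu> l * sawtooth (t - x l))"
        unfolding force_def by (rule sum.cong) (auto simp: sawtooth_def)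
      also have "\<dots> = (\<Sum>l\<in>I-{i}. if l = i then 0 else \<mu> l * sawtooth (t - x l))"
        using I i by (simp add: sum.remove)
      also have "\<dots> = s t" unfolding s_def by (rule sum.cong) auto
      finally show ?thesis .
    qed
    have de: "(e has_real_derivative 2 * \<mu> i * s t) (at t)" if "t \<notin> x ` (I - {i})" for t
    proof -
      have "((\<lambda>t. \<mu> l * kernel (t - x l)) has_real_derivative \<mu> l * sawtooth (t - x l)) (at t)"
        if "l \<in> I - {i}" for l
        using that \<open>t \<notin> x ` (I - {i})\<close> has_derivative_perbern_diff[of t "x l" "Suc 0"]
        by (auto simp: kernel_def numeral_2_eq_2 perbern_1 intro!: DERIV_cmult)
      then have "((\<lambda>t. \<Sum>l\<in>I-{i}. \<mu> l * kernel (t - x l)) has_real_derivative s t) (at t)"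
        unfolding s_def by (rule DERIV_sum)
      then have "((\<lambda>t. 2 * \<mu> i * (\<Sum>l\<in>I-{i}. \<mu> l * kernel (t - x l))) has_real_derivative 2 * \<mu> i * s t) (at t)"
        by (rule DERIV_cmult)
      from DERIV_add[OF DERIV_add[OF DERIV_const this] DERIV_const] show ?thesis
        unfolding e_def by simp
    qed
    have parts: "((\<lambda>t. (e t - c) ^ g + sawtooth (t - x j) * (g * (e t - c) ^ (g - 1) * (2 * \<mu> i * s t)))
        has_integral (e (x j) - c) ^ g) {0..1}" if "j \<in> I - {i}" for j
    proof (rule integration_by_parts_circle[of "x ` (I - {i})"])
      show "continuous_on {0..1} (\<lambda>t. (e t - c) ^ g)"
        unfolding e_def kernel_def by (intro continuous_intros continuous_on_perbern_diff) auto
      have "(\<Sum>l\<in>I-{i}. \<mu> l * kernel (0 - x l)) = (\<Sum>l\<in>I-{i}. \<mu> l * kernel (1 - x l))"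
        unfolding kernel_def by (intro sum.cong refl arg_cong2[where f = "(*)"] perbern_diff_periodic x01) auto
      then show "(e 0 - c) ^ g = (e 1 - c) ^ g" by (simp add: e_def)
      show "((\<lambda>t. (e t - c) ^ g) has_real_derivative g * (e t - c) ^ (g - 1) * (2 * \<mu> i * s t)) (at t)"
        if "t \<in> {0<..<1} - x ` (I - {i})" for t
        using that de[of t] by (auto intro!: derivative_eq_intros)
    qed (use I x01 in auto)
    have "((\<lambda>t. \<Sum>j\<in>I-{i}. \<mu> j * ((e t - c) ^ g + sawtooth (t - x j) * (g * (e t - c) ^ (g - 1) * (2 * \<mu> i * s t))))
        has_integral (\<Sum>j\<in>I-{i}. \<mu> j * (e (x j) - c) ^ g)) {0..1}"
      by (intro has_integral_sum has_integral_mult_right parts) (use I in auto)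
    moreover have "(\<Sum>j\<in>I-{i}. \<mu> j * ((e t - c) ^ g + sawtooth (t - x j) * (g * (e t - c) ^ (g - 1) * (2 * \<mu> i * s t))))
        = ?f (x(i := t))" if t: "t \<in> {0..1}" for t
    proof -
      have "sum \<mu> I - \<mu> i = (\<Sum>j\<in>I-{i}. \<mu> j)" using I i by (simp add: sum.remove)
      moreover have "(\<Sum>j\<in>I-{i}. \<mu> j * (a + sawtooth (t - x j) * d))
          = (\<Sum>j\<in>I-{i}. \<mu> j) * a + s t * d" for a d
        by (simp add: s_def distrib_left sum.distrib sum_distrib_right mult.assoc)
      ultimately have "(\<Sum>j\<in>I-{i}. \<mu> j * ((e t - c) ^ g + sawtooth (t - x j) * (g * (e t - c) ^ (g - 1) * (2 * \<mu> i * s t))))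
          = (sum \<mu> I - \<mu> i) * (e t - c) ^ g + s t * (g * (e t - c) ^ (g - 1) * (2 * \<mu> i * s t))"
        by (simp only:)
      then show ?thesis
        by (simp add: e[OF t] s power2_eq_square mult_ac)
    qed
    moreover have "(\<Sum>j\<in>I-{i}. \<mu> j * (e (x j) - c) ^ g)
        = (\<Sum>j\<in>I-{i}. \<mu> j * (energy I \<mu> (x(i := x j)) - c) ^ g)"
      by (simp only: e[OF x01])
    ultimately show "((\<lambda>t. ?f (x(i := t))) has_integral
        (\<Sum>j\<in>I-{i}. \<mu> j * (energy I \<mu> (x(i := x j)) - c) ^ g)) {0..1}"
      by (metis (no_types, lifting) has_integral_eq)
  qed
  also have "\<dots> = expect (\<lambda>x. \<Sum>j\<in>I-{i}. \<mu> j * (energy (I - {i}) (\<mu>(j := \<mu> i + \<mu> j)) x - c) ^ g)"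
    by (intro Bochner_Integration.integral_cong refl sum.cong) (use I i in \<open>auto simp: energy_merge\<close>)
  also have "\<dots> = (\<Sum>j\<in>I-{i}. expect (\<lambda>x. \<mu> j * (energy (I - {i}) (\<mu>(j := \<mu> i + \<mu> j)) x - c) ^ g))"
    by (intro Bochner_Integration.integral_sum bounded_rv_integrable bounded_rv_intros)
  finally show ?thesis by simp
qed

text \<open>
  Sum \<open>expect_integration_by_parts\<close> over all masses; almost surely the points are distinct, so that
  \<open>energy_dissipation\<close> replaces the squared forces by the energy.
\<close>

lemma moment_merge:
  assumes I: "finite I" "I \<noteq> {}"
  shows "(\<Sum>i\<in>I. \<Sum>j\<in>I-{i}. \<mu> j * moment g (I - {i}) (\<mu>(j := \<mu> i + \<mu> j)))
    = (real (card I) - 1 + 2 * real g) * sum \<mu> I * moment g I \<mu>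
      - 2 * real g * (\<Sum>i\<in>I. (\<mu> i ^ 3 - \<mu> i) / 12) * moment (g - 1) I \<mu>"
proof -
  let ?n = "sum \<mu> I" and ?w = "\<Sum>i\<in>I. (\<mu> i ^ 3 - \<mu> i) / 12"
  let ?q = "\<lambda>x. energy I \<mu> x - 1 / 12"
  have "(\<Sum>i\<in>I. \<Sum>j\<in>I-{i}. \<mu> j * moment g (I - {i}) (\<mu>(j := \<mu> i + \<mu> j)))
      = (\<Sum>i\<in>I. expect (\<lambda>x. (?n - \<mu> i) * ?q x ^ g
          + 2 * \<mu> i * (force I \<mu> x i)\<^sup>2 * (g * ?q x ^ (g - 1))))"
    unfolding moment_def by (intro sum.cong refl expect_integration_by_parts I)
  also have "\<dots> = expect (\<lambda>x. \<Sum>i\<in>I. (?n - \<mu> i) * ?q x ^ g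
          + 2 * \<mu> i * (force I \<mu> x i)\<^sup>2 * (g * ?q x ^ (g - 1)))"
    by (intro Bochner_Integration.integral_sum[symmetric] bounded_rv_integrable bounded_rv_intros)
  also have "\<dots> = expect (\<lambda>x. (real (card I) - 1 + 2 * real g) * ?n * ?q x ^ g
      - 2 * real g * ?w * ?q x ^ (g - 1))"
  proof (rule integral_cong_AE)
    have "AE x in points. \<forall>i\<in>I. \<forall>j\<in>I. i \<noteq> j \<longrightarrow> x i \<noteq> x j"
      using I AE_points_distinct by (auto intro!: AE_finite_allI)
    then show "AE x in points. (\<Sum>i\<in>I. (?n - \<mu> i) * ?q x ^ g
          + 2 * \<mu> i * (force I \<mu> x i)\<^sup>2 * (g * ?q x ^ (g - 1)))
        = (real (card I) - 1 + 2 * real g) * ?n * ?q x ^ g - 2 * real g * ?w * ?q x ^ (g - 1)"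
      using AE_space
    proof eventually_elim
      case (elim x)
      then have "inj_on x I" by (auto simp: inj_on_def)
      from energy_dissipation[OF I(1) elim(2) this, of \<mu>]
      have d: "(\<Sum>i\<in>I. \<mu> i * (force I \<mu> x i)\<^sup>2) = ?n * ?q x - ?w"
        by (simp add: right_diff_distrib sum_subtractf flip: sum_divide_distrib) (simp add: diff_divide_distrib)
      have "(\<Sum>i\<in>I. (?n - \<mu> i) * ?q x ^ g + 2 * \<mu> i * (force I \<mu> x i)\<^sup>2 * (g * ?q x ^ (g - 1)))
          = (real (card I) - 1) * ?n * ?q x ^ g
            + (\<Sum>i\<in>I. \<mu> i * (force I \<mu> x i)\<^sup>2) * (2 * g * ?q x ^ (g - 1))"
        by (simp add: sum.distrib sum_subtractf algebra_simps sum_distrib_left sum_distrib_right)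
      also have "\<dots> = (real (card I) - 1 + 2 * real g) * ?n * ?q x ^ g - 2 * real g * ?w * ?q x ^ (g - 1)"
      proof -
        have "a * n * q ^ g + (n * q - w) * (2 * g * q ^ (g - 1))
            = (a + 2 * real g) * n * q ^ g - 2 * real g * w * q ^ (g - 1)" for a n q w :: real
          by (cases g) (simp_all add: algebra_simps)
        then show ?thesis unfolding d .
      qed
      finally show ?case .
    qed
  qed (intro borel_measurable_integrable bounded_rv_integrable bounded_rv_intros)+
  also have "\<dots> = expect (\<lambda>x. (real (card I) - 1 + 2 * real g) * ?n * ?q x ^ g)
      - expect (\<lambda>x. 2 * real g * ?w * ?q x ^ (g - 1))"
    by (intro Bochner_Integration.integral_diff bounded_rv_integrable bounded_rv_intros)
  finally show ?thesis unfolding moment_def by simp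
qed

section \<open>Merging clusters of given masses\<close>

text \<open>
  The weight \<open>x + y\<close> of the merger of two clusters is distributed over the two orders in which the pair
  is met: an ordered pair receives the mass of its second element.
\<close>

definition merge_op :: "(nat multiset \<Rightarrow> real) \<Rightarrow> nat multiset \<Rightarrow> real" where
  "merge_op \<phi> m = (\<Sum>x\<in>#m. \<Sum>y\<in>#m - {#x#}. real y * \<phi> (add_mset (x + y) (m - {#x#} - {#y#})))"

definition genus_weight :: "nat multiset \<Rightarrow> real" where
  "genus_weight m = (\<Sum>x\<in>#m. (real x ^ 3 - real x) / 12)"

fun event_op :: "nat \<times> nat \<Rightarrow> (nat multiset \<Rightarrow> real) \<Rightarrow> nat multiset \<Rightarrow> real" where
  "event_op (p, a) \<phi> m = (if a = 2 then merge_op \<phi> m else genus_weight m * \<phi> m) / real p"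

lemma sum_mset_image_mset_set:
  "(\<Sum>x\<in>#image_mset \<mu> (mset_set I). f x) = (\<Sum>i\<in>I. f (\<mu> i))"
  by (simp add: sum_unfold_sum_mset multiset.map_comp comp_def)

lemma image_mset_mset_set_remove:
  "finite I \<Longrightarrow> i \<in> I \<Longrightarrow> image_mset \<mu> (mset_set I) - {#\<mu> i#} = image_mset \<mu> (mset_set (I - {i}))"
  by (simp add: mset_set.remove)

lemma merge_op_image:
  assumes "finite I"
  shows "merge_op \<phi> (image_mset \<mu> (mset_set I))
    = (\<Sum>i\<in>I. \<Sum>j\<in>I-{i}. real (\<mu> j) * \<phi> (add_mset (\<mu> i + \<mu> j) (image_mset \<mu> (mset_set (I - {i, j})))))"
  unfolding merge_op_def sum_mset_image_mset_set
proof (rule sum.cong[OF refl])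
  fix i assume "i \<in> I"
  then have r: "image_mset \<mu> (mset_set I) - {#\<mu> i#} = image_mset \<mu> (mset_set (I - {i}))"
    using assms by (intro image_mset_mset_set_remove)
  show "(\<Sum>y\<in>#image_mset \<mu> (mset_set I) - {#\<mu> i#}. real y *
        \<phi> (add_mset (\<mu> i + y) (image_mset \<mu> (mset_set I) - {#\<mu> i#} - {#y#})))
      = (\<Sum>j\<in>I-{i}. real (\<mu> j) * \<phi> (add_mset (\<mu> i + \<mu> j) (image_mset \<mu> (mset_set (I - {i, j})))))"
    unfolding r sum_mset_image_mset_set
  proof (rule sum.cong[OF refl])
    fix j assume j: "j \<in> I - {i}"
    have "I - {i} - {j} = I - {i, j}" by auto
    then have "image_mset \<mu> (mset_set (I - {i})) - {#\<mu> j#} = image_mset \<mu> (mset_set (I - {i, j}))"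
      using image_mset_mset_set_remove[of "I - {i}" j \<mu>] j assms by simp
    then show "real (\<mu> j) * \<phi> (add_mset (\<mu> i + \<mu> j) (image_mset \<mu> (mset_set (I - {i})) - {#\<mu> j#}))
        = real (\<mu> j) * \<phi> (add_mset (\<mu> i + \<mu> j) (image_mset \<mu> (mset_set (I - {i, j}))))"
      by simp
  qed
qed

lemma genus_weight_image:
  "genus_weight (image_mset \<mu> (mset_set I)) = (\<Sum>i\<in>I. (real (\<mu> i) ^ 3 - real (\<mu> i)) / 12)"
  unfolding genus_weight_def by (rule sum_mset_image_mset_set)

lemma merge_op_sum: "merge_op (\<lambda>m. \<Sum>w\<in>W. \<phi> w m) m = (\<Sum>w\<in>W. merge_op (\<phi> w) m)"
proof (induction W rule: infinite_finite_induct)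
  case (insert w W)
  have "merge_op (\<lambda>m. \<phi> w m + \<psi> m) m = merge_op (\<phi> w) m + merge_op \<psi> m" for \<psi>
    by (simp add: merge_op_def distrib_left sum_mset.distrib)
  then show ?case using insert by simp
qed (simp_all add: merge_op_def)

text \<open>
  The possible lists of pairs (label, number of sons) of the inner vertices of a tree with \<open>g\<close> vertices
  of one son and \<open>r\<close> vertices of two sons, by increasing label.  A vertex with two sons uses up one
  number and a vertex with one son uses up two, its label and the predecessor of its label; as there
  are \<open>2 * g + r\<close> numbers, this is the last label.
\<close>

function words :: "nat \<Rightarrow> nat \<Rightarrow> (nat \<times> nat) list set" where
  "words g r = (if g = 0 \<and> r = 0 then {[]} else
     (if r = 0 then {} else (\<lambda>w. w @ [(2 * g + r, 2)]) ` words g (r - 1)) \<union>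
     (if g = 0 then {} else (\<lambda>w. w @ [(2 * g + r, 1)]) ` words (g - 1) r))"
  by auto
termination by (relation "Wellfounded.measure (\<lambda>(g, r). g + r)") auto

declare words.simps [simp del]

lemma words_0_0: "words 0 0 = {[]}"
  by (simp add: words.simps)

lemma finite_words: "finite (words g r)"
proof (induction g r rule: words.induct)
  case (1 g r)
  then show ?case by (subst words.simps) auto
qed

text \<open>
  The sum of the weights of all ways to unite clusters of masses \<open>m\<close> into a single one by \<open>r\<close> mergers
  and \<open>g\<close> markings.  The events are applied to the final state from the smallest label on, that is,
  the masses \<open>m\<close> enter at the event of largest label.
\<close>

definition merge_sum :: "nat \<Rightarrow> nat \<Rightarrow> nat multiset \<Rightarrow> real" where
  "merge_sum g r m = (\<Sum>w\<in>words g r. fold event_op w (\<lambda>m. of_bool (size m = 1)) m)"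

lemma merge_sum_rec:
  assumes "g > 0 \<or> r > 0"
  shows "real (2 * g + r) * merge_sum g r m
    = (if r = 0 then 0 else merge_op (merge_sum g (r - 1)) m)
      + (if g = 0 then 0 else genus_weight m * merge_sum (g - 1) r m)"
proof -
  define F where "F w = fold event_op w (\<lambda>m. of_bool (size m = 1) :: real)" for w
  define A where "A = (if r = 0 then {} else (\<lambda>w. w @ [(2 * g + r, 2 :: nat)]) ` words g (r - 1))"
  define B where "B = (if g = 0 then {} else (\<lambda>w. w @ [(2 * g + r, 1 :: nat)]) ` words (g - 1) r)"
  have W: "words g r = A \<union> B" using assms unfolding A_def B_def by (subst words.simps) auto
  have "A \<inter> B = {}" by (auto simp: A_def B_def)
  moreover have "finite A" "finite B" by (auto simp: A_def B_def finite_words)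
  ultimately have "merge_sum g r m = (\<Sum>w\<in>A. F w m) + (\<Sum>w\<in>B. F w m)"
    unfolding merge_sum_def W F_def by (subst sum.union_disjoint) auto
  moreover have "real (2 * g + r) * (\<Sum>w\<in>A. F w m) = (if r = 0 then 0 else merge_op (merge_sum g (r - 1)) m)"
  proof (cases "r = 0")
    case False
    have "(\<Sum>w\<in>A. F w m) = (\<Sum>w\<in>words g (r - 1). F (w @ [(2 * g + r, 2)]) m)"
      using False by (simp add: A_def sum.reindex inj_on_def)
    also have "\<dots> = (\<Sum>w\<in>words g (r - 1). merge_op (F w) m) / real (2 * g + r)"
      by (simp add: F_def sum_divide_distrib)
    also have "(\<Sum>w\<in>words g (r - 1). merge_op (F w) m) = merge_op (merge_sum g (r - 1)) m"
      unfolding merge_op_sum[symmetric] merge_sum_def[abs_def] F_def ..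
    finally show ?thesis using False by simp
  qed (simp add: A_def)
  moreover have "real (2 * g + r) * (\<Sum>w\<in>B. F w m) = (if g = 0 then 0 else genus_weight m * merge_sum (g - 1) r m)"
  proof (cases "g = 0")
    case False
    have "(\<Sum>w\<in>B. F w m) = (\<Sum>w\<in>words (g - 1) r. F (w @ [(2 * g + r, 1)]) m)"
      using False by (simp add: B_def sum.reindex inj_on_def)
    also have "\<dots> = genus_weight m * merge_sum (g - 1) r m / real (2 * g + r)"
      by (simp add: F_def merge_sum_def sum_divide_distrib sum_distrib_left)
    finally show ?thesis using False by simp
  qed (simp add: B_def)
  ultimately show ?thesis by (simp add: distrib_left)
qed

text \<open>
  Both sides satisfy the same recursion, by \<open>merge_sum_rec\<close> and \<open>moment_merge\<close>.
\<close>

theorem merge_sum_eq_moment: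
  fixes \<mu> :: "nat \<Rightarrow> nat"
  assumes "finite I" "card I = Suc r" "sum \<mu> I > 0"
  shows "merge_sum g r (image_mset \<mu> (mset_set I))
    = real (sum \<mu> I) ^ (r + g) / (2 ^ g * fact g) * moment g I (\<lambda>i. real (\<mu> i))"
  using assms
proof (induction "g + r" arbitrary: g r I \<mu> rule: less_induct)
  case less
  note I = less.prems(1,2) and pos = less.prems(3)
  define n where "n = real (sum \<mu> I)"
  define m where "m = image_mset \<mu> (mset_set I)"
  let ?\<mu> = "\<lambda>i. real (\<mu> i)"
  have n: "n > 0" using pos unfolding n_def by (simp only: of_nat_0_less_iff)
  have n_sum: "n = sum ?\<mu> I" by (simp add: n_def)
  have I': "I \<noteq> {}" using I by auto
  show ?case
  proof (cases "g = 0 \<and> r = 0")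
    case True
    interpret prob_space points by (rule prob_space_points)
    have "moment 0 I ?\<mu> = 1" by (simp add: moment_def prob_space)
    then show ?thesis using True I by (simp add: merge_sum_def words_0_0)
  next
    case False
    define c where "c = n ^ (r + g) / (2 ^ g * fact g)"
    \<comment> \<open>A merger lowers \<open>r\<close> by one and keeps the total mass, hence the factor \<open>n\<close>.\<close>
    have merge: "n * (if r = 0 then 0 else merge_op (merge_sum g (r - 1)) m)
        = c * (\<Sum>i\<in>I. \<Sum>j\<in>I-{i}. ?\<mu> j * moment g (I - {i}) (?\<mu>(j := ?\<mu> i + ?\<mu> j)))"
    proof (cases "r = 0")
      case True
      then obtain i where "I = {i}" using I by (auto simp: card_Suc_eq)
      then show ?thesis using True by simp
    next
      case False
      have H: "n * merge_sum g (r - 1) (add_mset (\<mu> i + \<mu> j) (image_mset \<mu> (mset_set (I - {i, j}))))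
          = c * moment g (I - {i}) (?\<mu>(j := ?\<mu> i + ?\<mu> j))" if ij: "i \<in> I" "j \<in> I - {i}" for i j
      proof -
        let ?\<nu> = "\<mu>(j := \<mu> i + \<mu> j)"
        have J: "I - {i} = insert j (I - {i, j})" using ij by auto
        have "image_mset ?\<nu> (mset_set (I - {i})) = add_mset (\<mu> i + \<mu> j) (image_mset ?\<nu> (mset_set (I - {i, j})))"
          using I by (subst J) (subst mset_set.insert, auto)
        also have "image_mset ?\<nu> (mset_set (I - {i, j})) = image_mset \<mu> (mset_set (I - {i, j}))"
          using I by (intro image_mset_cong) auto
        finally have m': "image_mset ?\<nu> (mset_set (I - {i}))
          = add_mset (\<mu> i + \<mu> j) (image_mset \<mu> (mset_set (I - {i, j})))" .
        have "sum ?\<nu> (I - {i}) = \<mu> i + \<mu> j + sum ?\<nu> (I - {i, j})"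
          using I by (subst J) (subst sum.insert, auto)
        also have "sum ?\<nu> (I - {i, j}) = sum \<mu> (I - {i, j})" by (rule sum.cong) auto
        also have "\<mu> i + \<mu> j + sum \<mu> (I - {i, j}) = sum \<mu> I"
          using I ij sum.remove[of I i \<mu>] sum.insert[of "I - {i, j}" j \<mu>] J by simp
        finally have s: "sum ?\<nu> (I - {i}) = sum \<mu> I" .
        have "merge_sum g (r - 1) (image_mset ?\<nu> (mset_set (I - {i})))
            = real (sum ?\<nu> (I - {i})) ^ (r - 1 + g) / (2 ^ g * fact g) * moment g (I - {i}) (\<lambda>i. real (?\<nu> i))"
          by (rule less.hyps) (use \<open>r \<noteq> 0\<close> I ij pos s in auto)
        moreover have "(\<lambda>l. real (?\<nu> l)) = ?\<mu>(j := ?\<mu> i + ?\<mu> j)" by auto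
        ultimately have "merge_sum g (r - 1) (add_mset (\<mu> i + \<mu> j) (image_mset \<mu> (mset_set (I - {i, j}))))
            = n ^ (r - 1 + g) / (2 ^ g * fact g) * moment g (I - {i}) (?\<mu>(j := ?\<mu> i + ?\<mu> j))"
          by (simp only: m' s n_def)
        moreover have "n * (n ^ (r - 1 + g) / (2 ^ g * fact g)) = c"
          using \<open>r \<noteq> 0\<close> by (cases r) (auto simp: c_def)
        ultimately show ?thesis by (simp only: flip: mult.assoc)
      qed
      have key: "n * (?\<mu> j * merge_sum g (r - 1) (add_mset (\<mu> i + \<mu> j) (image_mset \<mu> (mset_set (I - {i, j})))))
          = c * (?\<mu> j * moment g (I - {i}) (?\<mu>(j := ?\<mu> i + ?\<mu> j)))" if "i \<in> I" "j \<in> I - {i}" for i j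
        by (metis H[OF that] mult.left_commute)
      have "n * merge_op (merge_sum g (r - 1)) m
          = c * (\<Sum>i\<in>I. \<Sum>j\<in>I-{i}. ?\<mu> j * moment g (I - {i}) (?\<mu>(j := ?\<mu> i + ?\<mu> j)))"
        unfolding m_def merge_op_image[OF I(1)] sum_distrib_left by (intro sum.cong refl key)
      then show ?thesis using False by simp
    qed
    have genus: "n * (if g = 0 then 0 else genus_weight m * merge_sum (g - 1) r m)
        = c * (2 * real g * genus_weight m * moment (g - 1) I ?\<mu>)"
    proof (cases "g = 0")
      case False
      then obtain h where h: "g = Suc h" by (cases g) auto
      have h_sum: "merge_sum h r m = n ^ (r + h) / (2 ^ h * fact h) * moment h I ?\<mu>"
        unfolding m_def n_def by (rule less.hyps) (use h I pos in auto)
      have h_factor: "n * (n ^ (r + h) / (2 ^ h * fact h)) = c * (2 * real g)"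
      proof -
        have "c = n * n ^ (r + h) / (2 * real g * (2 ^ h * fact h))"
          by (simp add: c_def h algebra_simps)
        moreover have "a / (2 * real g * b) * (2 * real g) = a / b" for a b
          using h by simp
        ultimately show ?thesis by simp
      qed
      have "n * (w * (a * v)) = c * (k * w * v)" if "n * a = c * k" for a v w k
        using that by (metis mult.assoc mult.commute)
      from this[OF h_factor, of "genus_weight m" "moment h I ?\<mu>"]
      have "n * (genus_weight m * merge_sum h r m) = c * (2 * real g * genus_weight m * moment h I ?\<mu>)"
        by (simp only: h_sum)
      then show ?thesis using h by simp
    qed simp
    have "n * (real (2 * g + r) * merge_sum g r m)
        = c * (\<Sum>i\<in>I. \<Sum>j\<in>I-{i}. ?\<mu> j * moment g (I - {i}) (?\<mu>(j := ?\<mu> i + ?\<mu> j)))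
          + c * (2 * real g * genus_weight m * moment (g - 1) I ?\<mu>)"
      using merge_sum_rec[of g r m] False by (simp only: flip: merge genus) (auto simp: distrib_left)
    also have "\<dots> = c * ((real (card I) - 1 + 2 * real g) * n * moment g I ?\<mu>)"
      unfolding moment_merge[OF I(1) I'] n_sum m_def genus_weight_image by (simp add: algebra_simps)
    finally have "n * (real (2 * g + r) * merge_sum g r m)
        = c * ((real (card I) - 1 + 2 * real g) * n * moment g I ?\<mu>)" .
    moreover have "real (card I) - 1 + 2 * real g = real (2 * g + r)" using I by simp
    ultimately have "(n * real (2 * g + r)) * merge_sum g r m = (n * real (2 * g + r)) * (c * moment g I ?\<mu>)"
      by (simp only: mult_ac)
    moreover have "n * real (2 * g + r) \<noteq> 0" using n False by auto
    ultimately have "merge_sum g r m = c * moment g I ?\<mu>" by simp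
    then show ?thesis by (simp add: m_def c_def n_def)
  qed
qed

section \<open>Powers of the energy of unit masses\<close>

text \<open>
  A function of multisets stands for the coefficients of a power series in variables \<open>z\<^sub>i\<close>, a multiset
  for a monomial; \<open>lower \<beta>\<close> is the multiplication by the monomial \<open>\<beta>\<close>.
\<close>

definition lower :: "nat multiset \<Rightarrow> (nat multiset \<Rightarrow> real) \<Rightarrow> nat multiset \<Rightarrow> real" where
  "lower \<beta> f \<alpha> = (if \<beta> \<subseteq># \<alpha> then f (\<alpha> - \<beta>) else 0)"

text \<open>
  The coefficient of the monomial \<open>\<alpha>\<close> in the \<open>h\<close>-th power of \<open>\<Sum>i j. z\<^sub>i z\<^sub>j kernel (x i - x j)\<close>.
\<close>

fun energy_coeff :: "nat set \<Rightarrow> (nat \<Rightarrow> real) \<Rightarrow> nat \<Rightarrow> nat multiset \<Rightarrow> real" where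
  "energy_coeff K x 0 \<alpha> = of_bool (\<alpha> = {#})"
| "energy_coeff K x (Suc h) \<alpha>
    = (\<Sum>i\<in>K. \<Sum>j\<in>K. kernel (x i - x j) * lower {#i, j#} (energy_coeff K x h) \<alpha>)"

lemma lower_lower: "lower \<beta> (lower \<gamma> f) \<alpha> = lower (\<beta> + \<gamma>) f \<alpha>"
  by (auto simp: lower_def subset_mset.le_diff_conv2 subset_mset.add_increasing diff_diff_add
      mset_subset_eq_add_left subset_mset.trans[of \<beta> "\<beta> + \<gamma>"] add.commute)

lemma lower_commute: "lower \<beta> (lower \<gamma> f) \<alpha> = lower \<gamma> (lower \<beta> f) \<alpha>"
  by (simp add: lower_lower add.commute)

lemma lower_sum: "lower \<beta> (\<lambda>\<alpha>. \<Sum>a\<in>A. f a \<alpha>) \<alpha> = (\<Sum>a\<in>A. lower \<beta> (f a) \<alpha>)"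
  by (simp add: lower_def)

lemma lower_cmult: "lower \<beta> (\<lambda>\<alpha>. c * f \<alpha>) \<alpha> = c * lower \<beta> f \<alpha>"
  by (simp add: lower_def)

lemma count_times_lower:
  "real (count \<alpha> a) * lower {#i, j#} f \<alpha>
    = lower {#i, j#} (\<lambda>\<beta>. real (count \<beta> a) * f \<beta>) \<alpha> + (of_bool (i = a) + of_bool (j = a)) * lower {#i, j#} f \<alpha>"
proof (cases "{#i, j#} \<subseteq># \<alpha>")
  case True
  then obtain \<beta> where "\<alpha> = {#i, j#} + \<beta>" by (metis subset_mset.add_diff_inverse)
  then show ?thesis by (auto simp: lower_def algebra_simps)
qed (simp add: lower_def)

text \<open>
  Put \<open>z\<^sub>i = 1\<close> for the points of \<open>L\<close> and \<open>z\<^sub>i = 0\<close> for the other ones.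
\<close>

lemma energy_power_expansion:
  assumes "finite K" "L \<subseteq> K"
  shows "energy L (\<lambda>_. 1) x ^ h = (\<Sum>\<alpha>\<in>multisets_of_size L (2 * h). energy_coeff K x h \<alpha>)"
proof (induction h)
  case 0
  show ?case by simp
next
  case (Suc h)
  have L: "finite L" using assms finite_subset by blast
  let ?M = "multisets_of_size L"
  have fin: "finite (?M m)" for m using L by (rule finite_multisets_of_size)
  have shift: "(\<Sum>\<alpha>\<in>?M (2 * Suc h). lower {#i, j#} f \<alpha>)
      = of_bool (i \<in> L \<and> j \<in> L) * (\<Sum>\<beta>\<in>?M (2 * h). f \<beta>)" for i j f
  proof -
    have "(\<Sum>\<alpha>\<in>?M (2 * Suc h). lower {#i, j#} f \<alpha>)
        = (\<Sum>\<alpha>\<in>{\<alpha>\<in>?M (2 * Suc h). {#i, j#} \<subseteq># \<alpha>}. f (\<alpha> - {#i, j#}))"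
      by (rule sum.mono_neutral_cong_right) (auto simp: fin lower_def)
    also have "\<dots> = of_bool (i \<in> L \<and> j \<in> L) * (\<Sum>\<beta>\<in>?M (2 * h). f \<beta>)"
    proof (cases "i \<in> L \<and> j \<in> L")
      case True
      have "(\<Sum>\<alpha>\<in>{\<alpha>\<in>?M (2 * Suc h). {#i, j#} \<subseteq># \<alpha>}. f (\<alpha> - {#i, j#})) = (\<Sum>\<beta>\<in>?M (2 * h). f \<beta>)"
      proof (rule sum.reindex_bij_witness[of _ "\<lambda>\<beta>. \<beta> + {#i, j#}" "\<lambda>\<alpha>. \<alpha> - {#i, j#}"])
        fix \<alpha> assume "\<alpha> \<in> {\<alpha>\<in>?M (2 * Suc h). {#i, j#} \<subseteq># \<alpha>}"
        then show "\<alpha> - {#i, j#} + {#i, j#} = \<alpha>" by (intro subset_mset.diff_add) simp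
      qed (use True in \<open>auto simp: multisets_of_size_def size_Diff_submset dest!: in_diffD\<close>)
      then show ?thesis using True by simp
    next
      case False
      then have "{\<alpha>\<in>?M (2 * Suc h). {#i, j#} \<subseteq># \<alpha>} = {}"
        by (auto simp: multisets_of_size_def dest!: set_mset_mono)
      then show ?thesis using False by (simp only: sum.empty) simp
    qed
    finally show ?thesis .
  qed
  have "(\<Sum>\<alpha>\<in>?M (2 * Suc h). energy_coeff K x (Suc h) \<alpha>)
      = (\<Sum>i\<in>K. \<Sum>j\<in>K. kernel (x i - x j) * (\<Sum>\<alpha>\<in>?M (2 * Suc h). lower {#i, j#} (energy_coeff K x h) \<alpha>))"
    unfolding energy_coeff.simps sum_distrib_left
    by (subst sum.swap, rule sum.cong[OF refl], rule sum.swap)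
  also have "\<dots> = (\<Sum>i\<in>K. \<Sum>j\<in>K. of_bool (i \<in> L \<and> j \<in> L) * kernel (x i - x j) * energy L (\<lambda>_. 1) x ^ h)"
    unfolding shift Suc.IH by (simp add: mult_ac)
  also have "\<dots> = (\<Sum>i\<in>L. \<Sum>j\<in>L. kernel (x i - x j) * energy L (\<lambda>_. 1) x ^ h)"
  proof -
    have "(\<Sum>j\<in>K. of_bool (i \<in> L \<and> j \<in> L) * kernel (x i - x j) * c)
        = of_bool (i \<in> L) * (\<Sum>j\<in>L. kernel (x i - x j) * c)" for i c
      unfolding sum_distrib_left using assms
      by (intro sum.mono_neutral_cong_right) auto
    then show ?thesis
      using assms by (simp only:) (intro sum.mono_neutral_cong_right, auto)
  qed
  also have "\<dots> = energy L (\<lambda>_. 1) x ^ Suc h"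
    by (simp add: energy_def sum_distrib_right)
  finally show ?case ..
qed

text \<open>
  The coefficients of the identity \<open>z\<^sub>a \<partial>\<^sub>a q\<^bsup>h+1\<^esup> = 2 (h + 1) z\<^sub>a (\<Sum>l. kernel (x a - x l) z\<^sub>l) q\<^sup>h\<close> for the
  quadratic form \<open>q\<close> of the kernel.  This is the Wick recursion: it picks an occurrence of \<open>a\<close> and
  sums over its possible partners.
\<close>

lemma count_times_energy_coeff:
  assumes "finite K" "a \<in> K" "x \<in> space points"
  shows "real (count \<alpha> a) * energy_coeff K x (Suc h) \<alpha>
    = 2 * real (Suc h) * (\<Sum>l\<in>K. kernel (x a - x l) * lower {#a, l#} (energy_coeff K x h) \<alpha>)"
proof (induction h arbitrary: \<alpha>)
  \<comment> \<open>The occurrence of \<open>a\<close> may lie in the factor that is split off from the power; the two positions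
    in that factor give equal contributions.\<close>
  have diag: "(\<Sum>i\<in>K. \<Sum>j\<in>K. kernel (x i - x j) * ((of_bool (i = a) + of_bool (j = a)) * lower {#i, j#} f \<alpha>))
      = 2 * (\<Sum>l\<in>K. kernel (x a - x l) * lower {#a, l#} f \<alpha>)" for f \<alpha>
  proof -
    have "(\<Sum>i\<in>K. \<Sum>j\<in>K. kernel (x i - x j) * (of_bool (i = a) * lower {#i, j#} f \<alpha>))
        = (\<Sum>i\<in>K. if i = a then \<Sum>j\<in>K. kernel (x a - x j) * lower {#a, j#} f \<alpha> else 0)"
      by (intro sum.cong) auto
    also have "\<dots> = (\<Sum>l\<in>K. kernel (x a - x l) * lower {#a, l#} f \<alpha>)"
      using assms by simp
    finally have 1: "(\<Sum>i\<in>K. \<Sum>j\<in>K. kernel (x i - x j) * (of_bool (i = a) * lower {#i, j#} f \<alpha>))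
        = (\<Sum>l\<in>K. kernel (x a - x l) * lower {#a, l#} f \<alpha>)" .
    have "(\<Sum>i\<in>K. \<Sum>j\<in>K. kernel (x i - x j) * (of_bool (j = a) * lower {#i, j#} f \<alpha>))
        = (\<Sum>i\<in>K. \<Sum>j\<in>K. if j = a then kernel (x i - x a) * lower {#i, a#} f \<alpha> else 0)"
      by (intro sum.cong) auto
    also have "\<dots> = (\<Sum>i\<in>K. kernel (x i - x a) * lower {#i, a#} f \<alpha>)"
      using assms by simp
    also have "\<dots> = (\<Sum>l\<in>K. kernel (x a - x l) * lower {#a, l#} f \<alpha>)"
      using space_points_kernel_commute[OF assms(3)] by (simp add: add_mset_commute)
    finally have 2: "(\<Sum>i\<in>K. \<Sum>j\<in>K. kernel (x i - x j) * (of_bool (j = a) * lower {#i, j#} f \<alpha>))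
        = (\<Sum>l\<in>K. kernel (x a - x l) * lower {#a, l#} f \<alpha>)" .
    have "(\<Sum>i\<in>K. \<Sum>j\<in>K. kernel (x i - x j) * ((of_bool (i = a) + of_bool (j = a)) * lower {#i, j#} f \<alpha>))
        = (\<Sum>i\<in>K. \<Sum>j\<in>K. kernel (x i - x j) * (of_bool (i = a) * lower {#i, j#} f \<alpha>))
          + (\<Sum>i\<in>K. \<Sum>j\<in>K. kernel (x i - x j) * (of_bool (j = a) * lower {#i, j#} f \<alpha>))"
      by (simp add: distrib_left distrib_right sum.distrib)
    then show ?thesis unfolding 1 2 by simp
  qed
  have expand: "real (count \<alpha> a) * energy_coeff K x (Suc h) \<alpha>
      = (\<Sum>i\<in>K. \<Sum>j\<in>K. kernel (x i - x j) * lower {#i, j#} (\<lambda>\<beta>. real (count \<beta> a) * energy_coeff K x h \<beta>) \<alpha>)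
        + 2 * (\<Sum>l\<in>K. kernel (x a - x l) * lower {#a, l#} (energy_coeff K x h) \<alpha>)" for h \<alpha>
  proof -
    have "real (count \<alpha> a) * energy_coeff K x (Suc h) \<alpha>
        = (\<Sum>i\<in>K. \<Sum>j\<in>K. kernel (x i - x j) * (real (count \<alpha> a) * lower {#i, j#} (energy_coeff K x h) \<alpha>))"
      by (simp add: sum_distrib_left mult.left_commute[of "real (count \<alpha> a)"])
    then show ?thesis
      unfolding count_times_lower distrib_left[of "kernel _"] sum.distrib diag .
  qed
  {
    case 0
    have "lower \<gamma> (\<lambda>\<beta>. real (count \<beta> a) * energy_coeff K x 0 \<beta>) \<alpha> = 0" for \<gamma>
    proof -
      have "real (count \<beta> a) * energy_coeff K x 0 \<beta> = 0" for \<beta> by auto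
      then show ?thesis by (simp only: lower_def if_cancel)
    qed
    then show ?case unfolding expand by (simp del: energy_coeff.simps)
  next
    case (Suc h)
    have "(\<Sum>i\<in>K. \<Sum>j\<in>K. kernel (x i - x j) * lower {#i, j#} (\<lambda>\<beta>. real (count \<beta> a) * energy_coeff K x (Suc h) \<beta>) \<alpha>)
        = (\<Sum>i\<in>K. \<Sum>j\<in>K. \<Sum>l\<in>K. 2 * real (Suc h) * (kernel (x a - x l) *
            (kernel (x i - x j) * lower {#a, l#} (lower {#i, j#} (energy_coeff K x h)) \<alpha>)))"
      unfolding Suc.IH lower_cmult lower_sum sum_distrib_left
      by (simp only: lower_commute[of "{#a, _#}"] mult_ac)
    also have "\<dots> = (\<Sum>l\<in>K. \<Sum>i\<in>K. \<Sum>j\<in>K. 2 * real (Suc h) * (kernel (x a - x l) *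
            (kernel (x i - x j) * lower {#a, l#} (lower {#i, j#} (energy_coeff K x h)) \<alpha>)))"
      by (subst sum.swap, subst (2) sum.swap, rule refl)
    also have "\<dots> = 2 * real (Suc h) * (\<Sum>l\<in>K. kernel (x a - x l) * lower {#a, l#} (energy_coeff K x (Suc h)) \<alpha>)"
    proof -
      have "lower \<gamma> (energy_coeff K x (Suc h)) \<alpha>
          = (\<Sum>i\<in>K. \<Sum>j\<in>K. kernel (x i - x j) * lower \<gamma> (lower {#i, j#} (energy_coeff K x h)) \<alpha>)" for \<gamma>
        by (cases "\<gamma> \<subseteq># \<alpha>") (simp_all add: lower_def)
      then show ?thesis by (simp add: sum_distrib_left)
    qed
    finally show ?case unfolding expand by (simp add: algebra_simps del: energy_coeff.simps)
  }
qed

lemma energy_coeff_irrelevant: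
  "i \<notin># \<alpha> \<Longrightarrow> energy_coeff K (x(i := t)) h \<alpha> = energy_coeff K x h \<alpha>"
proof (induction h arbitrary: \<alpha>)
  case (Suc h)
  have "kernel ((x(i := t)) k - (x(i := t)) l) * lower {#k, l#} (energy_coeff K (x(i := t)) h) \<alpha>
      = kernel (x k - x l) * lower {#k, l#} (energy_coeff K x h) \<alpha>" for k l
  proof (cases "{#k, l#} \<subseteq># \<alpha>")
    case True
    then have "k \<noteq> i" "l \<noteq> i" using Suc.prems by (auto dest!: set_mset_mono)
    moreover have "i \<notin># \<alpha> - {#k, l#}" using Suc.prems in_diffD by metis
    ultimately show ?thesis
      using Suc.IH[of "\<alpha> - {#k, l#}"] by (simp add: lower_def fun_upd_other del: fun_upd_apply)
  qed (simp add: lower_def)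
  then show ?case by (simp only: energy_coeff.simps)
qed simp

lemma bounded_rv_energy_coeff [bounded_rv_intros]: "bounded_rv (\<lambda>x. energy_coeff K x h \<alpha>)"
proof (induction h arbitrary: \<alpha>)
  case (Suc h)
  then show ?case
    unfolding energy_coeff.simps lower_def by (intro bounded_rv_intros)
qed (simp add: bounded_rv_const)

text \<open>
  By \<open>count_times_energy_coeff\<close> the point \<open>a\<close> enters through a single factor \<open>kernel (x a - x l)\<close> with
  \<open>l \<noteq> a\<close>, and the integral of the kernel over the circle is zero.
\<close>

lemma expect_energy_coeff_single:
  assumes K: "finite K" "a \<in> K" and a: "count \<alpha> a = 1"
  shows "expect (\<lambda>x. energy_coeff K x h \<alpha>) = 0"
proof (cases h)
  case 0
  then show ?thesis using a by auto
next
  case (Suc h')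
  let ?L = "\<lambda>x l. lower {#a, l#} (energy_coeff K x h') \<alpha>"
  have "energy_coeff K x h \<alpha> = 2 * real h * (\<Sum>l\<in>K-{a}. kernel (x a - x l) * ?L x l)"
    if "x \<in> space points" for x
  proof -
    have "\<not> {#a, a#} \<subseteq># \<alpha>"
      using a by (auto dest: mset_subset_eq_count[of _ _ a])
    then have "?L x a = 0" by (simp add: lower_def)
    then have "(\<Sum>l\<in>K. kernel (x a - x l) * ?L x l) = (\<Sum>l\<in>K-{a}. kernel (x a - x l) * ?L x l)"
      using K by (simp add: sum.remove)
    then show ?thesis
      using count_times_energy_coeff[OF K that, of \<alpha> h'] a Suc by simp
  qed
  then have "expect (\<lambda>x. energy_coeff K x h \<alpha>)
      = expect (\<lambda>x. 2 * real h * (\<Sum>l\<in>K-{a}. kernel (x a - x l) * ?L x l))"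
    by (intro Bochner_Integration.integral_cong refl)
  also have "\<dots> = expect (\<lambda>_. 0)"
  proof (rule expect_integrate[of _ a])
    show "bounded_rv (\<lambda>x. 2 * real h * (\<Sum>l\<in>K-{a}. kernel (x a - x l) * ?L x l))"
      unfolding lower_def by (intro bounded_rv_intros)
    fix x assume x: "x \<in> space points"
    have L: "?L (x(a := t)) l = ?L x l" if "l \<in> K - {a}" for l t
    proof (cases "{#a, l#} \<subseteq># \<alpha>")
      case True
      have "count (\<alpha> - {#a, l#}) a = 0" using a by simp
      then have "a \<notin># \<alpha> - {#a, l#}" by (simp only: count_eq_zero_iff not_False_eq_True)
      then show ?thesis by (simp only: lower_def energy_coeff_irrelevant[OF \<open>a \<notin># \<alpha> - {#a, l#}\<close>])
    qed (simp add: lower_def)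
    have "((\<lambda>t. 2 * real h * (\<Sum>l\<in>K-{a}. kernel (t - x l) * ?L x l)) has_integral
        2 * real h * (\<Sum>l\<in>K-{a}. 0 * ?L x l)) {0..1}"
      unfolding kernel_def using K x
      by (intro has_integral_mult_right has_integral_sum has_integral_mult_left has_integral_perbern)
         (auto simp: space_points)
    moreover have "2 * real h * (\<Sum>l\<in>K-{a}. kernel (t - x l) * ?L x l)
        = 2 * real h * (\<Sum>l\<in>K-{a}. kernel ((x(a := t)) a - (x(a := t)) l) * ?L (x(a := t)) l)" for t
      by (intro arg_cong[where f = "\<lambda>s. 2 * real h * s"] sum.cong refl) (auto simp: L)
    ultimately show "((\<lambda>t. 2 * real h * (\<Sum>l\<in>K-{a}. kernel ((x(a := t)) a - (x(a := t)) l) * ?L (x(a := t)) l))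
        has_integral 0) {0..1}" by simp
  qed
  finally show ?thesis by simp
qed

section \<open>Finite differences in the number of points\<close>

text \<open>
  The monomial in which each variable of \<open>I\<close> has exponent \<open>2\<close>.
\<close>

definition twice :: "nat set \<Rightarrow> nat multiset" where
  "twice I = mset_set I + mset_set I"

text \<open>
  The coefficients of \<open>(t/2) / sin (t/2)\<close> in powers of \<open>t\<^sup>2\<close>.
\<close>

definition sine_coeff :: "nat \<Rightarrow> real" where
  "sine_coeff g = (-1) ^ g * csch_coeff (2 * g)"

lemma sine_coeff_0: "sine_coeff 0 = 1"
  by (simp add: sine_coeff_def csch_coeff_0)

lemma sine_coeff_rec:
  "2 * real (Suc g) * sine_coeff (Suc g) = (\<Sum>k\<le>g. sine_coeff (g - k) * kernel_power (Suc k) 0)"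
proof -
  have "2 * real (Suc g) * sine_coeff (Suc g)
      = (-1) ^ Suc g * (real (2 * Suc g) * csch_coeff (2 * Suc g))"
    by (simp add: sine_coeff_def)
  also have "\<dots> = (\<Sum>l=1..Suc g. (-1) ^ g * (bern (2 * l) * csch_coeff (2 * (Suc g - l))))"
    using csch_coeff_rec[of "Suc g"]
    by (simp only:) (simp add: sum_distrib_left sum_negf del: sum.cl_ivl_Suc)
  also have "\<dots> = (\<Sum>k\<in>{0..g}. (-1) ^ g * (bern (2 * Suc k) * csch_coeff (2 * (g - k))))"
    using sum.shift_bounds_cl_Suc_ivl[of "\<lambda>l. (-1) ^ g * (bern (2 * l) * csch_coeff (2 * (Suc g - l)))" 0 g]
    by simp
  also have "\<dots> = (\<Sum>k\<in>{0..g}. sine_coeff (g - k) * kernel_power (Suc k) 0)"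
  proof (rule sum.cong[OF refl])
    fix k assume "k \<in> {0..g}"
    then have "(-1 :: real) ^ g = (-1) ^ (g - k) * (-1) ^ (Suc k + 1)"
      by (simp flip: power_add)
    then show "(-1) ^ g * (bern (2 * Suc k) * csch_coeff (2 * (g - k))) = sine_coeff (g - k) * kernel_power (Suc k) 0"
      by (simp only: sine_coeff_def kernel_power_0 mult_ac)
  qed
  finally show ?thesis by (simp add: atLeast0AtMost)
qed

text \<open>
  If each point of \<open>I\<close> is used twice and the points \<open>a\<close> and \<open>b\<close> once, then the factors form cycles and
  one open chain from \<open>a\<close> to \<open>b\<close>.  Up to a factor, this is the sum over all such products, expanded
  according to the neighbour of \<open>a\<close> in the chain: either \<open>b\<close> or some \<open>l\<close> in \<open>I\<close>.
\<close>

definition chain_coeff :: "nat set \<Rightarrow> nat set \<Rightarrow> nat \<Rightarrow> nat \<Rightarrow> (nat \<Rightarrow> real) \<Rightarrow> real" where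
  "chain_coeff K I a b x = kernel (x a - x b) * energy_coeff K x (card I) (twice I)
    + (\<Sum>l\<in>I. kernel (x a - x l) * energy_coeff K x (card I) (twice (I - {l}) + {#l, b#}))"

lemma bounded_rv_chain_coeff [bounded_rv_intros]: "bounded_rv (chain_coeff K I a b)"
proof -
  have "chain_coeff K I a b = (\<lambda>x. kernel (x a - x b) * energy_coeff K x (card I) (twice I)
    + (\<Sum>l\<in>I. kernel (x a - x l) * energy_coeff K x (card I) (twice (I - {l}) + {#l, b#})))"
    by (rule ext) (simp add: chain_coeff_def)
  then show ?thesis by (simp only:) (intro bounded_rv_intros)
qed

text \<open>
  Apply \<open>count_times_energy_coeff\<close> to the only occurrence of \<open>a\<close>.
\<close>

lemma energy_coeff_open:
  assumes K: "finite K" "I \<subseteq> K" "a \<in> K" "b \<in> K" and ab: "a \<noteq> b" "a \<notin> I" "b \<notin> I"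
    and x: "x \<in> space points"
  shows "energy_coeff K x (Suc (card I)) (twice I + {#a, b#})
    = 2 * real (Suc (card I)) * chain_coeff K I a b x"
proof -
  have I: "finite I" using K finite_subset by blast
  let ?m = "twice I + {#a, b#}" and ?N = "energy_coeff K x (card I)"
  have b: "lower {#a, b#} ?N ?m = ?N (twice I)" by (simp add: lower_def)
  have l: "lower {#a, l#} ?N ?m = ?N (twice (I - {l}) + {#l, b#})" if "l \<in> I" for l
  proof -
    have "?m = {#a, l#} + (twice (I - {l}) + {#l, b#})"
      using I that by (simp add: twice_def mset_set.remove[of I l])
    then show ?thesis by (simp add: lower_def)
  qed
  have other: "lower {#a, l#} ?N ?m = 0" if "l \<notin> insert b I" for l
  proof -
    have "count ?m l < count {#a, l#} l" using that I ab by (auto simp: twice_def)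
    then have "\<not> {#a, l#} \<subseteq># ?m" by (meson leD mset_subset_eq_count)
    then show ?thesis by (simp add: lower_def)
  qed
  have "real (count ?m a) * energy_coeff K x (Suc (card I)) ?m
      = 2 * real (Suc (card I)) * (\<Sum>l\<in>K. kernel (x a - x l) * lower {#a, l#} ?N ?m)"
    by (rule count_times_energy_coeff) (use K x in auto)
  also have "count ?m a = 1" using ab I by (simp add: twice_def)
  also have "(\<Sum>l\<in>K. kernel (x a - x l) * lower {#a, l#} ?N ?m)
      = (\<Sum>l\<in>insert b I. kernel (x a - x l) * lower {#a, l#} ?N ?m)"
    by (rule sum.mono_neutral_right) (use K other in auto)
  also have "\<dots> = chain_coeff K I a b x"
  proof -
    have "(\<Sum>l\<in>I. kernel (x a - x l) * lower {#a, l#} ?N ?m)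
        = (\<Sum>l\<in>I. kernel (x a - x l) * ?N (twice (I - {l}) + {#l, b#}))"
      by (rule sum.cong[OF refl]) (simp only: l)
    then show ?thesis
      by (simp only: sum.insert[OF I ab(3)] chain_coeff_def b)
  qed
  finally show ?thesis by (simp del: energy_coeff.simps)
qed

text \<open>
  Opening the cycle through \<open>a\<close> at \<open>a\<close> gives a chain from \<open>a\<close> to itself; the two occurrences of \<open>a\<close>
  cancel the factor \<open>2\<close> of \<open>energy_coeff_open\<close>.
\<close>

lemma energy_coeff_closed:
  assumes K: "finite K" "I \<subseteq> K" "a \<in> K" and a: "a \<notin> I" and x: "x \<in> space points"
  shows "energy_coeff K x (Suc (card I)) (twice (insert a I)) = real (Suc (card I)) * chain_coeff K I a a x"
proof -
  have I: "finite I" using K finite_subset by blast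
  let ?m = "twice (insert a I)" and ?N = "energy_coeff K x (card I)"
  have m: "?m = {#a, a#} + twice I" using I a by (simp add: twice_def)
  have aa: "lower {#a, a#} ?N ?m = ?N (twice I)" unfolding m by (simp add: lower_def)
  have l: "lower {#a, l#} ?N ?m = ?N (twice (I - {l}) + {#l, a#})" if "l \<in> I" for l
  proof -
    have "?m = {#a, l#} + (twice (I - {l}) + {#l, a#})"
      using I that unfolding m by (simp add: twice_def mset_set.remove[of I l])
    then show ?thesis by (simp add: lower_def)
  qed
  have other: "lower {#a, l#} ?N ?m = 0" if "l \<notin> insert a I" for l
  proof -
    have "count ?m l < count {#a, l#} l" using that I by (auto simp: twice_def)
    then have "\<not> {#a, l#} \<subseteq># ?m" by (meson leD mset_subset_eq_count)
    then show ?thesis by (simp add: lower_def)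
  qed
  have "real (count ?m a) * energy_coeff K x (Suc (card I)) ?m
      = 2 * real (Suc (card I)) * (\<Sum>l\<in>K. kernel (x a - x l) * lower {#a, l#} ?N ?m)"
    by (rule count_times_energy_coeff) (use K x in auto)
  also have "count ?m a = 2" using a I by (simp add: twice_def)
  also have "(\<Sum>l\<in>K. kernel (x a - x l) * lower {#a, l#} ?N ?m)
      = (\<Sum>l\<in>insert a I. kernel (x a - x l) * lower {#a, l#} ?N ?m)"
    by (rule sum.mono_neutral_right) (use K other in auto)
  also have "\<dots> = chain_coeff K I a a x"
  proof -
    have "(\<Sum>l\<in>I. kernel (x a - x l) * lower {#a, l#} ?N ?m)
        = (\<Sum>l\<in>I. kernel (x a - x l) * ?N (twice (I - {l}) + {#l, a#}))"
      by (rule sum.cong[OF refl]) (simp only: l)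
    then show ?thesis
      by (simp only: sum.insert[OF I a] chain_coeff_def aa)
  qed
  finally show ?thesis by (simp add: algebra_simps del: energy_coeff.simps)
qed

definition free_of :: "((nat \<Rightarrow> real) \<Rightarrow> real) \<Rightarrow> nat set \<Rightarrow> bool" where
  "free_of \<theta> I \<longleftrightarrow> (\<forall>i\<in>I. \<forall>x t. \<theta> (x(i := t)) = \<theta> x)"

lemma free_of_mult_kernel:
  "free_of \<theta> I \<Longrightarrow> J \<subseteq> I \<Longrightarrow> a \<notin> J \<Longrightarrow> b \<notin> J \<Longrightarrow> free_of (\<lambda>x. \<theta> x * kernel (x a - x b)) J"
  by (auto simp: free_of_def)

lemma expect_kernel_convolution:
  assumes \<theta>: "bounded_rv \<theta>" "free_of \<theta> {l}" and l: "l \<noteq> a" "l \<noteq> b"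
  shows "expect (\<lambda>x. \<theta> x * kernel (x a - x l) * kernel_power (Suc k) (x l - x b))
    = expect (\<lambda>x. \<theta> x * kernel_power (Suc (Suc k)) (x a - x b))"
proof (rule expect_integrate[of _ l])
  show "bounded_rv (\<lambda>x. \<theta> x * kernel (x a - x l) * kernel_power (Suc k) (x l - x b))"
    by (intro bounded_rv_intros \<theta>)
  fix x assume x: "x \<in> space points"
  have "((\<lambda>t. \<theta> x * (kernel (x a - t) * kernel_power (Suc k) (t - x b))) has_integral
      \<theta> x * kernel_power (Suc (Suc k)) (x a - x b)) {0..1}"
    using x by (intro has_integral_mult_right has_integral_kernel_convolution) (auto simp: space_points)
  then show "((\<lambda>t. \<theta> (x(l := t)) * kernel ((x(l := t)) a - (x(l := t)) l) * kernel_power (Suc k) ((x(l := t)) l - (x(l := t)) b))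
      has_integral \<theta> x * kernel_power (Suc (Suc k)) (x a - x b)) {0..1}"
    using l \<theta>(2) by (simp add: free_of_def mult.assoc)
qed

lemma expect_cong: "(\<And>x. x \<in> space points \<Longrightarrow> f x = h x) \<Longrightarrow> expect f = expect h"
  by (rule Bochner_Integration.integral_cong) auto

text \<open>
  On average a chain with \<open>k\<close> interior points becomes the convolution power of the kernel of exponent
  \<open>k + 1\<close>, while the other \<open>g - k\<close> points form cycles and contribute \<open>sine_coeff (g - k)\<close>, up to powers of
  \<open>2\<close> and factorials.  The induction integrates out the neighbour of \<open>a\<close>.  If there is none in \<open>I\<close>, then all points lie on cycles; opening
  one of these leads back to chains with one point less, and \<open>sine_coeff_rec\<close> sums up their
  contributions.  The factor \<open>\<theta>\<close> carries along the part of the chain that is already integrated.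
\<close>

lemma expect_chain_coeff:
  assumes "finite K" "I \<subseteq> K" "a \<in> K" "b \<in> K" "a \<notin> I" "b \<notin> I" "card I = g"
    and "bounded_rv \<theta>" "free_of \<theta> I"
  shows "expect (\<lambda>x. \<theta> x * chain_coeff K I a b x)
    = 2 ^ g * fact g * fact g * (\<Sum>k\<le>g. sine_coeff (g - k) * expect (\<lambda>x. \<theta> x * kernel_power (Suc k) (x a - x b)))"
  using assms
proof (induction g arbitrary: I a b \<theta>)
  case 0
  then have "I = {}" using finite_subset by fastforce
  then show ?case by (simp add: chain_coeff_def twice_def sine_coeff_0 kernel_power_1)
next
  case (Suc g)
  note K = Suc.prems(1-4) and ab = Suc.prems(5,6) and card = Suc.prems(7) and \<theta> = Suc.prems(8,9)
  have I: "finite I" using K finite_subset by blast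
  define c where "c = 2 ^ Suc g * fact (Suc g) * (fact g :: real)"
  define E where "E k = expect (\<lambda>x. \<theta> x * kernel_power (Suc k) (x a - x b))" for k
  have closed: "expect (\<lambda>x. \<theta> x * kernel (x a - x b) * energy_coeff K x (Suc g) (twice I))
      = c * real (Suc g) * (sine_coeff (Suc g) * E 0)"
  proof -
    obtain d J where J: "I = insert d J" "d \<notin> J" "card J = g"
      using card by (auto simp: card_Suc_eq)
    let ?\<theta> = "\<lambda>x. \<theta> x * kernel (x a - x b)"
    have \<theta>': "bounded_rv ?\<theta>" "free_of ?\<theta> I"
      using \<theta> ab by (auto intro!: bounded_rv_intros free_of_mult_kernel)
    have "expect (\<lambda>x. ?\<theta> x * energy_coeff K x (Suc g) (twice I))
        = expect (\<lambda>x. real (Suc g) * (?\<theta> x * chain_coeff K J d d x))"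
    proof (rule expect_cong)
      fix x assume "x \<in> space points"
      then have "energy_coeff K x (Suc (card J)) (twice (insert d J)) = real (Suc (card J)) * chain_coeff K J d d x"
        by (intro energy_coeff_closed) (use K J in auto)
      then show "?\<theta> x * energy_coeff K x (Suc g) (twice I) = real (Suc g) * (?\<theta> x * chain_coeff K J d d x)"
        using J by (simp only: mult.left_commute)
    qed
    also have "\<dots> = real (Suc g) * expect (\<lambda>x. ?\<theta> x * chain_coeff K J d d x)"
      by (rule integral_mult_right_zero)
    also have "expect (\<lambda>x. ?\<theta> x * chain_coeff K J d d x)
        = 2 ^ g * fact g * fact g * (\<Sum>k\<le>g. sine_coeff (g - k) * expect (\<lambda>x. ?\<theta> x * kernel_power (Suc k) (x d - x d)))"
      by (rule Suc.IH) (use K J ab \<theta>' in \<open>auto simp: free_of_def\<close>)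
    also have "(\<Sum>k\<le>g. sine_coeff (g - k) * expect (\<lambda>x. ?\<theta> x * kernel_power (Suc k) (x d - x d)))
        = (\<Sum>k\<le>g. sine_coeff (g - k) * kernel_power (Suc k) 0) * E 0"
    proof -
      have "expect (\<lambda>x. ?\<theta> x * kernel_power (Suc k) (x d - x d)) = kernel_power (Suc k) 0 * E 0" for k
        by (simp add: E_def kernel_power_1)
      then show ?thesis by (simp add: sum_distrib_right mult.assoc)
    qed
    also have "\<dots> = 2 * real (Suc g) * sine_coeff (Suc g) * E 0"
      by (simp only: sine_coeff_rec)
    finally show ?thesis by (simp only: c_def fact_Suc power_Suc of_nat_mult mult_ac of_nat_Suc) 
  qed
  have open_l: "expect (\<lambda>x. \<theta> x * (kernel (x a - x l) * energy_coeff K x (Suc g) (twice (I - {l}) + {#l, b#})))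
      = c * (\<Sum>k\<le>g. sine_coeff (g - k) * E (Suc k))" if l: "l \<in> I" for l
  proof -
    let ?J = "I - {l}" and ?\<theta> = "\<lambda>x. \<theta> x * kernel (x a - x l)"
    have J: "card ?J = g" using l card I by simp
    have \<theta>': "bounded_rv ?\<theta>" "free_of ?\<theta> ?J"
      using \<theta> ab l by (auto intro!: bounded_rv_intros free_of_mult_kernel)
    have "expect (\<lambda>x. \<theta> x * (kernel (x a - x l) * energy_coeff K x (Suc g) (twice ?J + {#l, b#})))
        = expect (\<lambda>x. 2 * real (Suc g) * (?\<theta> x * chain_coeff K ?J l b x))"
    proof (rule expect_cong)
      fix x assume "x \<in> space points"
      then have "energy_coeff K x (Suc (card ?J)) (twice ?J + {#l, b#}) = 2 * real (Suc (card ?J)) * chain_coeff K ?J l b x"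
        by (intro energy_coeff_open) (use K ab l in auto)
      then show "\<theta> x * (kernel (x a - x l) * energy_coeff K x (Suc g) (twice ?J + {#l, b#}))
          = 2 * real (Suc g) * (?\<theta> x * chain_coeff K ?J l b x)"
        by (simp only: J mult_ac)
    qed
    also have "\<dots> = 2 * real (Suc g) * expect (\<lambda>x. ?\<theta> x * chain_coeff K ?J l b x)"
      by (rule integral_mult_right_zero)
    also have "expect (\<lambda>x. ?\<theta> x * chain_coeff K ?J l b x)
        = 2 ^ g * fact g * fact g * (\<Sum>k\<le>g. sine_coeff (g - k) * expect (\<lambda>x. ?\<theta> x * kernel_power (Suc k) (x l - x b)))"
      by (rule Suc.IH) (use K J ab l \<theta>' in auto)
    also have "(\<Sum>k\<le>g. sine_coeff (g - k) * expect (\<lambda>x. ?\<theta> x * kernel_power (Suc k) (x l - x b)))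
        = (\<Sum>k\<le>g. sine_coeff (g - k) * E (Suc k))"
    proof (rule sum.cong[OF refl])
      fix k
      have "expect (\<lambda>x. ?\<theta> x * kernel_power (Suc k) (x l - x b)) = E (Suc k)"
        unfolding E_def by (rule expect_kernel_convolution) (use \<theta> l ab in \<open>auto simp: free_of_def\<close>)
      then show "sine_coeff (g - k) * expect (\<lambda>x. ?\<theta> x * kernel_power (Suc k) (x l - x b)) = sine_coeff (g - k) * E (Suc k)"
        by simp
    qed
    finally show ?thesis by (simp only: c_def fact_Suc power_Suc of_nat_mult mult_ac of_nat_Suc)
  qed
  have "expect (\<lambda>x. \<theta> x * chain_coeff K I a b x)
      = expect (\<lambda>x. \<theta> x * kernel (x a - x b) * energy_coeff K x (Suc g) (twice I)
        + (\<Sum>l\<in>I. \<theta> x * (kernel (x a - x l) * energy_coeff K x (Suc g) (twice (I - {l}) + {#l, b#}))))"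
    by (simp only: chain_coeff_def card distrib_left sum_distrib_left mult.assoc)
  also have "\<dots> = expect (\<lambda>x. \<theta> x * kernel (x a - x b) * energy_coeff K x (Suc g) (twice I))
      + expect (\<lambda>x. \<Sum>l\<in>I. \<theta> x * (kernel (x a - x l) * energy_coeff K x (Suc g) (twice (I - {l}) + {#l, b#})))"
    by (intro Bochner_Integration.integral_add bounded_rv_integrable bounded_rv_intros \<theta>)
  also have "expect (\<lambda>x. \<Sum>l\<in>I. \<theta> x * (kernel (x a - x l) * energy_coeff K x (Suc g) (twice (I - {l}) + {#l, b#})))
      = (\<Sum>l\<in>I. expect (\<lambda>x. \<theta> x * (kernel (x a - x l) * energy_coeff K x (Suc g) (twice (I - {l}) + {#l, b#}))))"
    by (intro Bochner_Integration.integral_sum bounded_rv_integrable bounded_rv_intros \<theta>)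
  also have "\<dots> = c * real (Suc g) * (\<Sum>k\<le>g. sine_coeff (g - k) * E (Suc k))"
  proof -
    have "(\<Sum>l\<in>I. expect (\<lambda>x. \<theta> x * (kernel (x a - x l) * energy_coeff K x (Suc g) (twice (I - {l}) + {#l, b#}))))
        = (\<Sum>l\<in>I. c * (\<Sum>k\<le>g. sine_coeff (g - k) * E (Suc k)))"
      by (rule sum.cong[OF refl open_l])
    then show ?thesis by (simp add: card mult_ac del: energy_coeff.simps)
  qed
  also have "expect (\<lambda>x. \<theta> x * kernel (x a - x b) * energy_coeff K x (Suc g) (twice I))
        + c * real (Suc g) * (\<Sum>k\<le>g. sine_coeff (g - k) * E (Suc k))
      = c * real (Suc g) * (\<Sum>k\<le>Suc g. sine_coeff (Suc g - k) * E k)"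
    unfolding closed by (subst sum.atMost_Suc_shift) (simp add: distrib_left)
  finally show ?case by (simp add: c_def E_def mult_ac)
qed

lemma expect_energy_coeff_twice:
  assumes "finite K" "I \<subseteq> K"
  shows "expect (\<lambda>x. energy_coeff K x (card I) (twice I)) = 2 ^ card I * fact (card I) * fact (card I) * sine_coeff (card I)"
proof (cases "card I")
  case 0
  interpret prob_space points by (rule prob_space_points)
  have "I = {}" using 0 assms finite_subset by fastforce
  then show ?thesis by (simp add: twice_def sine_coeff_0 prob_space)
next
  case (Suc g)
  interpret prob_space points by (rule prob_space_points)
  obtain d J where J: "I = insert d J" "d \<notin> J" "card J = g" "finite J"
    using Suc unfolding card_Suc_eq_finite by blast
  have "expect (\<lambda>x. energy_coeff K x (card I) (twice I))
      = expect (\<lambda>x. real (Suc g) * (1 * chain_coeff K J d d x))"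
  proof (rule expect_cong)
    fix x assume "x \<in> space points"
    then show "energy_coeff K x (card I) (twice I) = real (Suc g) * (1 * chain_coeff K J d d x)"
      using energy_coeff_closed[of K J d x] assms J by simp
  qed
  also have "\<dots> = real (Suc g) * expect (\<lambda>x. 1 * chain_coeff K J d d x)"
    by (rule integral_mult_right_zero)
  also have "expect (\<lambda>x. 1 * chain_coeff K J d d x)
      = 2 ^ g * fact g * fact g * (\<Sum>k\<le>g. sine_coeff (g - k) * expect (\<lambda>x. 1 * kernel_power (Suc k) (x d - x d)))"
    by (rule expect_chain_coeff) (use assms J in \<open>auto simp: free_of_def bounded_rv_const\<close>)
  also have "(\<Sum>k\<le>g. sine_coeff (g - k) * expect (\<lambda>x. 1 * kernel_power (Suc k) (x d - x d)))
      = 2 * real (Suc g) * sine_coeff (Suc g)"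
    by (simp only: sine_coeff_rec) (simp add: prob_space)
  finally show ?thesis by (simp only: Suc fact_Suc power_Suc of_nat_mult mult_ac of_nat_Suc)
qed

lemma alternating_sum_Pow:
  assumes "finite S"
  shows "(\<Sum>J\<in>Pow S. (-1) ^ card J) = (of_bool (S = {}) :: real)"
  using assms
proof (induction S rule: finite_induct)
  case (insert a S)
  have "(\<Sum>J\<in>Pow (insert a S). (-1) ^ card J) = (\<Sum>J\<in>Pow S. (-1) ^ card J) + (\<Sum>J\<in>insert a ` Pow S. (-1 :: real) ^ card J)"
    unfolding Pow_insert using insert.hyps by (subst sum.union_disjoint) auto
  also have "(\<Sum>J\<in>insert a ` Pow S. (-1 :: real) ^ card J) = (\<Sum>J\<in>Pow S. (-1) ^ card (insert a J))"
    using insert.hyps by (subst sum.reindex) (auto simp: inj_on_def)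
  also have "\<dots> = (\<Sum>J\<in>Pow S. - ((-1) ^ card J))"
  proof (rule sum.cong[OF refl])
    fix J assume "J \<in> Pow S"
    then have "finite J" "a \<notin> J" using insert.hyps finite_subset by auto
    then show "(-1 :: real) ^ card (insert a J) = - ((-1) ^ card J)" by simp
  qed
  finally show ?case by (simp add: sum_negf)
qed simp

lemma sum_Pow_card:
  fixes f :: "nat \<Rightarrow> real"
  assumes "finite S"
  shows "(\<Sum>J\<in>Pow S. f (card J)) = (\<Sum>j\<le>card S. real (card S choose j) * f j)"
proof -
  have "(\<Sum>J\<in>Pow S. f (card J)) = (\<Sum>j\<in>{..card S}. \<Sum>J\<in>{J \<in> Pow S. card J = j}. f (card J))"
    by (rule sum.group[symmetric]) (use assms in \<open>auto intro: card_mono\<close>)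
  also have "\<dots> = (\<Sum>j\<le>card S. real (card S choose j) * f j)"
  proof (rule sum.cong[OF refl])
    fix j
    have "card {J \<in> Pow S. card J = j} = card S choose j"
      using n_subsets[OF assms, of j] by (simp add: Pow_def)
    then show "(\<Sum>J\<in>{J \<in> Pow S. card J = j}. f (card J)) = real (card S choose j) * f j" by simp
  qed
  finally show ?thesis .
qed

text \<open>
  The alternating sum keeps the monomials that contain all of \<open>I\<close>.  Those with a point of multiplicity
  one have mean zero, so that the surviving ones contain each point of \<open>I\<close> at least twice, and there is
  room for this only if \<open>h = card I\<close> and the monomial is \<open>twice I\<close>.
\<close>

lemma energy_power_difference:
  assumes K: "finite K" "I \<subseteq> K" and h: "h \<le> card I"
  shows "(\<Sum>J\<in>Pow I. (-1) ^ card J * expect (\<lambda>x. energy (K - J) (\<lambda>_. 1) x ^ h))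
    = of_bool (h = card I) * expect (\<lambda>x. energy_coeff K x h (twice I))"
proof -
  let ?M = "multisets_of_size K (2 * h)"
  have I: "finite I" using K finite_subset by blast
  have fin: "finite ?M" using K by (intro finite_multisets_of_size)
  let ?N = "\<lambda>\<alpha>. expect (\<lambda>x. energy_coeff K x h \<alpha>)"
  have "expect (\<lambda>x. energy (K - J) (\<lambda>_. 1) x ^ h) = (\<Sum>\<alpha>\<in>?M. of_bool (J \<inter> set_mset \<alpha> = {}) * ?N \<alpha>)" for J
  proof -
    have "expect (\<lambda>x. energy (K - J) (\<lambda>_. 1) x ^ h)
        = (\<Sum>\<alpha>\<in>multisets_of_size (K - J) (2 * h). ?N \<alpha>)"
      using K by (simp add: energy_power_expansion[of K "K - J"] bounded_rv_integrable bounded_rv_energy_coeff)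
    also have "\<dots> = (\<Sum>\<alpha>\<in>?M. of_bool (J \<inter> set_mset \<alpha> = {}) * ?N \<alpha>)"
      by (rule sum.mono_neutral_cong_left) (use fin in \<open>auto simp: multisets_of_size_def\<close>)
    finally show ?thesis .
  qed
  then have "(\<Sum>J\<in>Pow I. (-1) ^ card J * expect (\<lambda>x. energy (K - J) (\<lambda>_. 1) x ^ h))
      = (\<Sum>\<alpha>\<in>?M. \<Sum>J\<in>Pow I. (-1) ^ card J * (of_bool (J \<inter> set_mset \<alpha> = {}) * ?N \<alpha>))"
    by (simp add: sum_distrib_left) (rule sum.swap)
  also have "\<dots> = (\<Sum>\<alpha>\<in>?M. of_bool (I \<subseteq> set_mset \<alpha>) * ?N \<alpha>)"
  proof (rule sum.cong[OF refl])
    fix \<alpha>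
    have "(\<Sum>J\<in>Pow I. (-1) ^ card J * (of_bool (J \<inter> set_mset \<alpha> = {}) * ?N \<alpha>))
        = (\<Sum>J\<in>Pow (I - set_mset \<alpha>). (-1) ^ card J * ?N \<alpha>)"
      by (rule sum.mono_neutral_cong_right) (use I in auto)
    also have "\<dots> = of_bool (I \<subseteq> set_mset \<alpha>) * ?N \<alpha>"
      using I by (simp add: alternating_sum_Pow flip: sum_distrib_right)
    finally show "(\<Sum>J\<in>Pow I. (-1) ^ card J * (of_bool (J \<inter> set_mset \<alpha> = {}) * ?N \<alpha>))
        = of_bool (I \<subseteq> set_mset \<alpha>) * ?N \<alpha>" .
  qed
  also have "\<dots> = (\<Sum>\<alpha>\<in>?M. if \<alpha> = twice I then of_bool (h = card I) * ?N \<alpha> else 0)"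
  proof (rule sum.cong[OF refl])
    fix \<alpha> assume \<alpha>: "\<alpha> \<in> ?M"
    show "of_bool (I \<subseteq> set_mset \<alpha>) * ?N \<alpha> = (if \<alpha> = twice I then of_bool (h = card I) * ?N \<alpha> else 0)"
    proof (cases "I \<subseteq> set_mset \<alpha> \<and> ?N \<alpha> \<noteq> 0")
      case True
      have two: "count \<alpha> a \<ge> 2" if "a \<in> I" for a
      proof -
        have "count \<alpha> a \<noteq> 1"
          using True expect_energy_coeff_single[of K a \<alpha> h] that K by auto
        moreover have "count \<alpha> a \<noteq> 0" using True that by auto
        ultimately show ?thesis by linarith
      qed
      have "twice I \<subseteq># \<alpha>"
        using two I by (auto simp: subseteq_mset_def twice_def count_mset_set' simp flip: numeral_2_eq_2)
      moreover have "size \<alpha> \<le> size (twice I)"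
        using \<alpha> h by (simp add: multisets_of_size_def twice_def)
      ultimately have "\<alpha> = twice I"
        by (metis mset_subset_size not_le subset_mset.le_neq_trans)
      moreover from this have "h = card I"
        using \<alpha> by (auto simp: multisets_of_size_def twice_def)
      ultimately show ?thesis using True by simp
    next
      case False
      then show ?thesis using I by (auto simp: twice_def)
    qed
  qed
  also have "\<dots> = of_bool (h = card I) * ?N (twice I)"
  proof (cases "h = card I")
    case True
    then have "twice I \<in> ?M" using K I by (auto simp: multisets_of_size_def twice_def)
    then show ?thesis using True fin by simp
  qed (auto intro!: sum.neutral)
  finally show ?thesis .
qed

text \<open>
  Of the powers in the binomial expansion of \<open>(energy - 1 / 12) ^ g\<close> only the highest one survives the
  difference.
\<close>

theorem moment_difference:
  assumes K: "finite K" "I \<subseteq> K"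
  shows "(\<Sum>J\<in>Pow I. (-1) ^ card J * moment (card I) (K - J) (\<lambda>_. 1))
    = 2 ^ card I * fact (card I) * fact (card I) * sine_coeff (card I)"
proof -
  let ?g = "card I"
  let ?e = "\<lambda>J x. energy (K - J) (\<lambda>_. 1) x"
  have "moment ?g (K - J) (\<lambda>_. 1)
      = (\<Sum>h\<le>?g. real (?g choose h) * (- 1 / 12) ^ (?g - h) * expect (\<lambda>x. ?e J x ^ h))" for J
  proof -
    have "moment ?g (K - J) (\<lambda>_. 1) = expect (\<lambda>x. (?e J x + (- 1 / 12)) ^ ?g)"
      by (simp add: moment_def)
    also have "\<dots> = expect (\<lambda>x. \<Sum>h\<le>?g. real (?g choose h) * ?e J x ^ h * (- 1 / 12) ^ (?g - h))"
      by (simp only: binomial_ring)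
    also have "\<dots> = (\<Sum>h\<le>?g. expect (\<lambda>x. real (?g choose h) * ?e J x ^ h * (- 1 / 12) ^ (?g - h)))"
      by (intro Bochner_Integration.integral_sum bounded_rv_integrable bounded_rv_intros)
    finally show ?thesis by (simp add: mult_ac)
  qed
  then have "(\<Sum>J\<in>Pow I. (-1) ^ card J * moment ?g (K - J) (\<lambda>_. 1))
      = (\<Sum>h\<le>?g. real (?g choose h) * (- 1 / 12) ^ (?g - h)
          * (\<Sum>J\<in>Pow I. (-1) ^ card J * expect (\<lambda>x. ?e J x ^ h)))"
    by (simp add: sum_distrib_left mult_ac) (subst sum.swap, simp add: mult_ac)
  also have "\<dots> = (\<Sum>h\<le>?g. if h = ?g then expect (\<lambda>x. energy_coeff K x ?g (twice I)) else 0)"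
    by (rule sum.cong[OF refl]) (use K in \<open>auto simp: energy_power_difference\<close>)
  also have "\<dots> = 2 ^ ?g * fact ?g * fact ?g * sine_coeff ?g"
    using expect_energy_coeff_twice[OF K] by simp
  finally show ?thesis .
qed

section \<open>Forests\<close>

text \<open>
  Forests are multisets of trees, so that the sons of a vertex form a forest, and removing a root
  from a forest amounts to replacing it by its sons.
\<close>

definition forest_vertices :: "ltree multiset \<Rightarrow> ltree multiset" where
  "forest_vertices M = \<Sum>\<^sub># (image_mset vertices M)"

definition inner_nodes :: "ltree multiset \<Rightarrow> ltree multiset" where
  "inner_nodes M = {#v \<in># forest_vertices M. sons v \<noteq> {#}#}"

definition leaves :: "ltree multiset \<Rightarrow> ltree multiset" where
  "leaves M = {#v \<in># forest_vertices M. sons v = {#}#}"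

definition increasing_forest :: "ltree multiset \<Rightarrow> bool" where
  "increasing_forest M \<longleftrightarrow> (\<forall>v \<in># inner_nodes M. \<forall>w \<in># inner_nodes (sons v). label v < label w)"

definition signature :: "ltree \<Rightarrow> nat \<times> nat" where
  "signature v = (label v, size (sons v))"

text \<open>
  The forests of increasing trees with leaves \<open>L\<close> whose inner vertices have the labels and numbers of
  sons listed in \<open>w\<close>, which will be sorted by label.
\<close>

definition forests :: "nat set \<Rightarrow> (nat \<times> nat) list \<Rightarrow> ltree multiset set" where
  "forests L w = {M. increasing_forest M \<and> image_mset label (leaves M) = mset_set L
     \<and> image_mset signature (inner_nodes M) = mset w}"

text \<open>
  In contrast to \<open>ml\<close> this counts a leaf as its own descendant: a leaf is a cluster of mass \<open>1\<close>.
\<close>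

definition mass :: "ltree \<Rightarrow> nat" where
  "mass t = size (leaves {#t#})"

definition vertex_weight :: "ltree \<Rightarrow> real" where
  "vertex_weight v
    = (if size (sons v) = 2 then real (ml v) else (real (ml v) ^ 3 - real (ml v)) / 12) / real (label v)"

definition forest_weight :: "ltree multiset \<Rightarrow> real" where
  "forest_weight M = (\<Prod>v \<in># inner_nodes M. vertex_weight v)"

lemma forest_vertices_empty [simp]: "forest_vertices {#} = {#}"
  by (simp add: forest_vertices_def)

lemma forest_vertices_union [simp]: "forest_vertices (M + N) = forest_vertices M + forest_vertices N"
  by (simp add: forest_vertices_def)

lemma vertices_eq: "vertices t = add_mset t (forest_vertices (sons t))"
  by (cases t) (simp add: forest_vertices_def)

lemma forest_vertices_add_mset [simp]:
  "forest_vertices (add_mset t M) = add_mset t (forest_vertices (sons t) + forest_vertices M)"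
  by (simp add: forest_vertices_def vertices_eq)

lemma descendants_eq: "descendants v = forest_vertices (sons v)"
  by (simp add: descendants_def forest_vertices_def)

lemma inner_nodes_empty [simp]: "inner_nodes {#} = {#}"
  by (simp add: inner_nodes_def)

lemma inner_nodes_union [simp]: "inner_nodes (M + N) = inner_nodes M + inner_nodes N"
  by (simp add: inner_nodes_def)

lemma leaves_empty [simp]: "leaves {#} = {#}"
  by (simp add: leaves_def)

lemma leaves_union [simp]: "leaves (M + N) = leaves M + leaves N"
  by (simp add: leaves_def)

lemma inner_nodes_add_mset:
  "inner_nodes (add_mset t M) = (if sons t = {#} then inner_nodes M else add_mset t (inner_nodes (sons t) + inner_nodes M))"
  by (simp add: inner_nodes_def)

lemma leaves_add_mset:
  "leaves (add_mset t M) = (if sons t = {#} then add_mset t (leaves M) else leaves (sons t) + leaves M)"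
  by (simp add: leaves_def)

lemma ml_eq: "ml v = size (leaves (sons v))"
  by (simp add: ml_def leaves_def descendants_eq)

lemma mass_eq: "mass t = (if sons t = {#} then 1 else ml t)"
  by (simp add: mass_def ml_eq leaves_add_mset)

lemma size_leaves: "size (leaves M) = (\<Sum>t\<in>#M. mass t)"
  by (induction M) (simp_all add: mass_eq ml_eq leaves_add_mset)

lemma mass_eq_sum: "sons t \<noteq> {#} \<Longrightarrow> mass t = (\<Sum>s\<in>#sons t. mass s)"
  by (simp add: mass_eq ml_eq size_leaves)

lemma mass_pos: "mass t > 0"
proof (induction t)
  case (Vertex a M)
  show ?case
  proof (cases "M = {#}")
    case False
    then obtain s where "s \<in># M" by auto
    moreover from this have "mass s \<le> (\<Sum>s\<in>#M. mass s)" by (auto dest!: multi_member_split)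
    ultimately show ?thesis using Vertex[of s] False by (simp add: mass_eq_sum)
  qed (simp add: mass_eq)
qed

lemma mset_set_of_count_le_1:
  assumes le_1: "\<And>t. count M t \<le> 1"
  shows "M = mset_set (set_mset M)"
proof (rule multiset_eqI)
  fix t
  show "count M t = count (mset_set (set_mset M)) t"
  proof (cases "t \<in># M")
    case True
    then have "count M t \<ge> 1" by (simp add: Suc_le_eq)
    then have "count M t = 1" using le_1[of t] by linarith
    then show ?thesis using True by simp
  qed (simp add: not_in_iff)
qed

text \<open>
  Equal trees would have equal leaf labels, and every tree has a leaf.
\<close>

lemma forest_distinct:
  assumes "M \<in> forests L w"
  shows "M = mset_set (set_mset M)"
proof -
  have "count M t \<le> 1" for t
  proof (rule ccontr)
    assume "\<not> count M t \<le> 1"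
    then have "{#t, t#} \<subseteq># M" by (auto simp: subseteq_mset_def)
    then obtain N where N: "M = {#t#} + {#t#} + N"
      by (metis add_mset_add_single mset_subset_eq_exists_conv union_mset_add_mset_left)
    obtain v where v: "v \<in># leaves {#t#}"
      using mass_pos[of t] by (metis mass_def multiset_nonemptyE size_empty less_irrefl)
    have "image_mset label (leaves M)
        = image_mset label (leaves {#t#}) + image_mset label (leaves {#t#}) + image_mset label (leaves N)"
      unfolding N by (simp only: leaves_union image_mset_union)
    moreover have "image_mset label (leaves M) = mset_set L" using assms by (simp add: forests_def)
    ultimately have "mset_set L
        = image_mset label (leaves {#t#}) + image_mset label (leaves {#t#}) + image_mset label (leaves N)"
      by simp
    then have "count (mset_set L) (label v) = 2 * count (image_mset label (leaves {#t#})) (label v)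
        + count (image_mset label (leaves N)) (label v)"
      by simp
    moreover have "count (image_mset label (leaves {#t#})) (label v) \<ge> 1"
      using v by (simp add: Suc_le_eq)
    moreover have "count (mset_set L) (label v) \<le> 1" by (simp add: count_mset_set')
    ultimately show False by linarith
  qed
  then show ?thesis by (rule mset_set_of_count_le_1)
qed

lemma forests_Nil:
  assumes "finite L"
  shows "forests L [] = {image_mset (\<lambda>a. Vertex a {#}) (mset_set L)}"
proof -
  have M: "M = image_mset (\<lambda>a. Vertex a {#}) (image_mset label (leaves M))" if "inner_nodes M = {#}" for M
    using that
  proof (induction M)
    case (add t M)
    then show ?case by (cases t) (auto simp: inner_nodes_add_mset leaves_add_mset split: if_splits)
  qed simp
  have "inner_nodes (image_mset (\<lambda>a. Vertex a {#}) A) = {#}" for A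
    by (induction A) (simp_all add: inner_nodes_add_mset)
  moreover have "image_mset label (leaves (image_mset (\<lambda>a. Vertex a {#}) A)) = A" for A
    by (induction A) (simp_all add: leaves_add_mset)
  ultimately show ?thesis using M by (auto simp: forests_def increasing_forest_def) (metis)
qed

text \<open>
  Joining the trees \<open>S\<close> of the forest \<open>N\<close> below a new root with label \<open>p\<close>.
\<close>

definition graft :: "nat \<Rightarrow> ltree multiset \<Rightarrow> ltree multiset \<Rightarrow> ltree multiset" where
  "graft p N S = add_mset (Vertex p S) (N - S)"

lemma inner_nodes_graft:
  assumes "S \<subseteq># N" "S \<noteq> {#}"
  shows "inner_nodes (graft p N S) = add_mset (Vertex p S) (inner_nodes N)"
proof -
  have "inner_nodes N = inner_nodes S + inner_nodes (N - S)"
    using assms(1) inner_nodes_union[of S "N - S"] by (simp add: subset_mset.add_diff_inverse)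
  then show ?thesis using assms by (simp add: graft_def inner_nodes_add_mset)
qed

lemma leaves_graft:
  assumes "S \<subseteq># N" "S \<noteq> {#}"
  shows "leaves (graft p N S) = leaves N"
proof -
  have "leaves N = leaves S + leaves (N - S)"
    using assms(1) leaves_union[of S "N - S"] by (simp add: subset_mset.add_diff_inverse)
  then show ?thesis using assms by (simp add: graft_def leaves_add_mset)
qed

text \<open>
  Since labels increase towards the leaves, the inner vertex with the smallest label is a root.
  Removing it undoes the grafting.
\<close>

lemma bij_betw_graft:
  assumes first: "\<forall>q\<in>fst ` set w. p < q" and a: "a > 0"
  shows "bij_betw (\<lambda>(N, S). graft p N S) (SIGMA N:forests L w. {S. S \<subseteq># N \<and> size S = a})
    (forests L ((p, a) # w))"
proof -
  define root where "root M = (SOME t. t \<in># M \<and> t \<in># inner_nodes M \<and> label t = p)" for M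
  let ?X = "SIGMA N:forests L w. {S. S \<subseteq># N \<and> size S = a}"
  have unique: "t = t'" if M: "M \<in> forests L ((p, a) # w)"
    and t: "t \<in># inner_nodes M" "t' \<in># inner_nodes M" "label t = p" "label t' = p" for M t t'
  proof (rule ccontr)
    assume "t \<noteq> t'"
    then obtain R where R: "inner_nodes M = {#t, t'#} + R"
      using t by (metis insert_DiffM insert_noteq_member add_mset_add_single union_mset_add_mset_left add_cancel_left_left)
    then have "image_mset signature (inner_nodes M) = {#signature t, signature t'#} + image_mset signature R" by simp
    then have "mset ((p, a) # w) = {#signature t, signature t'#} + image_mset signature R"
      using M by (simp add: forests_def)
    then have "image_mset fst (mset ((p, a) # w)) = {#p, p#} + image_mset fst (image_mset signature R)"
      using t by (simp add: signature_def)
    then have "p \<in># image_mset fst (mset w)" by simp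
    then show False using first by fastforce
  qed
  \<comment> \<open>The vertex with label \<open>p\<close> is a root: below another root \<open>r\<close> it would have a larger label than \<open>r\<close>.\<close>
  have ex: "\<exists>t. t \<in># M \<and> t \<in># inner_nodes M \<and> label t = p" if M: "M \<in> forests L ((p, a) # w)" for M
  proof -
    have sig: "image_mset signature (inner_nodes M) = mset ((p, a) # w)" using M by (simp add: forests_def)
    then have "(p, a) \<in># image_mset signature (inner_nodes M)" by simp
    then obtain t where t: "t \<in># inner_nodes M" "label t = p" by (auto simp: signature_def)
    then obtain r where r: "r \<in># M" "t \<in># vertices r" by (auto simp: inner_nodes_def forest_vertices_def)
    obtain M' where M': "M = add_mset r M'" using r by (meson multi_member_split)
    have "t = r"
    proof (rule ccontr)
      assume "t \<noteq> r"
      then have td: "t \<in># forest_vertices (sons r)" using r by (simp add: vertices_eq)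
      then have "sons r \<noteq> {#}" by auto
      then have "r \<in># inner_nodes M" unfolding M' by (simp add: inner_nodes_add_mset)
      moreover have "t \<in># inner_nodes (sons r)" using td t by (simp add: inner_nodes_def)
      ultimately have "label r < p" using M t by (auto simp: forests_def increasing_forest_def)
      moreover have "signature r \<in># mset ((p, a) # w)"
        using \<open>r \<in># inner_nodes M\<close> unfolding sig[symmetric] by simp
      then have "label r = p \<or> label r \<in> fst ` set w" by (force simp: signature_def)
      ultimately show False using first by auto
    qed
    then show ?thesis using t r by auto
  qed
  have root: "root M \<in># M" "root M \<in># inner_nodes M" "label (root M) = p" if "M \<in> forests L ((p, a) # w)" for M
    using someI_ex[OF ex[OF that]] by (auto simp: root_def)
  have size_root: "size (sons (root M)) = a" if M: "M \<in> forests L ((p, a) # w)" for M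
  proof -
    have "signature (root M) \<in># image_mset signature (inner_nodes M)" using root[OF M] by simp
    also have "image_mset signature (inner_nodes M) = mset ((p, a) # w)" using M by (simp add: forests_def)
    finally show ?thesis using root[OF M] first by (force simp: signature_def)
  qed
  show ?thesis
  proof (rule bij_betwI[where g = "\<lambda>M. (M - {#root M#} + sons (root M), sons (root M))"]; (rule Pi_I)?)
    fix M assume M: "M \<in> forests L ((p, a) # w)"
    define T S N where "T = root M" and "S = sons T" and "N = M - {#T#} + S"
    have T: "T \<in># M" "T = Vertex p S" "size S = a" "T \<in># inner_nodes M"
      using root[OF M] size_root[OF M] by (auto simp: T_def S_def)
    have "S \<subseteq># N" unfolding N_def by (rule mset_subset_eq_add_right)
    moreover have "S \<noteq> {#}" using T a by auto
    ultimately have S: "S \<subseteq># N" "S \<noteq> {#}" .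
    have G: "graft p N S = M" using T by (simp add: graft_def N_def)
    then show "(case (M - {#root M#} + sons (root M), sons (root M)) of (N, S) \<Rightarrow> graft p N S) = M"
      by (simp add: N_def S_def T_def)
    have in_M: "inner_nodes M = add_mset T (inner_nodes N)" using inner_nodes_graft[OF S, of p] G T by simp
    have "N \<in> forests L w"
      unfolding forests_def
    proof (intro CollectI conjI)
      show "increasing_forest N" using M in_M by (simp add: forests_def increasing_forest_def)
      show "image_mset label (leaves N) = mset_set L"
        using M leaves_graft[OF S, of p] G by (simp add: forests_def)
      have "add_mset (p, a) (image_mset signature (inner_nodes N)) = add_mset (p, a) (mset w)"
        using M in_M T by (simp add: forests_def signature_def)
      then show "image_mset signature (inner_nodes N) = mset w" by simp
    qed
    then have "(N, S) \<in> ?X" using S T by simp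
    then show "(M - {#root M#} + sons (root M), sons (root M)) \<in> ?X"
      unfolding N_def S_def T_def .
  next
    fix X assume "X \<in> ?X"
    then obtain N S where X: "X = (N, S)" and N: "N \<in> forests L w" and S: "S \<subseteq># N" "size S = a" by auto
    let ?M = "graft p N S" and ?T = "Vertex p S"
    have S0: "S \<noteq> {#}" using S a by auto
    have in_M: "inner_nodes ?M = add_mset ?T (inner_nodes N)" by (rule inner_nodes_graft[OF S(1) S0])
    have M: "?M \<in> forests L ((p, a) # w)"
      unfolding forests_def
    proof (intro CollectI conjI)
      show "increasing_forest ?M"
        unfolding increasing_forest_def
      proof (intro ballI)
        fix v u assume v: "v \<in># inner_nodes ?M" and u: "u \<in># inner_nodes (sons v)"
        show "label v < label u"
        proof (cases "v \<in># inner_nodes N")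
          case True
          then show ?thesis using N u by (auto simp: forests_def increasing_forest_def)
        next
          case False
          then have "v = ?T" using v in_M by simp
          moreover have "inner_nodes N = inner_nodes S + inner_nodes (N - S)"
            using S(1) inner_nodes_union[of S "N - S"] by (simp add: subset_mset.add_diff_inverse)
          ultimately have "u \<in># inner_nodes N" using u by simp
          then have "signature u \<in># image_mset signature (inner_nodes N)" by simp
          also have "image_mset signature (inner_nodes N) = mset w" using N by (simp add: forests_def)
          finally have "label u \<in> fst ` set w" by (force simp: signature_def)
          then have "p < label u" using first by blast
          then show ?thesis using \<open>v = ?T\<close> by simp
        qed
      qed
      show "image_mset label (leaves ?M) = mset_set L"
        using N leaves_graft[OF S(1) S0] by (simp add: forests_def)
      show "image_mset signature (inner_nodes ?M) = mset ((p, a) # w)"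
        using N S in_M by (simp add: forests_def signature_def)
    qed
    then show "(case X of (N, S) \<Rightarrow> graft p N S) \<in> forests L ((p, a) # w)" by (simp add: X)
    have "root ?M = ?T"
      using unique[OF M root(2)[OF M], of ?T] root(3)[OF M] in_M by simp
    then show "((case X of (N, S) \<Rightarrow> graft p N S) - {#root (case X of (N, S) \<Rightarrow> graft p N S)#}
        + sons (root (case X of (N, S) \<Rightarrow> graft p N S)), sons (root (case X of (N, S) \<Rightarrow> graft p N S))) = X"
      using S by (simp add: X graft_def)
  qed
qed


lemma graft_sum_unary:
  fixes F :: "ltree multiset \<Rightarrow> real"
  assumes N: "N = mset_set I" "finite I"
  shows "(\<Sum>S | S \<subseteq># N \<and> size S = 1. F S) = (\<Sum>t\<in>I. F {#t#})"
proof (rule sum.reindex_bij_witness[of _ "\<lambda>t. {#t#}" "\<lambda>S. (THE t. S = {#t#})"])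
  fix S assume "S \<in> {S. S \<subseteq># N \<and> size S = 1}"
  then have S: "S \<subseteq># mset_set I" "size S = 1" using N by auto
  then obtain t where t: "S = {#t#}" using size_1_singleton_mset by blast
  then have "t \<in> I" using set_mset_mono[OF S(1)] N by simp
  with t show "{#THE t. S = {#t#}#} = S" "(THE t. S = {#t#}) \<in> I" "F {#THE t. S = {#t#}#} = F S"
    by auto
qed (use N in auto)

text \<open>
  The trees of \<open>N\<close> are distinct, so the pair \<open>S\<close> together with the choice of one of its elements \<open>t\<close>
  is the same as an ordered pair.
\<close>

lemma graft_sum_binary:
  fixes F :: "ltree multiset \<Rightarrow> real"
  assumes N: "N = mset_set I" "finite I"
  shows "(\<Sum>S | S \<subseteq># N \<and> size S = 2. (\<Sum>t\<in>#S. \<mu> t) * F S) = (\<Sum>s\<in>I. \<Sum>t\<in>I-{s}. \<mu> t * F {#s, t#})"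
proof -
  let ?A = "{S. S \<subseteq># N \<and> size S = 2}"
  have pair: "\<exists>s t. S = {#s, t#} \<and> s \<noteq> t \<and> s \<in> I \<and> t \<in> I" if "S \<in> ?A" for S
  proof -
    have "size S = Suc 1" using that by simp
    then obtain s R where R: "S = add_mset s R" using size_eq_Suc_imp_eq_union by blast
    then have "size R = 1" using that by simp
    then obtain t where S: "S = {#s, t#}" using R size_1_singleton_mset by blast
    then have "{#s, t#} \<subseteq># mset_set I" using that N by simp
    then have "s \<in># mset_set I" "t \<in># mset_set I - {#s#}" by (auto simp: insert_subset_eq_iff)
    then have st: "s \<in> I" "t \<in># mset_set I - {#s#}" using N by auto
    moreover have "mset_set (I - {s}) = mset_set I - {#s#}"
      using N st by (subst mset_set_Diff) auto
    ultimately have "t \<in> I - {s}" using N by (metis finite_Diff finite_set_mset_mset_set)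
    then show ?thesis using S st by auto
  qed
  have fin: "finite ?A"
  proof (rule finite_subset)
    show "?A \<subseteq> (\<lambda>(s, t). {#s, t#}) ` (I \<times> I)" using pair by force
    show "finite ((\<lambda>(s, t). {#s, t#}) ` (I \<times> I))" using N by simp
  qed
  have "(\<Sum>S\<in>?A. (\<Sum>t\<in>#S. \<mu> t) * F S) = (\<Sum>S\<in>?A. \<Sum>t\<in>set_mset S. \<mu> t * F S)"
  proof (rule sum.cong[OF refl])
    fix S assume "S \<in> ?A"
    then obtain s t where "S = {#s, t#}" "s \<noteq> t" using pair by blast
    then show "(\<Sum>t\<in>#S. \<mu> t) * F S = (\<Sum>t\<in>set_mset S. \<mu> t * F S)" by (simp add: algebra_simps)
  qed
  also have "\<dots> = (\<Sum>(S, t)\<in>(SIGMA S:?A. set_mset S). \<mu> t * F S)"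
    using fin by (simp add: sum.Sigma)
  also have "\<dots> = (\<Sum>(s, t)\<in>(SIGMA s:I. I - {s}). \<mu> t * F {#s, t#})"
  proof -
    let ?h = "\<lambda>(s, t). ({#s, t#}, t)"
    have inj: "inj_on ?h (SIGMA s:I. I - {s})" by (auto simp: inj_on_def)
    have img: "?h ` (SIGMA s:I. I - {s}) = (SIGMA S:?A. set_mset S)"
    proof (intro equalityI subsetI)
      fix X assume "X \<in> ?h ` (SIGMA s:I. I - {s})"
      then obtain s t where X: "X = ({#s, t#}, t)" "s \<in> I" "t \<in> I" "t \<noteq> s" by auto
      then have "{#s, t#} = mset_set {s, t}" by simp
      also have "\<dots> \<subseteq># N" unfolding N(1) using X N by (intro subset_imp_msubset_mset_set) auto
      finally show "X \<in> (SIGMA S:?A. set_mset S)" using X by simp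
    next
      fix X assume "X \<in> (SIGMA S:?A. set_mset S)"
      then obtain S u where X: "X = (S, u)" "S \<in> ?A" "u \<in># S" by auto
      then obtain s t where "S = {#s, t#}" "s \<noteq> t" "s \<in> I" "t \<in> I" using pair by blast
      then have "X = ?h (s, t) \<or> X = ?h (t, s)" using X by (auto simp: add_mset_commute)
      then show "X \<in> ?h ` (SIGMA s:I. I - {s})" using \<open>s \<noteq> t\<close> \<open>s \<in> I\<close> \<open>t \<in> I\<close> by blast
    qed
    show ?thesis
      unfolding img[symmetric] sum.reindex[OF inj] by (rule sum.cong) auto
  qed
  also have "\<dots> = (\<Sum>s\<in>I. \<Sum>t\<in>I-{s}. \<mu> t * F {#s, t#})"
    using N by (simp add: sum.Sigma)
  finally show ?thesis .
qed

lemma masses_graft: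
  assumes "S \<subseteq># N" "S \<noteq> {#}"
  shows "image_mset mass (graft p N S) = add_mset (\<Sum>s\<in>#S. mass s) (image_mset mass N - image_mset mass S)"
  using assms by (simp add: graft_def mass_eq_sum image_mset_Diff)

lemma finite_submultisets: "finite {S. S \<subseteq># N \<and> P S}"
proof (rule finite_subset)
  show "{S. S \<subseteq># N \<and> P S} \<subseteq> (\<Union>n\<le>size N. multisets_of_size (set_mset N) n)"
    by (auto simp: multisets_of_size_def size_mset_mono dest: mset_subset_eqD)
qed auto

lemma finite_forests:
  assumes "finite L" "\<forall>e \<in> set w. snd e > 0" "sorted_wrt (<) (map fst w)"
  shows "finite (forests L w)"
  using assms(2,3)
proof (induction w)
  case Nil
  then show ?case using assms(1) by (simp add: forests_Nil)
next
  case (Cons e w)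
  obtain p a where e: "e = (p, a)" by (cases e)
  have "finite (SIGMA N:forests L w. {S. S \<subseteq># N \<and> size S = a})"
    using Cons by (intro finite_SigmaI finite_submultisets) auto
  moreover have "bij_betw (\<lambda>(N, S). graft p N S) (SIGMA N:forests L w. {S. S \<subseteq># N \<and> size S = a})
      (forests L ((p, a) # w))"
    by (rule bij_betw_graft) (use Cons.prems in \<open>auto simp: e\<close>)
  ultimately show ?case using bij_betw_finite e by blast
qed

text \<open>
  By \<open>bij_betw_graft\<close> a forest arises from a smaller one by grafting one or two of its trees below the
  root of smallest label.  The weight of this root and the new masses depend only on the masses of the
  trees, hence the sum over the choices is \<open>event_op\<close>, applied to \<open>\<phi>\<close>.
\<close>

theorem forest_sum:
  assumes "finite L" and w: "\<forall>e \<in> set w. snd e \<in> {1, 2}" "sorted_wrt (<) (map fst w)"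
  shows "(\<Sum>M\<in>forests L w. forest_weight M * \<phi> (image_mset mass M))
    = fold event_op w \<phi> (replicate_mset (card L) 1)"
  using w
proof (induction w arbitrary: \<phi>)
  case Nil
  have "inner_nodes (image_mset (\<lambda>a. Vertex a {#}) A) = {#}" for A
    by (induction A) (simp_all add: inner_nodes_add_mset)
  moreover have "mass (Vertex a {#}) = 1" for a by (simp add: mass_eq)
  ultimately show ?case
    using assms(1) by (simp add: forests_Nil forest_weight_def multiset.map_comp comp_def image_mset_const_eq)
next
  case (Cons e w)
  obtain p a where e: "e = (p, a)" by (cases e)
  have a: "a = 1 \<or> a = 2" and first: "\<forall>q\<in>fst ` set w. p < q"
    using Cons.prems by (auto simp: e)
  have "(\<Sum>M\<in>forests L (e # w). forest_weight M * \<phi> (image_mset mass M))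
      = (\<Sum>(N, S)\<in>(SIGMA N:forests L w. {S. S \<subseteq># N \<and> size S = a}).
          forest_weight (graft p N S) * \<phi> (image_mset mass (graft p N S)))"
    unfolding e using a
    by (subst sum.reindex_bij_betw[OF bij_betw_graft[OF first], symmetric]) (auto simp: case_prod_unfold)
  also have "\<dots> = (\<Sum>N\<in>forests L w. \<Sum>S | S \<subseteq># N \<and> size S = a.
          forest_weight (graft p N S) * \<phi> (image_mset mass (graft p N S)))"
  proof -
    have "finite (forests L w)"
      by (rule finite_forests[OF assms(1)]) (use Cons.prems in force)+
    then show ?thesis by (subst sum.Sigma) (auto intro: finite_submultisets)
  qed
  also have "\<dots> = (\<Sum>N\<in>forests L w. forest_weight N * event_op e \<phi> (image_mset mass N))"
  proof (rule sum.cong[OF refl])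
    fix N assume N: "N \<in> forests L w"
    define I where "I = set_mset N"
    have I: "N = mset_set I" "finite I" using forest_distinct[OF N] by (simp_all add: I_def)
    define G where "G S = \<phi> (add_mset (\<Sum>s\<in>#S. mass s) (image_mset mass N - image_mset mass S))" for S
    have step: "forest_weight (graft p N S) * \<phi> (image_mset mass (graft p N S))
        = forest_weight N * (vertex_weight (Vertex p S) * G S)" if "S \<subseteq># N" "S \<noteq> {#}" for S
      using that by (simp add: forest_weight_def inner_nodes_graft masses_graft G_def mult_ac)
    have ml: "ml (Vertex p S) = (\<Sum>s\<in>#S. mass s)" for S
      by (simp add: ml_eq size_leaves)
    show "(\<Sum>S | S \<subseteq># N \<and> size S = a. forest_weight (graft p N S) * \<phi> (image_mset mass (graft p N S)))
        = forest_weight N * event_op e \<phi> (image_mset mass N)"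
    proof (cases "a = 1")
      case True
      have "(\<Sum>S | S \<subseteq># N \<and> size S = a. forest_weight (graft p N S) * \<phi> (image_mset mass (graft p N S)))
          = (\<Sum>S | S \<subseteq># N \<and> size S = 1. forest_weight N * (vertex_weight (Vertex p S) * G S))"
        using True by (intro sum.cong step) auto
      also have "\<dots> = (\<Sum>t\<in>I. forest_weight N * (vertex_weight (Vertex p {#t#}) * G {#t#}))"
        by (rule graft_sum_unary[OF I])
      also have "\<dots> = (\<Sum>t\<in>I. forest_weight N * ((real (mass t) ^ 3 - real (mass t)) / 12 / real p * \<phi> (image_mset mass N)))"
      proof (rule sum.cong[OF refl])
        fix t assume "t \<in> I"
        then have "t \<in># N" by (simp add: I_def)
        then have "G {#t#} = \<phi> (image_mset mass N)" by (simp add: G_def)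
        then show "forest_weight N * (vertex_weight (Vertex p {#t#}) * G {#t#})
            = forest_weight N * ((real (mass t) ^ 3 - real (mass t)) / 12 / real p * \<phi> (image_mset mass N))"
          by (simp add: vertex_weight_def ml)
      qed
      also have "\<dots> = forest_weight N * (genus_weight (image_mset mass N) * \<phi> (image_mset mass N) / real p)"
        unfolding I(1) genus_weight_image by (simp add: sum_distrib_left sum_distrib_right sum_divide_distrib)
      finally show ?thesis using True by (simp add: e)
    next
      case False
      then have [simp]: "a = 2" using a by simp
      have "(\<Sum>S | S \<subseteq># N \<and> size S = a. forest_weight (graft p N S) * \<phi> (image_mset mass (graft p N S)))
          = (\<Sum>S | S \<subseteq># N \<and> size S = 2. (\<Sum>t\<in>#S. real (mass t)) * (forest_weight N * (G S / real p)))"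
      proof (rule sum.cong)
        fix S assume S: "S \<in> {S. S \<subseteq># N \<and> size S = 2}"
        then have "vertex_weight (Vertex p S) = (\<Sum>t\<in>#S. real (mass t)) / real p"
          by (simp add: vertex_weight_def ml of_nat_sum_mset multiset.map_comp comp_def)
        moreover have "S \<subseteq># N" "S \<noteq> {#}" using S by auto
        ultimately show "forest_weight (graft p N S) * \<phi> (image_mset mass (graft p N S))
            = (\<Sum>t\<in>#S. real (mass t)) * (forest_weight N * (G S / real p))"
          by (simp add: step mult_ac)
      qed simp
      also have "\<dots> = (\<Sum>s\<in>I. \<Sum>t\<in>I-{s}. real (mass t) * (forest_weight N * (G {#s, t#} / real p)))"
        by (rule graft_sum_binary[OF I])
      also have "\<dots> = (\<Sum>s\<in>I. \<Sum>t\<in>I-{s}. real (mass t) * (forest_weight N *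
          (\<phi> (add_mset (mass s + mass t) (image_mset mass (mset_set (I - {s, t})))) / real p)))"
      proof (intro sum.cong refl)
        fix s t assume st: "s \<in> I" "t \<in> I - {s}"
        have "image_mset mass N - image_mset mass {#s, t#} = image_mset mass (N - {#s, t#})"
          using st I by (intro image_mset_Diff[symmetric])
            (auto simp: insert_subset_eq_iff mset_set_Diff[of I "{s}", symmetric, simplified])
        also have "N - {#s, t#} = mset_set (I - {s, t})"
        proof -
          have "s \<noteq> t" using st by auto
          then have "{#s, t#} = mset_set {s, t}" by simp
          then show ?thesis using st I mset_set_Diff[of I "{s, t}"] by (simp only:) auto
        qed
        finally show "real (mass t) * (forest_weight N * (G {#s, t#} / real p))
            = real (mass t) * (forest_weight N *
          (\<phi> (add_mset (mass s + mass t) (image_mset mass (mset_set (I - {s, t})))) / real p))"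
          by (simp add: G_def)
      qed
      also have "\<dots> = forest_weight N * (merge_op \<phi> (image_mset mass N) / real p)"
        unfolding I(1) merge_op_image[OF I(2)] by (simp add: sum_distrib_left sum_divide_distrib mult_ac)
      finally show ?thesis by (simp add: e)
    qed
  qed
  also have "\<dots> = fold event_op w (event_op e \<phi>) (replicate_mset (card L) 1)"
    by (rule Cons.IH) (use Cons.prems in auto)
  finally show ?case by simp
qed

section \<open>Decorated trees\<close>

lemma words_cases:
  assumes "w \<in> words g r"
  obtains "g = 0" "r = 0" "w = []"
  | r' u where "r = Suc r'" "w = u @ [(2 * g + r, 2)]" "u \<in> words g r'"
  | g' u where "g = Suc g'" "w = u @ [(2 * g + r, 1)]" "u \<in> words g' r"
  using assms by (subst (asm) words.simps) (cases r; cases g; fastforce)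

lemma words_properties:
  assumes "w \<in> words g r"
  shows "sorted_wrt (<) (map fst w)" "\<forall>e\<in>set w. snd e \<in> {1, 2} \<and> fst e \<in> {1..2 * g + r}"
    "\<forall>p. (p, 1) \<in> set w \<longrightarrow> p > 1 \<and> p - 1 \<notin> fst ` set w"
    "size {#e \<in># mset w. snd e = 1#} = g" "size {#e \<in># mset w. snd e = 2#} = r"
proof -
  have "sorted_wrt (<) (map fst w) \<and> (\<forall>e\<in>set w. snd e \<in> {1, 2} \<and> fst e \<in> {1..2 * g + r})
    \<and> (\<forall>p. (p, 1) \<in> set w \<longrightarrow> p > 1 \<and> p - 1 \<notin> fst ` set w)
    \<and> size {#e \<in># mset w. snd e = 1#} = g \<and> size {#e \<in># mset w. snd e = 2#} = r"
    using assms
  proof (induction "g + r" arbitrary: g r w rule: less_induct)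
    case less
    from less.prems show ?case
    proof (cases rule: words_cases)
      case 1
      then show ?thesis by simp
    next
      case (2 r' u)
      have IH: "sorted_wrt (<) (map fst u) \<and> (\<forall>e\<in>set u. snd e \<in> {1, 2} \<and> fst e \<in> {1..2 * g + r'})
        \<and> (\<forall>p. (p, 1) \<in> set u \<longrightarrow> p > 1 \<and> p - 1 \<notin> fst ` set u)
        \<and> size {#e \<in># mset u. snd e = 1#} = g \<and> size {#e \<in># mset u. snd e = 2#} = r'"
        by (rule less.hyps) (use 2 in auto)
      then have lt: "\<forall>e\<in>set u. fst e < 2 * g + r" using 2 by fastforce
      have "p - 1 \<noteq> 2 * g + r" if "(p, 1) \<in> set u" for p using lt that by fastforce
      then show ?thesis using IH lt 2 by (auto simp: sorted_wrt_append)
    next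
      case (3 g' u)
      have IH: "sorted_wrt (<) (map fst u) \<and> (\<forall>e\<in>set u. snd e \<in> {1, 2} \<and> fst e \<in> {1..2 * g' + r})
        \<and> (\<forall>p. (p, 1) \<in> set u \<longrightarrow> p > 1 \<and> p - 1 \<notin> fst ` set u)
        \<and> size {#e \<in># mset u. snd e = 1#} = g' \<and> size {#e \<in># mset u. snd e = 2#} = r"
        by (rule less.hyps) (use 3 in auto)
      then have lt: "\<forall>e\<in>set u. fst e < 2 * g + r - 1" using 3 by fastforce
      have "p - 1 \<noteq> 2 * g + r" if "(p, 1) \<in> set u" for p using lt that by fastforce
      moreover have "2 * g + r - 1 \<notin> fst ` set u" using lt by fastforce
      moreover have "fst e < 2 * g + r" "fst e \<in> {1..2 * g + r}" "snd e \<in> {1, 2}" if "e \<in> set u" for e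
        using IH lt that 3 by fastforce+
      ultimately show ?thesis using IH 3 by (auto simp: sorted_wrt_append)
    qed
  qed
  then show "sorted_wrt (<) (map fst w)" "\<forall>e\<in>set w. snd e \<in> {1, 2} \<and> fst e \<in> {1..2 * g + r}"
    "\<forall>p. (p, 1) \<in> set w \<longrightarrow> p > 1 \<and> p - 1 \<notin> fst ` set w"
    "size {#e \<in># mset w. snd e = 1#} = g" "size {#e \<in># mset w. snd e = 2#} = r"
    by blast+
qed

lemma sorted_fst_unique:
  assumes "sorted_wrt (<) (map fst u)" "sorted_wrt (<) (map fst w)" "mset u = mset (w :: (nat \<times> nat) list)"
  shows "u = w"
  using assms
proof (induction u arbitrary: w)
  case (Cons e u)
  then obtain d v where w: "w = d # v" by (cases w) auto
  have s: "set (e # u) = set (d # v)" using Cons.prems(3) w by (metis mset_eq_setD)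
  have "e = d"
  proof (rule ccontr)
    assume "e \<noteq> d"
    then have "e \<in> set v" "d \<in> set u" using s by auto
    then have "fst e < fst d" "fst d < fst e" using Cons.prems w by auto
    then show False by simp
  qed
  then show ?case using Cons w by auto
qed simp

text \<open>
  The labels and the predecessors of the labels in \<open>P1\<close> are \<open>2 * g + r\<close> distinct numbers and so fill up
  \<open>{1..2 * g + r}\<close>.  Therefore the largest number is a label; removing it gives the induction.
\<close>

lemma words_exists:
  assumes "finite P1" "finite P2" "P1 \<inter> P2 = {}" "card P1 = g" "card P2 = r"
    "P1 \<union> P2 \<subseteq> {1..2 * g + r}" "\<forall>a\<in>P1. a > 1 \<and> a - 1 \<notin> P1 \<union> P2"
  shows "\<exists>w\<in>words g r. mset w = image_mset (\<lambda>a. (a, 1)) (mset_set P1) + image_mset (\<lambda>a. (a, 2)) (mset_set P2)"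
  using assms
proof (induction "g + r" arbitrary: g r P1 P2 rule: less_induct)
  case less
  note P = less.prems
  show ?case
  proof (cases "g = 0 \<and> r = 0")
    case True
    then show ?thesis using P by (auto simp: words_0_0)
  next
    case False
    define N where "N = 2 * g + r"
    have "N \<ge> 1" using False by (auto simp: N_def)
    have "N \<in> P1 \<union> P2"
    proof (rule ccontr)
      assume no: "N \<notin> P1 \<union> P2"
      let ?D = "(\<lambda>a. a - 1) ` P1"
      have inj: "inj_on (\<lambda>a. a - 1 :: nat) P1"
        using P(7) by (auto simp: inj_on_def)
      have "(P1 \<union> P2) \<union> ?D \<subseteq> {1..N-1}"
      proof -
        have "a \<in> {1..N-1}" if "a \<in> P1 \<union> P2" for a
        proof -
          have "a \<in> {1..N}" "a \<noteq> N" using P(6) that no by (auto simp: N_def)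
          then show ?thesis by auto
        qed
        then show ?thesis using P(7) by fastforce
      qed
      then have "card ((P1 \<union> P2) \<union> ?D) \<le> N - 1" by (metis card_atLeastAtMost card_mono finite_atLeastAtMost diff_Suc_1)
      moreover have "card ((P1 \<union> P2) \<union> ?D) = card P1 + card P2 + card ?D"
        using P by (subst card_Un_disjoint) (auto simp: card_Un_disjoint)
      moreover have "card ?D = card P1" by (rule card_image[OF inj])
      ultimately show False using P(4,5) \<open>N \<ge> 1\<close> by (simp add: N_def)
    qed
    then consider "N \<in> P2" | "N \<in> P1" by blast
    then show ?thesis
    proof cases
      case 1
      then obtain r' where r: "r = Suc r'" using P(2,5) by (cases r) auto
      have bd: "P1 \<union> (P2 - {N}) \<subseteq> {1..2 * g + r'}"
      proof
        fix a assume a: "a \<in> P1 \<union> (P2 - {N})"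
        then have "a \<in> {1..2 * g + r}" "a \<noteq> N" using P(3,6) 1 by auto
        then show "a \<in> {1..2 * g + r'}" by (auto simp: N_def r)
      qed
      have "\<exists>u\<in>words g r'. mset u = image_mset (\<lambda>a. (a, 1)) (mset_set P1) + image_mset (\<lambda>a. (a, 2)) (mset_set (P2 - {N}))"
        by (rule less.hyps) (use P 1 r bd in auto)
      then obtain u where u: "u \<in> words g r'"
        "mset u = image_mset (\<lambda>a. (a, 1)) (mset_set P1) + image_mset (\<lambda>a. (a, 2)) (mset_set (P2 - {N}))" by blast
      have "u @ [(N, 2)] \<in> words g r" using u(1) r by (subst words.simps) (auto simp: N_def)
      moreover have "mset (u @ [(N, 2)]) = image_mset (\<lambda>a. (a, 1)) (mset_set P1) + image_mset (\<lambda>a. (a, 2)) (mset_set P2)"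
        using u(2) mset_set.remove[OF P(2) 1] by simp
      ultimately show ?thesis by blast
    next
      case 2
      then obtain g' where g: "g = Suc g'" using P(1,4) by (cases g) auto
      have bd: "(P1 - {N}) \<union> P2 \<subseteq> {1..2 * g' + r}"
      proof
        fix a assume a: "a \<in> (P1 - {N}) \<union> P2"
        then have "a \<in> {1..2 * g + r}" "a \<noteq> N" "a \<noteq> N - 1" using P(3,6,7) 2 by auto
        then show "a \<in> {1..2 * g' + r}" by (auto simp: N_def g)
      qed
      have "\<exists>u\<in>words g' r. mset u = image_mset (\<lambda>a. (a, 1)) (mset_set (P1 - {N})) + image_mset (\<lambda>a. (a, 2)) (mset_set P2)"
        by (rule less.hyps) (use P 2 g bd in auto)
      then obtain u where u: "u \<in> words g' r"
        "mset u = image_mset (\<lambda>a. (a, 1)) (mset_set (P1 - {N})) + image_mset (\<lambda>a. (a, 2)) (mset_set P2)" by blast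
      have "u @ [(N, 1)] \<in> words g r" using u(1) g by (subst words.simps) (auto simp: N_def)
      moreover have "mset (u @ [(N, 1)]) = image_mset (\<lambda>a. (a, 1)) (mset_set P1) + image_mset (\<lambda>a. (a, 2)) (mset_set P2)"
        using u(2) mset_set.remove[OF P(1) 2] by simp
      ultimately show ?thesis by blast
    qed
  qed
qed

lemma vertices_eq_forest: "vertices t = forest_vertices {#t#}"
  by (simp add: vertices_eq)

text \<open>
  Each vertex with two sons joins two forests into one and so lowers the number of trees by one.
\<close>

lemma size_leaves_binary:
  assumes "\<forall>v \<in># forest_vertices M. size (sons v) \<le> 2"
  shows "size (leaves M) = size M + size {#v \<in># forest_vertices M. size (sons v) = 2#}"
proof -
  have forest: "size (leaves M) = size M + size {#v \<in># forest_vertices M. size (sons v) = 2#}"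
    if "\<And>t. t \<in># M \<Longrightarrow> size (leaves {#t#}) = 1 + size {#v \<in># forest_vertices {#t#}. size (sons v) = 2#}" for M
    using that
  proof (induction M)
    case (add t M)
    have "leaves (add_mset t M) = leaves {#t#} + leaves M"
      "forest_vertices (add_mset t M) = forest_vertices {#t#} + forest_vertices M"
      using leaves_union[of "{#t#}" M] forest_vertices_union[of "{#t#}" M] by simp_all
    moreover have "size (leaves M) = size M + size {#v \<in># forest_vertices M. size (sons v) = 2#}"
      using add by simp
    moreover have "size (leaves {#t#}) = 1 + size {#v \<in># forest_vertices {#t#}. size (sons v) = 2#}"
      using add.prems[of t] by simp
    ultimately show ?case by (simp only: size_union filter_union_mset size_add_mset)
  qed simp
  have tree: "size (leaves {#t#}) = 1 + size {#v \<in># forest_vertices {#t#}. size (sons v) = 2#}"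
    if "\<forall>v \<in># forest_vertices {#t#}. size (sons v) \<le> 2" for t
    using that
  proof (induction t)
    case (Vertex a M)
    have M: "size (leaves M) = size M + size {#v \<in># forest_vertices M. size (sons v) = 2#}"
    proof (rule forest)
      fix s assume s: "s \<in># M"
      then obtain R where R: "M = add_mset s R" by (meson multi_member_split)
      show "size (leaves {#s#}) = 1 + size {#v \<in># forest_vertices {#s#}. size (sons v) = 2#}"
        by (rule Vertex.IH[OF s]) (use Vertex.prems R in auto)
    qed
    have "size M \<le> 2" using Vertex.prems by simp
    then consider "M = {#}" | "size M = 1" | "size M = 2"
      by (metis One_nat_def le_Suc_eq le_zero_eq numeral_2_eq_2 size_eq_0_iff_empty)
    then show ?case
    proof cases
      case 2
      then have "M \<noteq> {#}" by auto
      then show ?thesis using 2 M by (simp add: leaves_add_mset)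
    next
      case 3
      then have "M \<noteq> {#}" by auto
      then show ?thesis using 3 M by (simp add: leaves_add_mset)
    qed (simp add: leaves_add_mset)
  qed
  show ?thesis
  proof (rule forest, rule tree, rule ballI)
    fix t v assume "t \<in># M" "v \<in># forest_vertices {#t#}"
    then have "v \<in># forest_vertices M" by (auto dest!: multi_member_split)
    then show "size (sons v) \<le> 2" using assms by blast
  qed
qed

declare forest_vertices_add_mset [simp del]

lemma decorated_tree_iff:
  assumes "n \<ge> 1"
  shows "decorated_tree n g t \<longleftrightarrow>
    (\<exists>w\<in>words g (n - 1). {#t#} \<in> forests {1..n} w) \<and>
    (\<forall>v \<in># vertices t. \<forall>u \<in># sons v. sons u = {#} \<longrightarrow> size (sons v) = 2)"
proof -
  let ?V = "forest_vertices {#t#}"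
  define V1 where "V1 = {#v \<in># ?V. size (sons v) = 1#}"
  define V2 where "V2 = {#v \<in># ?V. size (sons v) = 2#}"
  have vs: "vertices_with_sons 0 t = leaves {#t#}" "vertices_with_sons 1 t = V1" "vertices_with_sons 2 t = V2"
    "inner_vertices t = V1 + V2"
    by (simp_all add: vertices_with_sons_def inner_vertices_def leaves_def V1_def V2_def vertices_eq_forest)
  have inner: "inner_nodes {#t#} = V1 + V2" if "\<forall>v \<in># ?V. size (sons v) \<le> 2"
  proof -
    have "inner_nodes {#t#} = {#v \<in># ?V. size (sons v) = 1 \<or> size (sons v) = 2#}"
      unfolding inner_nodes_def
    proof (rule filter_mset_cong[OF refl])
      fix v assume "v \<in># ?V"
      then have "size (sons v) \<le> 2" using that by blast
      then show "(sons v \<noteq> {#}) = (size (sons v) = 1 \<or> size (sons v) = 2)"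
        by (metis One_nat_def le_Suc_eq le_zero_eq numeral_2_eq_2 size_eq_0_iff_empty zero_neq_one zero_neq_numeral)
    qed
    also have "\<dots> = V1 + V2" unfolding V1_def V2_def by (rule multiset_eqI) auto
    finally show ?thesis .
  qed
  have inc: "increasing_forest {#t#} \<longleftrightarrow>
      (\<forall>v' \<in># inner_vertices t. \<forall>v \<in># descendants v'. sons v \<noteq> {#} \<longrightarrow> label v > label v')"
    if "\<forall>v \<in># ?V. size (sons v) \<le> 2"
    unfolding increasing_forest_def vs(4) inner[OF that]
    by (auto simp: descendants_eq inner_nodes_def)
  show ?thesis
  proof
    assume d: "decorated_tree n g t"
    then have le2: "\<forall>v \<in># ?V. size (sons v) \<le> 2"
      unfolding decorated_tree_def vertices_eq_forest by blast
    define A where "A = image_mset label V1"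
    define B where "B = image_mset label V2"
    have AB: "count A a + count B a \<le> 1" for a
      using d by (simp add: decorated_tree_def vs vs(2)[simplified] A_def B_def)
    have AB_set: "A = mset_set (set_mset A)" "B = mset_set (set_mset B)"
    proof -
      have "count A a \<le> 1" "count B a \<le> 1" for a using AB[of a] by linarith+
      then show "A = mset_set (set_mset A)" "B = mset_set (set_mset B)"
        by (blast intro: mset_set_of_count_le_1)+
    qed
    have szA: "size A = g" using d by (simp add: decorated_tree_def vs vs(2)[simplified] A_def)
    have szB: "size B = n - 1"
    proof -
      have "size (leaves {#t#}) = n" using d by (simp add: decorated_tree_def vs)
      then show ?thesis using size_leaves_binary[OF le2, folded V2_def] by (simp add: B_def)
    qed
    have labels: "a \<in> {1..2 * g + (n - 1)}" if "a \<in> set_mset A \<union> set_mset B" for a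
      using d that assms by (auto simp: decorated_tree_def vs vs(2)[simplified] A_def B_def)
    have gaps: "a > 1 \<and> a - 1 \<notin> set_mset A \<union> set_mset B" if "a \<in># A" for a
      using d that by (auto simp: decorated_tree_def vs vs(2)[simplified] A_def B_def)
    have "\<exists>w\<in>words g (n - 1). mset w
        = image_mset (\<lambda>a. (a, 1)) (mset_set (set_mset A)) + image_mset (\<lambda>a. (a, 2)) (mset_set (set_mset B))"
    proof (rule words_exists)
      show "set_mset A \<inter> set_mset B = {}"
      proof (rule ccontr)
        assume "set_mset A \<inter> set_mset B \<noteq> {}"
        then obtain a where "a \<in># A" "a \<in># B" by auto
        then have "count A a \<ge> 1" "count B a \<ge> 1" by (simp_all add: Suc_le_eq)
        then show False using AB[of a] by linarith
      qed
      show "card (set_mset A) = g" using arg_cong[OF AB_set(1), of size] szA by simp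
      show "card (set_mset B) = n - 1" using arg_cong[OF AB_set(2), of size] szB by simp
    qed (use labels gaps in auto)
    then obtain w where w: "w \<in> words g (n - 1)"
      "mset w = image_mset (\<lambda>a. (a, 1)) A + image_mset (\<lambda>a. (a, 2)) B"
      by (auto simp only: AB_set[symmetric])
    have "image_mset signature (inner_nodes {#t#}) = mset w"
      unfolding inner[OF le2] w(2) A_def B_def image_mset_union multiset.map_comp
      by (intro arg_cong2[where f = "(+)"] image_mset_cong) (auto simp: signature_def V1_def V2_def)
    moreover have "image_mset label (leaves {#t#}) = mset_set {1..n}"
      using d by (simp add: decorated_tree_def vs vs(2)[simplified])
    moreover have "increasing_forest {#t#}"
      using d inc[OF le2] by (simp add: decorated_tree_def)
    ultimately have "{#t#} \<in> forests {1..n} w" by (simp add: forests_def)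
    then show "(\<exists>w\<in>words g (n - 1). {#t#} \<in> forests {1..n} w) \<and>
      (\<forall>v \<in># vertices t. \<forall>u \<in># sons v. sons u = {#} \<longrightarrow> size (sons v) = 2)"
      using w(1) d by (auto simp: decorated_tree_def)
  next
    assume *: "(\<exists>w\<in>words g (n - 1). {#t#} \<in> forests {1..n} w) \<and>
      (\<forall>v \<in># vertices t. \<forall>u \<in># sons v. sons u = {#} \<longrightarrow> size (sons v) = 2)"
    then obtain w where w: "w \<in> words g (n - 1)" and t: "{#t#} \<in> forests {1..n} w" by blast
    note wp = words_properties[OF w]
    have sig: "image_mset signature (inner_nodes {#t#}) = mset w" using t by (simp add: forests_def)
    have sig_in: "signature v \<in> set w" if "v \<in># inner_nodes {#t#}" for v
    proof -
      have "signature v \<in># image_mset signature (inner_nodes {#t#})" using that by simp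
      then show ?thesis unfolding sig by simp
    qed
    have le2: "\<forall>v \<in># ?V. size (sons v) \<le> 2"
    proof
      fix v assume v: "v \<in># ?V"
      show "size (sons v) \<le> 2"
      proof (cases "sons v = {#}")
        case False
        then have "signature v \<in> set w" using v by (intro sig_in) (simp add: inner_nodes_def)
        then have "snd (signature v) \<in> {1, 2}" using wp(2) by blast
        then show ?thesis by (auto simp: signature_def)
      qed simp
    qed
    have inn: "inner_nodes {#t#} = inner_vertices t" using inner[OF le2] vs by simp
    have "image_mset label (inner_vertices t) = image_mset fst (image_mset signature (inner_nodes {#t#}))"
      by (simp add: inn multiset.map_comp comp_def signature_def)
    then have lab: "image_mset label (inner_vertices t) = mset (map fst w)" by (simp add: sig)
    have "V1 = {#v \<in># inner_nodes {#t#}. snd (signature v) = 1#}"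
      unfolding V1_def inner_nodes_def filter_filter_mset signature_def
      by (rule filter_mset_cong) auto
    then have sigV1: "image_mset signature V1 = {#e \<in># mset w. snd e = 1#}"
      by (simp only: filter_mset_image_mset flip: sig)
    have szV1: "size V1 = g" using arg_cong[OF sigV1, of size] wp(4) by simp
    have "distinct (map fst w)" using wp(1) strict_sorted_iff by blast
    then have count: "count (image_mset label (inner_vertices t)) a \<le> 1" for a
      unfolding lab using distinct_count_atmost_1[of "map fst w"] by (simp split: if_splits)
    have leafs: "image_mset label (leaves {#t#}) = mset_set {1..n}" using t by (simp add: forests_def)
    have szV0: "size (leaves {#t#}) = n" using arg_cong[OF leafs, of size] by simp
    have range: "label v \<in> {1..2 * g + n - 1}" if "v \<in># inner_vertices t" for v
    proof -
      have "signature v \<in> set w" using that by (intro sig_in) (simp add: inn)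
      then have "fst (signature v) \<in> {1..2 * g + (n - 1)}" using wp(2) by blast
      then show ?thesis using assms by (simp add: signature_def)
    qed
    have gaps: "label v > 1 \<and> label v - 1 \<notin># image_mset label (inner_vertices t)" if "v \<in># V1" for v
    proof -
      have "signature v = (label v, 1)" using that by (simp add: V1_def signature_def)
      moreover have "signature v \<in> set w" using that by (intro sig_in) (simp add: inn vs)
      ultimately have "(label v, 1) \<in> set w" by simp
      then have "label v > 1 \<and> label v - 1 \<notin> fst ` set w" using wp(3) by blast
      then show ?thesis unfolding lab by simp
    qed
    have "increasing_forest {#t#}" using t by (simp add: forests_def)
    then have "\<forall>v' \<in># inner_vertices t. \<forall>v \<in># descendants v'. sons v \<noteq> {#} \<longrightarrow> label v > label v'"
      by (simp only: inc[OF le2])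
    moreover have "\<forall>a \<in># image_mset label V1. a > 1 \<and> a - 1 \<notin># image_mset label (inner_vertices t)"
      using gaps by auto
    moreover have "\<forall>v \<in># vertices t. size (sons v) \<le> 2" using le2 by (simp only: vertices_eq_forest)
    ultimately show "decorated_tree n g t"
      unfolding decorated_tree_def vs(1,2) using szV0 szV1 * leafs range count by simp
  qed
qed

lemma tree_weight_eq_forest_weight:
  assumes w: "w \<in> words g r" and t: "{#t#} \<in> forests {1..n} w"
  shows "tree_weight n g t = forest_weight {#t#} / real n ^ (n + g - 1)"
proof -
  define A where "A k = {#v \<in># forest_vertices {#t#}. size (sons v) = k#}" for k :: nat
  have sizes: "size (sons v) = 1 \<or> size (sons v) = 2" if "v \<in># inner_nodes {#t#}" for v
  proof -
    have "signature v \<in># image_mset signature (inner_nodes {#t#})" using that by simp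
    also have "image_mset signature (inner_nodes {#t#}) = mset w" using t by (simp add: forests_def)
    finally show ?thesis using words_properties(2)[OF w] by (force simp: signature_def)
  qed
  have "inner_nodes {#t#} = {#v \<in># inner_nodes {#t#}. size (sons v) = 1 \<or> size (sons v) = 2#}"
  proof (rule multiset_eqI)
    fix v
    show "count (inner_nodes {#t#}) v
        = count {#v \<in># inner_nodes {#t#}. size (sons v) = 1 \<or> size (sons v) = 2#} v"
      using sizes[of v] by (cases "v \<in># inner_nodes {#t#}") (simp_all only: count_filter_mset not_in_iff if_True if_cancel)
  qed
  also have "\<dots> = {#v \<in># forest_vertices {#t#}. size (sons v) = 1 \<or> size (sons v) = 2#}"
    unfolding inner_nodes_def filter_filter_mset by (rule filter_mset_cong) auto
  also have "\<dots> = A 1 + A 2" unfolding A_def by (rule multiset_eqI) auto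
  finally have "inner_nodes {#t#} = A 1 + A 2" .
  then have "forest_weight {#t#} = (\<Prod>v\<in>#A 1. vertex_weight v) * (\<Prod>v\<in>#A 2. vertex_weight v)"
    by (simp add: forest_weight_def)
  also have "image_mset vertex_weight (A 1)
      = image_mset (\<lambda>v. (real (ml v) ^ 3 - real (ml v)) / (12 * real (label v))) (A 1)"
    by (rule image_mset_cong) (auto simp: A_def vertex_weight_def)
  also have "image_mset vertex_weight (A 2) = image_mset (\<lambda>v. real (ml v) / real (label v)) (A 2)"
    by (rule image_mset_cong) (auto simp: A_def vertex_weight_def)
  finally have F: "forest_weight {#t#}
      = (\<Prod>v\<in>#A 1. (real (ml v) ^ 3 - real (ml v)) / (12 * real (label v))) * (\<Prod>v\<in>#A 2. real (ml v) / real (label v))" .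
  have "vertices_with_sons k t = A k" for k
    by (simp only: vertices_with_sons_def vertices_eq_forest A_def)
  then show ?thesis unfolding tree_weight_def F by simp
qed

text \<open>
  The forests above admit a leaf as an only son.  The factor of its father is \<open>1\<^sup>3 - 1 = 0\<close>, so that the sum
  over the decorated trees may be extended to these trees.
\<close>

lemma tree_weight_zero:
  assumes "v \<in># vertices t" "u \<in># sons v" "sons u = {#}" "size (sons v) = 1"
  shows "tree_weight n g t = 0"
proof -
  obtain u' where "sons v = {#u'#}" using assms(4) size_1_singleton_mset by blast
  then have "sons v = {#u#}" using assms(2) by simp
  then have "ml v = 1" using assms(3) by (simp add: ml_eq leaves_add_mset)
  then have "(real (ml v) ^ 3 - real (ml v)) / (12 * real (label v)) = 0" by simp
  moreover have "v \<in># vertices_with_sons 1 t" using assms by (simp add: vertices_with_sons_def)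
  ultimately have "0 \<in># image_mset (\<lambda>v. (real (ml v) ^ 3 - real (ml v)) / (12 * real (label v))) (vertices_with_sons 1 t)"
    unfolding set_image_mset by (intro image_eqI[of _ _ v]) simp_all
  then have "(\<Prod>v \<in># vertices_with_sons 1 t. (real (ml v) ^ 3 - real (ml v)) / (12 * real (label v))) = 0"
    by (simp only: prod_mset_zero_iff)
  then show ?thesis unfolding tree_weight_def by simp
qed

theorem tree_sum_eq_merge_sum:
  assumes "n \<ge> 1"
  shows "tree_sum g n = merge_sum g (n - 1) (replicate_mset n 1) / real n ^ (n + g - 1)"
proof -
  let ?W = "words g (n - 1)"
  define T where "T w = {t. {#t#} \<in> forests {1..n} w}" for w
  have fin: "finite (forests {1..n} w)" if "w \<in> ?W" for w
    using words_properties(1,2)[OF that] by (intro finite_forests) auto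
  have finT: "finite (T w)" if "w \<in> ?W" for w
    using finite_vimageI[OF fin[OF that], of "\<lambda>t. {#t#}"] by (simp add: T_def vimage_def inj_on_def)
  have T: "{t. decorated_tree n g t} \<subseteq> (\<Union>w\<in>?W. T w)"
    using assms by (auto simp: decorated_tree_iff T_def)
  have zero: "tree_weight n g t = 0" if t: "t \<in> T w" "w \<in> ?W" "\<not> decorated_tree n g t" for t w
  proof -
    obtain v u where vu: "v \<in># vertices t" "u \<in># sons v" "sons u = {#}" "size (sons v) \<noteq> 2"
      using t assms by (auto simp: decorated_tree_iff T_def)
    then have "v \<in># inner_nodes {#t#}" unfolding inner_nodes_def vertices_eq_forest[symmetric] by auto
    then have "signature v \<in># image_mset signature (inner_nodes {#t#})" by simp
    also have "image_mset signature (inner_nodes {#t#}) = mset w" using t by (simp add: forests_def T_def)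
    finally have "size (sons v) = 1" using words_properties(2)[OF t(2)] vu by (force simp: signature_def)
    then show ?thesis using vu by (intro tree_weight_zero)
  qed
  have disj: "T w \<inter> T w' = {}" if "w \<in> ?W" "w' \<in> ?W" "w \<noteq> w'" for w w'
  proof (rule ccontr)
    assume "T w \<inter> T w' \<noteq> {}"
    then obtain t where "{#t#} \<in> forests {1..n} w" "{#t#} \<in> forests {1..n} w'" by (auto simp: T_def)
    then have "mset w = mset w'" by (simp add: forests_def)
    then have "w = w'" using that words_properties(1) by (intro sorted_fst_unique) blast+
    then show False using that(3) by simp
  qed
  have "tree_sum g n = (\<Sum>t\<in>(\<Union>w\<in>?W. T w). tree_weight n g t)"
    unfolding tree_sum_def using T zero finT finite_words
    by (intro sum.mono_neutral_left) auto
  also have "\<dots> = (\<Sum>w\<in>?W. \<Sum>t\<in>T w. tree_weight n g t)"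
    using disj finT finite_words by (intro sum.UNION_disjoint) auto
  also have "\<dots> = (\<Sum>w\<in>?W. (\<Sum>M\<in>forests {1..n} w. forest_weight M * of_bool (size (image_mset mass M) = 1))) / real n ^ (n + g - 1)"
    unfolding sum_divide_distrib[of _ ?W]
  proof (rule sum.cong[OF refl])
    fix w assume w: "w \<in> ?W"
    have "(\<Sum>t\<in>T w. tree_weight n g t) = (\<Sum>t\<in>T w. forest_weight {#t#}) / real n ^ (n + g - 1)"
      unfolding sum_divide_distrib by (rule sum.cong) (use tree_weight_eq_forest_weight[OF w] in \<open>auto simp: T_def\<close>)
    also have "(\<Sum>t\<in>T w. forest_weight {#t#}) = (\<Sum>M\<in>(\<lambda>t. {#t#}) ` T w. forest_weight M)"
      by (subst sum.reindex) (auto simp: inj_on_def)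
    also have "\<dots> = (\<Sum>M\<in>forests {1..n} w. forest_weight M * of_bool (size (image_mset mass M) = 1))"
    proof (rule sum.mono_neutral_cong_left[OF fin[OF w]])
      show "\<forall>M\<in>forests {1..n} w - (\<lambda>t. {#t#}) ` T w. forest_weight M * of_bool (size (image_mset mass M) = 1) = 0"
      proof
        fix M assume M: "M \<in> forests {1..n} w - (\<lambda>t. {#t#}) ` T w"
        have "size M \<noteq> 1"
        proof
          assume "size M = 1"
          then obtain t where "M = {#t#}" using size_1_singleton_mset by blast
          then show False using M by (auto simp: T_def)
        qed
        then show "forest_weight M * of_bool (size (image_mset mass M) = 1) = 0" by simp
      qed
    qed (auto simp: T_def)
    finally show "(\<Sum>t\<in>T w. tree_weight n g t)
        = (\<Sum>M\<in>forests {1..n} w. forest_weight M * of_bool (size (image_mset mass M) = 1)) / real n ^ (n + g - 1)" .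
  qed
  also have "(\<Sum>w\<in>?W. (\<Sum>M\<in>forests {1..n} w. forest_weight M * of_bool (size (image_mset mass M) = 1)))
      = merge_sum g (n - 1) (replicate_mset n 1)"
    unfolding merge_sum_def
  proof (rule sum.cong[OF refl])
    fix w assume w: "w \<in> ?W"
    show "(\<Sum>M\<in>forests {1..n} w. forest_weight M * of_bool (size (image_mset mass M) = 1))
        = fold event_op w (\<lambda>m. of_bool (size m = 1)) (replicate_mset n 1)"
      using forest_sum[of "{1..n}" w "\<lambda>m. of_bool (size m = 1)"] words_properties(1,2)[OF w] by simp
  qed
  finally show ?thesis .
qed

text \<open>
  The leaves are clusters of mass \<open>1\<close>, and the normalization \<open>1 / n ^ (n + g - 1)\<close> cancels the power of the
  total mass in \<open>merge_sum_eq_moment\<close>.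
\<close>

corollary tree_sum_eq_moment:
  assumes "finite K" "card K = n" "n \<ge> 1"
  shows "tree_sum g n = moment g K (\<lambda>_. 1) / (2 ^ g * fact g)"
proof -
  have "merge_sum g (n - 1) (image_mset (\<lambda>_. 1) (mset_set K))
      = real (sum (\<lambda>_. 1) K) ^ (n - 1 + g) / (2 ^ g * fact g) * moment g K (\<lambda>i. real 1)"
    by (rule merge_sum_eq_moment) (use assms in auto)
  moreover have "n - 1 + g = n + g - 1" using assms by simp
  ultimately have "merge_sum g (n - 1) (replicate_mset n 1)
      = real n ^ (n + g - 1) * (moment g K (\<lambda>_. 1) / (2 ^ g * fact g))"
    using assms by (simp add: image_mset_const_eq)
  then show ?thesis using assms by (simp add: tree_sum_eq_merge_sum)
qed

theorem corollary3p2: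
  fixes g n :: nat
  assumes "g \<ge> 1" and "n \<ge> 1"
  shows "(\<Sum>j = 0..g. (-1) ^ j * real (g choose j) * tree_sum g (n + g - j))
       = (2 ^ (2 * g - 1) - 1) * fact g / (2 ^ (2 * g - 1) * fact (2 * g)) * \<bar>bernoulli (2 * g)\<bar>"
proof -
  define I K where "I = {n..<n + g}" and "K = {..<n + g}"
  have I: "finite K" "I \<subseteq> K" "card I = g" by (auto simp: I_def K_def)
  \<comment> \<open>Omitting \<open>j\<close> of the \<open>g\<close> chosen points \<open>I\<close> out of \<open>n + g\<close> points can be done in \<open>g choose j\<close> ways.\<close>
  have "(\<Sum>j = 0..g. (-1) ^ j * real (g choose j) * tree_sum g (n + g - j))
      = (\<Sum>j\<le>card I. real (card I choose j) * ((-1) ^ j * tree_sum g (n + g - j)))"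
    by (simp add: I(3) atLeast0AtMost mult_ac)
  also have "\<dots> = (\<Sum>J\<in>Pow I. (-1) ^ card J * tree_sum g (n + g - card J))"
    by (rule sum_Pow_card[symmetric]) (simp add: I_def)
  also have "\<dots> = (\<Sum>J\<in>Pow I. (-1) ^ card J * moment g (K - J) (\<lambda>_. 1)) / (2 ^ g * fact g)"
    unfolding sum_divide_distrib
  proof (rule sum.cong[OF refl])
    fix J assume "J \<in> Pow I"
    then have J: "J \<subseteq> K" "finite J" "card J \<le> g"
      using I card_mono[of I J] finite_subset[of J I] by (auto simp: I_def)
    then have "card (K - J) = n + g - card J" by (simp add: card_Diff_subset K_def)
    then have "tree_sum g (n + g - card J) = moment g (K - J) (\<lambda>_. 1) / (2 ^ g * fact g)"
      using assms J I by (intro tree_sum_eq_moment) auto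
    then show "(-1) ^ card J * tree_sum g (n + g - card J)
        = (-1) ^ card J * moment g (K - J) (\<lambda>_. 1) / (2 ^ g * fact g)" by simp
  qed
  also have "\<dots> = fact g * sine_coeff g"
    using moment_difference[OF I(1,2)] I(3) by simp
  also have "\<dots> = (2 ^ (2 * g - 1) - 1) * fact g / (2 ^ (2 * g - 1) * fact (2 * g)) * \<bar>bernoulli (2 * g)\<bar>"
  proof -
    define p where "p = (2 :: real) ^ (2 * g - 1)"
    have "2 ^ (2 * g) = 2 * p"
      using assms by (simp add: p_def flip: power_Suc)
    then have "2 * (1 / 2) ^ (2 * g) = 1 / p" by (simp add: power_one_over)
    then have "sine_coeff g = (-1) ^ (g + 1) * (1 - 1 / p) * bern (2 * g)"
      by (simp add: sine_coeff_def csch_coeff_def algebra_simps)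
    moreover have "p > 0" by (simp add: p_def)
    moreover have "f * (s * (1 - 1 / p) * b) = (p - 1) * f / (p * h) * (s * h * b)" if "h > 0" for f s b h :: real
      using that \<open>p > 0\<close> by (simp add: field_simps)
    ultimately have "fact g * sine_coeff g
        = (p - 1) * fact g / (p * fact (2 * g)) * ((-1) ^ (g + 1) * fact (2 * g) * bern (2 * g))"
      by simp
    then show ?thesis unfolding p_def abs_bernoulli_even[OF assms(1)] .
  qed
  finally show ?thesis .
qed

end
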